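(* Let $k$ be an algebraically closed field of characteristic $0$, let $\mathbb{G}=(G,g,\chi,\mu)$ be a group datum over $k$, and let $H=A(\mathbb{G})$ be the associated non-semisimple monomial Hopf algebra. Let $A$ and $B$ be two (right) $H$-Galois objects. If $I_H(A)=I_H(B)$, then $A$ and $B$ are isomorphic as $H$-comodule algebras.
   Context: Throughout, $k$ is an algebraically closed field of characteristic $0$; algebras are associative and unital over $k$; $o(\cdot)$ denotes multiplicative order. **Group datum.** A group datum is a quadruple $\mathbb{G}=(G,g,\chi,\mu)$ where $G$ is a finite group, $g$ is an element of the center of $G$, $\chi\colon G\to k^{\times}$ is a one-dimensional representation with $\chi(g)\neq 1$, and $\mu\in k$ is such that $\mu=0$ if $o(g)=o(\chi(g))$, and if $\mu\neq 0$ then $\chi^{o(\chi(g))}=1$. Put $d=o(\chi(g))$. **The Hopf algebra $A(\mathbb{G})$.** It is the algebra generated by the elements $x\in G$ (multiplying as in $G$) and an element $y$, with relations $yx=\chi(x)xy$ for all $x\in G$ and $y^d=\mu(1-g^d)$. Its Hopf structure is given by $\Delta(y)=1\otimes y+y\otimes g$, $\varepsilon(y)=0$, $S(y)=-yg^{-1}$, and $\Delta(x)=x\otimes x$, $\varepsilon(x)=1$, $S(x)=x^{-1}$ for $x\in G$. The elements $xy^i$ ($x\in G$, $0\le i\le d-1$) form a basis. The algebras $A(\mathbb{G})$ are precisely the non-semisimple monomial Hopf algebras. **Galois objects.** A (right) $H$-comodule algebra $A$ with coaction $\rho\colon A\to A\otimes H$ (an algebra map) is an $H$-Galois object if $A^{coH}=\{a\in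 A\mid \rho(a)=a\otimes 1_H\}\cong k$ (i.e. equals $k1_A$) and the map $A\otimes A\to A\otimes H$, $a\otimes b\mapsto (a\otimes 1_H)\rho(b)$, is a linear isomorphism. **Polynomial $H$-identities.** For each $i=1,2,\ldots$ let $X_i^H$ be a copy of the vector space $H$, with elements denoted $X_i^x$ ($x\in H$, linear in $x$). Let $T=T\big(\bigoplus_{i\ge1}X_i^H\big)$ be the tensor algebra. It is a right $H$-comodule algebra with coaction determined by $\delta(X_i^x)=X_i^{x_1}\otimes x_2$ (where $\Delta(x)=x_1\otimes x_2$ in Sweedler notation). An element $P\in T$ is a polynomial $H$-identity for an $H$-comodule algebra $A$ if $\mu(P)=0$ for every $H$-comodule algebra map $\mu\colon T\to A$. The set of all of these is $I_H(A)=\bigcap_{\mu\colon T\to A}\ker\mu$. *)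

theory Defs
  imports
    "HOL-Algebra.Multiplicative_Group"
    "HOL-Computational_Algebra.Polynomial"
    "HOL-Library.Poly_Mapping"
begin

section \<open>Algebras and tensor products over a field\<close>

locale k_algebra = vector_space scale
  for scale :: "'k::field \<Rightarrow> 'a::ring_1 \<Rightarrow> 'a" +
  assumes scale_mult_left: "scale c (x * y) = scale c x * y"
    and scale_mult_right: "scale c (x * y) = x * scale c y"

definition algebra_hom ::
  "('k::field \<Rightarrow> 'a::ring_1 \<Rightarrow> 'a) \<Rightarrow> ('k \<Rightarrow> 'b::ring_1 \<Rightarrow> 'b) \<Rightarrow> ('a \<Rightarrow> 'b) \<Rightarrow> bool" where
  "algebra_hom sA sB f \<longleftrightarrow>
     Vector_Spaces.linear sA sB f \<and> f 1 = 1 \<and> (\<forall>x y. f (x * y) = f x * f y)"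

definition bilinear_form ::
  "('k::field \<Rightarrow> 'v::ab_group_add \<Rightarrow> 'v) \<Rightarrow> ('k \<Rightarrow> 'w::ab_group_add \<Rightarrow> 'w) \<Rightarrow> ('v \<Rightarrow> 'w \<Rightarrow> 'k) \<Rightarrow> bool" where
  "bilinear_form sV sW \<beta> \<longleftrightarrow>
     (\<forall>v. Vector_Spaces.linear sW (*) (\<beta> v)) \<and> (\<forall>w. Vector_Spaces.linear sV (*) (\<lambda>v. \<beta> v w))"

definition trilinear_form ::
  "('k::field \<Rightarrow> 'u::ab_group_add \<Rightarrow> 'u) \<Rightarrow> ('k \<Rightarrow> 'v::ab_group_add \<Rightarrow> 'v) \<Rightarrow> ('k \<Rightarrow> 'w::ab_group_add \<Rightarrow> 'w) \<Rightarrow>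
   ('u \<Rightarrow> 'v \<Rightarrow> 'w \<Rightarrow> 'k) \<Rightarrow> bool" where
  "trilinear_form sU sV sW \<gamma> \<longleftrightarrow>
     (\<forall>u v. Vector_Spaces.linear sW (*) (\<gamma> u v)) \<and>
     (\<forall>u w. Vector_Spaces.linear sV (*) (\<lambda>v. \<gamma> u v w)) \<and>
     (\<forall>v w. Vector_Spaces.linear sU (*) (\<lambda>u. \<gamma> u v w))"

text \<open>
  Over a field, \<open>V \<otimes> W\<close> embeds into the dual of the space of bilinear forms on \<open>V \<times> W\<close> by letting
  \<open>v \<otimes> w\<close> act as evaluation at \<open>(v, w)\<close>.  The tensor product is taken to be the image of this
  embedding, so that equality of tensors is equality of functions; tensors are given the value 0 at
  functions that are not bilinear.  A list \<open>[(v\<^sub>1, w\<^sub>1), \<dots>]\<close> stands for the sum of the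
  \<open>v\<^sub>i \<otimes> w\<^sub>i\<close>.  The lemma \<open>tensor_universal\<close> below is the universal property.
\<close>

type_synonym ('k, 'v, 'w) tensor = "('v \<Rightarrow> 'w \<Rightarrow> 'k) \<Rightarrow> 'k"

definition tensor_of ::
  "('k::field \<Rightarrow> 'v::ab_group_add \<Rightarrow> 'v) \<Rightarrow> ('k \<Rightarrow> 'w::ab_group_add \<Rightarrow> 'w) \<Rightarrow>
   ('v \<times> 'w) list \<Rightarrow> ('k, 'v, 'w) tensor" where
  "tensor_of sV sW ps = (\<lambda>\<beta>. if bilinear_form sV sW \<beta> then (\<Sum>(v, w)\<leftarrow>ps. \<beta> v w) else 0)"

abbreviation pure ::
  "('k::field \<Rightarrow> 'v::ab_group_add \<Rightarrow> 'v) \<Rightarrow> ('k \<Rightarrow> 'w::ab_group_add \<Rightarrow> 'w) \<Rightarrow>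
   'v \<Rightarrow> 'w \<Rightarrow> ('k, 'v, 'w) tensor" where
  "pure sV sW v w \<equiv> tensor_of sV sW [(v, w)]"

definition tensor_space ::
  "('k::field \<Rightarrow> 'v::ab_group_add \<Rightarrow> 'v) \<Rightarrow> ('k \<Rightarrow> 'w::ab_group_add \<Rightarrow> 'w) \<Rightarrow> ('k, 'v, 'w) tensor set" where
  "tensor_space sV sW = range (tensor_of sV sW)"

definition pure3 ::
  "('k::field \<Rightarrow> 'u::ab_group_add \<Rightarrow> 'u) \<Rightarrow> ('k \<Rightarrow> 'v::ab_group_add \<Rightarrow> 'v) \<Rightarrow> ('k \<Rightarrow> 'w::ab_group_add \<Rightarrow> 'w) \<Rightarrow>
   'u \<Rightarrow> 'v \<Rightarrow> 'w \<Rightarrow> ('u \<Rightarrow> 'v \<Rightarrow> 'w \<Rightarrow> 'k) \<Rightarrow> 'k" where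
  "pure3 sU sV sW u v w = (\<lambda>\<gamma>. if trilinear_form sU sV sW \<gamma> then \<gamma> u v w else 0)"

text \<open>
  The linear map on \<open>V \<otimes> W\<close> induced by a bilinear map \<open>\<phi>\<close> on \<open>V \<times> W\<close> whose values are themselves
  tensors, that is, functionals on forms: \<open>tensor_ext \<phi> (v \<otimes> w) = \<phi> v w\<close>.
\<close>

definition tensor_ext :: "('v \<Rightarrow> 'w \<Rightarrow> 'form \<Rightarrow> 'k) \<Rightarrow> ('k, 'v, 'w) tensor \<Rightarrow> 'form \<Rightarrow> 'k" where
  "tensor_ext \<phi> u = (\<lambda>\<beta>. u (\<lambda>v w. \<phi> v w \<beta>))"

definition tensor_map ::
  "('k::field \<Rightarrow> 'c::ab_group_add \<Rightarrow> 'c) \<Rightarrow> ('k \<Rightarrow> 'd::ab_group_add \<Rightarrow> 'd) \<Rightarrow> ('v \<Rightarrow> 'c) \<Rightarrow> ('w \<Rightarrow> 'd) \<Rightarrow>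
   ('k, 'v, 'w) tensor \<Rightarrow> ('k, 'c, 'd) tensor" where
  "tensor_map sC sD f h = tensor_ext (\<lambda>v w. pure sC sD (f v) (h w))"

definition tensor_mult ::
  "('k::field \<Rightarrow> 'a::ring_1 \<Rightarrow> 'a) \<Rightarrow> ('k \<Rightarrow> 'b::ring_1 \<Rightarrow> 'b) \<Rightarrow>
   ('k, 'a, 'b) tensor \<Rightarrow> ('k, 'a, 'b) tensor \<Rightarrow> ('k, 'a, 'b) tensor" where
  "tensor_mult sA sB u u' =
     tensor_ext (\<lambda>a b. tensor_ext (\<lambda>a' b'. pure sA sB (a * a') (b * b')) u') u"

definition algebra_hom_to_tensor ::
  "('k::field \<Rightarrow> 'c::ring_1 \<Rightarrow> 'c) \<Rightarrow> ('k \<Rightarrow> 'a::ring_1 \<Rightarrow> 'a) \<Rightarrow> ('k \<Rightarrow> 'b::ring_1 \<Rightarrow> 'b) \<Rightarrow>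
   ('c \<Rightarrow> ('k, 'a, 'b) tensor) \<Rightarrow> bool" where
  "algebra_hom_to_tensor sC sA sB \<rho> \<longleftrightarrow>
     range \<rho> \<subseteq> tensor_space sA sB \<and>
     (\<forall>x y. \<rho> (x + y) = (\<lambda>\<beta>. \<rho> x \<beta> + \<rho> y \<beta>)) \<and>
     (\<forall>c x. \<rho> (sC c x) = (\<lambda>\<beta>. c * \<rho> x \<beta>)) \<and>
     \<rho> 1 = pure sA sB 1 1 \<and>
     (\<forall>x y. \<rho> (x * y) = tensor_mult sA sB (\<rho> x) (\<rho> y))"

lemma vector_space_times: "vector_space ((*) :: 'k::field \<Rightarrow> 'k \<Rightarrow> 'k)"
  by unfold_locales (simp_all add: algebra_simps)

lemma separating_functional:
  fixes sX :: "'k::field \<Rightarrow> 'x::ab_group_add \<Rightarrow> 'x"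
  assumes "vector_space sX" and "z \<noteq> 0"
  shows "\<exists>l. Vector_Spaces.linear sX (*) l \<and> l z \<noteq> 0"
proof -
  interpret X: vector_space sX by fact
  interpret P: vector_space_pair sX "(*) :: 'k \<Rightarrow> 'k \<Rightarrow> 'k"
    using assms(1) vector_space_times by (simp add: vector_space_pair_def)
  have ind: "X.independent {z}" using assms(2) by simp
  have "P.construct {z} (\<lambda>_. 1) z = 1" by (rule P.construct_basis[OF ind]) simp
  with P.linear_construct[OF ind, of "\<lambda>_. 1"] show ?thesis by (intro exI[of _ "P.construct {z} (\<lambda>_. 1)"]) simp
qed

lemma tensor_universal:
  fixes sV :: "'k::field \<Rightarrow> 'v::ab_group_add \<Rightarrow> 'v" and sW :: "'k \<Rightarrow> 'w::ab_group_add \<Rightarrow> 'w"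
    and sX :: "'k \<Rightarrow> 'x::ab_group_add \<Rightarrow> 'x" and \<phi> :: "'v \<Rightarrow> 'w \<Rightarrow> 'x"
  assumes l1: "\<And>v. Vector_Spaces.linear sW sX (\<phi> v)" and l2: "\<And>w. Vector_Spaces.linear sV sX (\<lambda>v. \<phi> v w)"
    and eq: "tensor_of sV sW ps = tensor_of sV sW qs"
  shows "(\<Sum>(v, w)\<leftarrow>ps. \<phi> v w) = (\<Sum>(v, w)\<leftarrow>qs. \<phi> v w)"
proof (rule ccontr)
  let ?z = "(\<Sum>(v, w)\<leftarrow>ps. \<phi> v w) - (\<Sum>(v, w)\<leftarrow>qs. \<phi> v w)"
  assume "\<not> ?thesis"
  then have "?z \<noteq> 0" by simp
  moreover have "vector_space sX" using l1 by (simp add: Vector_Spaces.linear_def)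
  ultimately obtain l where l: "Vector_Spaces.linear sX (*) l" and lz: "l ?z \<noteq> 0"
    using separating_functional by blast
  interpret L: Vector_Spaces.linear sX "(*)" l by fact
  have "bilinear_form sV sW (\<lambda>v w. l (\<phi> v w))"
    unfolding bilinear_form_def using Vector_Spaces.linear_compose[OF l1 l] Vector_Spaces.linear_compose[OF l2 l]
    by (simp add: o_def)
  then have "(\<Sum>(v, w)\<leftarrow>ps. l (\<phi> v w)) = (\<Sum>(v, w)\<leftarrow>qs. l (\<phi> v w))"
    using fun_cong[OF eq, of "\<lambda>v w. l (\<phi> v w)"] by (simp add: tensor_of_def)
  moreover have "l (\<Sum>(v, w)\<leftarrow>rs. \<phi> v w) = (\<Sum>(v, w)\<leftarrow>rs. l (\<phi> v w))" for rs
    by (induction rs) (auto simp: L.add)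
  ultimately show False using lz by (simp add: L.diff)
qed

lemma tensor_mult_pure:
  assumes "k_algebra sA" and "k_algebra sB"
  shows "tensor_mult sA sB (pure sA sB a b) (pure sA sB a' b') = pure sA sB (a * a') (b * b')"
proof
  fix \<beta>
  interpret A: k_algebra sA by fact
  interpret B: k_algebra sB by fact
  have A: "Vector_Spaces.linear sA sA ((*) x)" "Vector_Spaces.linear sA sA (\<lambda>z. z * x)" for x
    by unfold_locales (simp_all add: algebra_simps A.scale_mult_left flip: A.scale_mult_right)
  have B: "Vector_Spaces.linear sB sB ((*) x)" "Vector_Spaces.linear sB sB (\<lambda>z. z * x)" for x
    by unfold_locales (simp_all add: algebra_simps B.scale_mult_left flip: B.scale_mult_right)
  show "tensor_mult sA sB (pure sA sB a b) (pure sA sB a' b') \<beta> = pure sA sB (a * a') (b * b') \<beta>"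
  proof (cases "bilinear_form sA sB \<beta>")
    case True
    then have lin: "Vector_Spaces.linear sB (*) (\<beta> v)" "Vector_Spaces.linear sA (*) (\<lambda>v. \<beta> v w)" for v w
      by (auto simp: bilinear_form_def)
    have *: "bilinear_form sA sB (\<lambda>x y. \<beta> (c * x) (d * y))" for c d
      unfolding bilinear_form_def
      using Vector_Spaces.linear_compose[OF A(1) lin(2)] Vector_Spaces.linear_compose[OF B(1) lin(1)]
      by (auto simp: o_def)
    have "bilinear_form sA sB (\<lambda>x y. \<beta> (x * c) (y * d))" for c d
      unfolding bilinear_form_def
      using Vector_Spaces.linear_compose[OF A(2) lin(2)] Vector_Spaces.linear_compose[OF B(2) lin(1)]
      by (auto simp: o_def)
    with * True show ?thesis by (simp add: tensor_mult_def tensor_ext_def tensor_of_def)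
  next
    case False
    then show ?thesis by (simp add: tensor_mult_def tensor_ext_def tensor_of_def)
  qed
qed

section \<open>Presentations by generators and relations\<close>

datatype 's free_word = Free_Word (letters: "'s list")

instantiation free_word :: (type) monoid_add
begin
definition zero_free_word :: "'a free_word" where "0 = Free_Word []"
definition plus_free_word :: "'a free_word \<Rightarrow> 'a free_word \<Rightarrow> 'a free_word" where
  "u + v = Free_Word (letters u @ letters v)"
instance by standard (simp_all add: zero_free_word_def plus_free_word_def)
end

text \<open>The ring structure on finitely supported functions on words is convolution over concatenation.\<close>

type_synonym ('k, 's) free_alg = "'s free_word \<Rightarrow>\<^sub>0 'k"

definition gen :: "'s \<Rightarrow> ('k::field, 's) free_alg" where
  "gen s = Poly_Mapping.single (Free_Word [s]) 1"

definition const :: "'k::field \<Rightarrow> ('k, 's) free_alg" where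
  "const c = Poly_Mapping.single 0 c"

definition free_alg_on :: "'s set \<Rightarrow> ('k::field, 's) free_alg set" where
  "free_alg_on S = {p. \<forall>w \<in> Poly_Mapping.keys p. set (letters w) \<subseteq> S}"

definition free_eval ::
  "('k::field \<Rightarrow> 'a::ring_1 \<Rightarrow> 'a) \<Rightarrow> ('s \<Rightarrow> 'a) \<Rightarrow> ('k, 's) free_alg \<Rightarrow> 'a" where
  "free_eval sA f p =
     (\<Sum>w \<in> Poly_Mapping.keys p. sA (Poly_Mapping.lookup p w) (prod_list (map f (letters w))))"

inductive_set ideal_on :: "'s set \<Rightarrow> ('k::field, 's) free_alg set \<Rightarrow> ('k, 's) free_alg set"
  for S R where
  zero: "0 \<in> ideal_on S R"
| mult: "r \<in> R \<Longrightarrow> p \<in> free_alg_on S \<Longrightarrow> q \<in> free_alg_on S \<Longrightarrow> p * r * q \<in> ideal_on S R"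
| add: "p \<in> ideal_on S R \<Longrightarrow> q \<in> ideal_on S R \<Longrightarrow> p + q \<in> ideal_on S R"

text \<open>
  The algebra is generated by the family \<open>f\<close>, indexed by \<open>S\<close>, with relations \<open>r = 0\<close> for \<open>r \<in> R\<close>:
  evaluation identifies it with the quotient of the free algebra on \<open>S\<close> by the two-sided ideal
  generated by \<open>R\<close>.
\<close>

definition presented_by ::
  "('k::field \<Rightarrow> 'a::ring_1 \<Rightarrow> 'a) \<Rightarrow> ('s \<Rightarrow> 'a) \<Rightarrow> 's set \<Rightarrow> ('k, 's) free_alg set \<Rightarrow> bool" where
  "presented_by sA f S R \<longleftrightarrow>
     k_algebra sA \<and>
     free_eval sA f ` free_alg_on S = UNIV \<and>
     {p \<in> free_alg_on S. free_eval sA f p = 0} = ideal_on S R"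

section \<open>Hopf algebras, comodule algebras and Galois objects\<close>

text \<open>
  The conditions quantifying over lists \<open>ps\<close> are Sweedler notation: \<open>ps\<close> is any way of writing the
  coproduct (or coaction) as a sum of pure tensors.
\<close>

locale hopf_algebra = k_algebra sH
  for sH :: "'k::field \<Rightarrow> 'h::ring_1 \<Rightarrow> 'h"
    and \<Delta> :: "'h \<Rightarrow> ('k, 'h, 'h) tensor"
    and \<epsilon> :: "'h \<Rightarrow> 'k"
    and S :: "'h \<Rightarrow> 'h" +
  assumes comult_hom: "algebra_hom_to_tensor sH sH sH \<Delta>"
    and counit_hom: "algebra_hom sH (*) \<epsilon>"
    and coassoc: "tensor_ext (\<lambda>a b. tensor_ext (\<lambda>a' a''. pure3 sH sH sH a' a'' b) (\<Delta> a)) (\<Delta> h)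
        = tensor_ext (\<lambda>a b. tensor_ext (\<lambda>b' b''. pure3 sH sH sH a b' b'') (\<Delta> b)) (\<Delta> h)"
    and counit_left: "\<Delta> h = tensor_of sH sH ps \<Longrightarrow> (\<Sum>(a, b)\<leftarrow>ps. sH (\<epsilon> a) b) = h"
    and counit_right: "\<Delta> h = tensor_of sH sH ps \<Longrightarrow> (\<Sum>(a, b)\<leftarrow>ps. sH (\<epsilon> b) a) = h"
    and antipode_linear: "Vector_Spaces.linear sH sH S"
    and antipode_left: "\<Delta> h = tensor_of sH sH ps \<Longrightarrow> (\<Sum>(a, b)\<leftarrow>ps. S a * b) = sH (\<epsilon> h) 1"
    and antipode_right: "\<Delta> h = tensor_of sH sH ps \<Longrightarrow> (\<Sum>(a, b)\<leftarrow>ps. a * S b) = sH (\<epsilon> h) 1"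

locale comodule_algebra = k_algebra sA
  for sH :: "'k::field \<Rightarrow> 'h::ring_1 \<Rightarrow> 'h"
    and \<Delta> :: "'h \<Rightarrow> ('k, 'h, 'h) tensor"
    and \<epsilon> :: "'h \<Rightarrow> 'k"
    and sA :: "'k \<Rightarrow> 'a::ring_1 \<Rightarrow> 'a"
    and \<rho> :: "'a \<Rightarrow> ('k, 'a, 'h) tensor" +
  assumes coaction_hom: "algebra_hom_to_tensor sA sA sH \<rho>"
    and coaction_coassoc:
      "tensor_ext (\<lambda>a h. tensor_ext (\<lambda>a' h'. pure3 sA sH sH a' h' h) (\<rho> a)) (\<rho> x)
        = tensor_ext (\<lambda>a h. tensor_ext (\<lambda>h' h''. pure3 sA sH sH a h' h'') (\<Delta> h)) (\<rho> x)"
    and coaction_counit: "\<rho> x = tensor_of sA sH ps \<Longrightarrow> (\<Sum>(a, h)\<leftarrow>ps. sA (\<epsilon> h) a) = x"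

definition comodule_algebra_hom ::
  "('k::field \<Rightarrow> 'h::ring_1 \<Rightarrow> 'h) \<Rightarrow>
   ('k \<Rightarrow> 'a::ring_1 \<Rightarrow> 'a) \<Rightarrow> ('a \<Rightarrow> ('k, 'a, 'h) tensor) \<Rightarrow>
   ('k \<Rightarrow> 'b::ring_1 \<Rightarrow> 'b) \<Rightarrow> ('b \<Rightarrow> ('k, 'b, 'h) tensor) \<Rightarrow> ('a \<Rightarrow> 'b) \<Rightarrow> bool" where
  "comodule_algebra_hom sH sA \<rho>A sB \<rho>B f \<longleftrightarrow>
     algebra_hom sA sB f \<and> (\<forall>a. \<rho>B (f a) = tensor_map sB sH f id (\<rho>A a))"

definition isomorphic_comodule_algebras ::
  "('k::field \<Rightarrow> 'h::ring_1 \<Rightarrow> 'h) \<Rightarrow>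
   ('k \<Rightarrow> 'a::ring_1 \<Rightarrow> 'a) \<Rightarrow> ('a \<Rightarrow> ('k, 'a, 'h) tensor) \<Rightarrow>
   ('k \<Rightarrow> 'b::ring_1 \<Rightarrow> 'b) \<Rightarrow> ('b \<Rightarrow> ('k, 'b, 'h) tensor) \<Rightarrow> bool" where
  "isomorphic_comodule_algebras sH sA \<rho>A sB \<rho>B \<longleftrightarrow>
     (\<exists>f. comodule_algebra_hom sH sA \<rho>A sB \<rho>B f \<and> bij f)"

definition coinvariants ::
  "('k::field \<Rightarrow> 'h::ring_1 \<Rightarrow> 'h) \<Rightarrow> ('k \<Rightarrow> 'a::ring_1 \<Rightarrow> 'a) \<Rightarrow> ('a \<Rightarrow> ('k, 'a, 'h) tensor) \<Rightarrow> 'a set" where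
  "coinvariants sH sA \<rho> = {a. \<rho> a = pure sA sH a 1}"

definition galois_map ::
  "('k::field \<Rightarrow> 'h::ring_1 \<Rightarrow> 'h) \<Rightarrow> ('k \<Rightarrow> 'a::ring_1 \<Rightarrow> 'a) \<Rightarrow> ('a \<Rightarrow> ('k, 'a, 'h) tensor) \<Rightarrow>
   ('k, 'a, 'a) tensor \<Rightarrow> ('k, 'a, 'h) tensor" where
  "galois_map sH sA \<rho> = tensor_ext (\<lambda>a b. tensor_mult sA sH (pure sA sH a 1) (\<rho> b))"

text \<open>Linearity of \<^const>\<open>galois_map\<close> is automatic, whence only bijectivity is required below.\<close>

definition galois_object ::
  "('k::field \<Rightarrow> 'h::ring_1 \<Rightarrow> 'h) \<Rightarrow> ('h \<Rightarrow> ('k, 'h, 'h) tensor) \<Rightarrow> ('h \<Rightarrow> 'k) \<Rightarrow>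
   ('k \<Rightarrow> 'a::ring_1 \<Rightarrow> 'a) \<Rightarrow> ('a \<Rightarrow> ('k, 'a, 'h) tensor) \<Rightarrow> bool" where
  "galois_object sH \<Delta> \<epsilon> sA \<rho> \<longleftrightarrow>
     comodule_algebra sH \<Delta> \<epsilon> sA \<rho> \<and>
     coinvariants sH sA \<rho> = range (\<lambda>c. sA c 1) \<and>
     bij_betw (galois_map sH sA \<rho>) (tensor_space sA sA) (tensor_space sA sH)"

section \<open>Monomial Hopf algebras\<close>

definition units_group :: "'k::field monoid" where
  "units_group = \<lparr>carrier = UNIV - {0}, monoid.mult = (*), one = 1\<rparr>"

definition group_datum :: "'g monoid \<Rightarrow> 'g \<Rightarrow> ('g \<Rightarrow> 'k::field) \<Rightarrow> 'k \<Rightarrow> bool" where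
  "group_datum G g \<chi> \<mu> \<longleftrightarrow>
     group G \<and> finite (carrier G) \<and>
     g \<in> carrier G \<and> (\<forall>x \<in> carrier G. g \<otimes>\<^bsub>G\<^esub> x = x \<otimes>\<^bsub>G\<^esub> g) \<and>
     \<chi> \<in> hom G units_group \<and> \<chi> g \<noteq> 1 \<and>
     (group.ord G g = group.ord units_group (\<chi> g) \<longrightarrow> \<mu> = 0) \<and>
     (\<mu> \<noteq> 0 \<longrightarrow> (\<forall>x \<in> carrier G. \<chi> x ^ group.ord units_group (\<chi> g) = 1))"

datatype 'g monomial_gen = Grp 'g | Y

definition monomial_gens :: "'g monoid \<Rightarrow> 'g monomial_gen set" where
  "monomial_gens G = Grp ` carrier G \<union> {Y}"

definition monomial_relators ::
  "'g monoid \<Rightarrow> 'g \<Rightarrow> ('g \<Rightarrow> 'k::field) \<Rightarrow> 'k \<Rightarrow> ('k, 'g monomial_gen) free_alg set" where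
  "monomial_relators G g \<chi> \<mu> =
     {gen (Grp x) * gen (Grp z) - gen (Grp (x \<otimes>\<^bsub>G\<^esub> z)) | x z. x \<in> carrier G \<and> z \<in> carrier G} \<union>
     {gen (Grp \<one>\<^bsub>G\<^esub>) - 1} \<union>
     {gen Y * gen (Grp x) - const (\<chi> x) * gen (Grp x) * gen Y | x. x \<in> carrier G} \<union>
     (let d = group.ord units_group (\<chi> g) in {gen Y ^ d - const \<mu> * (1 - gen (Grp g) ^ d)})"

text \<open>
  The Hopf algebra attached to a group datum, determined up to isomorphism: \<open>\<iota>\<close> sends the elements
  of \<open>G\<close>, and \<open>y\<close> is the image of the last generator, to the Hopf algebra.
\<close>

definition monomial_hopf_algebra ::
  "'g monoid \<Rightarrow> 'g \<Rightarrow> ('g \<Rightarrow> 'k::field) \<Rightarrow> 'k \<Rightarrow>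
   ('k \<Rightarrow> 'h::ring_1 \<Rightarrow> 'h) \<Rightarrow> ('g \<Rightarrow> 'h) \<Rightarrow> 'h \<Rightarrow>
   ('h \<Rightarrow> ('k, 'h, 'h) tensor) \<Rightarrow> ('h \<Rightarrow> 'k) \<Rightarrow> ('h \<Rightarrow> 'h) \<Rightarrow> bool" where
  "monomial_hopf_algebra G g \<chi> \<mu> sH \<iota> y \<Delta> \<epsilon> S \<longleftrightarrow>
     presented_by sH (case_monomial_gen \<iota> y) (monomial_gens G) (monomial_relators G g \<chi> \<mu>) \<and>
     hopf_algebra sH \<Delta> \<epsilon> S \<and>
     (\<forall>x \<in> carrier G. \<Delta> (\<iota> x) = pure sH sH (\<iota> x) (\<iota> x) \<and> \<epsilon> (\<iota> x) = 1 \<and> S (\<iota> x) = \<iota> (inv\<^bsub>G\<^esub> x)) \<and>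
     \<Delta> y = tensor_of sH sH [(1, y), (y, \<iota> g)] \<and> \<epsilon> y = 0 \<and> S y = - (y * \<iota> (inv\<^bsub>G\<^esub> g))"

section \<open>Polynomial identities\<close>

text \<open>
  The tensor algebra of the direct sum of copies \<open>X\<^sub>i\<close> (\<open>i \<ge> 1\<close>) of the vector space \<open>H\<close>, determined
  up to isomorphism: it is generated by symbols \<open>X i h\<close> subject only to linearity in \<open>h\<close>.
\<close>

definition linearity_relators ::
  "('k::field \<Rightarrow> 'h::ab_group_add \<Rightarrow> 'h) \<Rightarrow> ('k, nat \<times> 'h) free_alg set" where
  "linearity_relators sH =
     {gen (i, h + h') - gen (i, h) - gen (i, h') | i h h'. 1 \<le> i} \<union>
     {gen (i, sH c h) - const c * gen (i, h) | i c h. 1 \<le> i}"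

definition tensor_algebra_of_copies ::
  "('k::field \<Rightarrow> 'h::ring_1 \<Rightarrow> 'h) \<Rightarrow> ('h \<Rightarrow> ('k, 'h, 'h) tensor) \<Rightarrow> ('h \<Rightarrow> 'k) \<Rightarrow>
   ('k \<Rightarrow> 't::ring_1 \<Rightarrow> 't) \<Rightarrow> (nat \<Rightarrow> 'h \<Rightarrow> 't) \<Rightarrow> ('t \<Rightarrow> ('k, 't, 'h) tensor) \<Rightarrow> bool" where
  "tensor_algebra_of_copies sH \<Delta> \<epsilon> sT X \<delta> \<longleftrightarrow>
     presented_by sT (case_prod X) ({1..} \<times> UNIV) (linearity_relators sH) \<and>
     comodule_algebra sH \<Delta> \<epsilon> sT \<delta> \<and>
     (\<forall>i\<ge>1. \<forall>h. \<delta> (X i h) = tensor_map sT sH (X i) id (\<Delta> h))"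

definition polynomial_identities ::
  "('k::field \<Rightarrow> 'h::ring_1 \<Rightarrow> 'h) \<Rightarrow>
   ('k \<Rightarrow> 't::ring_1 \<Rightarrow> 't) \<Rightarrow> ('t \<Rightarrow> ('k, 't, 'h) tensor) \<Rightarrow>
   ('k \<Rightarrow> 'a::ring_1 \<Rightarrow> 'a) \<Rightarrow> ('a \<Rightarrow> ('k, 'a, 'h) tensor) \<Rightarrow> 't set" where
  "polynomial_identities sH sT \<delta> sA \<rho> =
     {P. \<forall>f. comodule_algebra_hom sH sT \<delta> sA \<rho> f \<longrightarrow> f P = 0}"

end

theory Submission
  imports Defs
begin

text \<open>
  Let \<open>q = \<chi> g\<close>, \<open>d\<close> its order and \<open>\<gamma> = g\<^sup>d\<close>.  A Galois object \<open>A\<close> looks like \<open>H\<close> itself up to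
  scalars.  It contains units \<open>u\<^sub>x\<close> (\<open>x \<in> G\<close>) with \<open>\<rho>(u\<^sub>x) = u\<^sub>x \<otimes> x\<close>, each unique up to a scalar, and an
  element \<open>Z\<close> with \<open>\<rho>(Z) = 1 \<otimes> y + Z \<otimes> g\<close>, unique up to multiples of \<open>u\<^sub>g\<close>.  All of them are obtained by
  contracting the first leg of the preimage of \<open>1 \<otimes> h\<close> under the Galois map (\<open>section_map_comodule\<close>,
  \<open>section_maps_generate\<close>).  Since \<open>g\<close> is central and \<open>q \<noteq> 1\<close>, exactly one choice of \<open>Z\<close> satisfies
  \<open>Z u\<^sub>x = \<chi>(x) u\<^sub>x Z\<close> for all \<open>x\<close> (\<open>normalised_frame_exists\<close>).  The products \<open>u\<^sub>x Z\<^sup>i\<close> with \<open>i < d\<close> are a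
  basis (\<open>frame_map_bij\<close>), and as the inner Gaussian binomials vanish at a primitive \<open>d\<close>-th root of
  unity, \<open>Z\<^sup>d = \<mu> + a u\<^sub>\<gamma>\<close> for a scalar \<open>a\<close> (\<open>Z_power_d\<close>).  Thus \<open>A\<close> is determined by the 2-cocycle
  \<open>u\<^sub>x u\<^sub>z = \<sigma>(x, z) u\<^sub>x\<^sub>z\<close> and by \<open>a\<close>, and two Galois objects are isomorphic as soon as some rescaling
  \<open>u\<^sub>x \<mapsto> t\<^sub>x u\<^sub>x\<close> makes these data agree (\<open>frames_isomorphic\<close>).

  The identities control the data as follows.  Every comodule algebra map from the tensor algebra to \<open>A\<close> sends \<open>X\<^sup>x\<close> to
  a multiple \<open>t\<^sub>x u\<^sub>x\<close> and \<open>X\<^sup>y\<close> to \<open>t\<^sub>1 Z + s u\<^sub>g\<close>.  The commutator of \<open>X\<^sup>g\<close> and \<open>X\<^sup>y\<close> does not see \<open>s\<close>, and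
  its \<open>d\<close>-th power yields a polynomial \<open>W\<close> with value \<open>a N\<close>, next to a monomial \<open>V\<close> with value
  \<open>t\<^sub>\<gamma> N\<close>, where \<open>N\<close> is the same unit in both cases when all \<open>t\<^sub>x \<noteq> 0\<close>.  If two words
  \<open>v\<close>, \<open>w\<close> in \<open>G\<close> have the same product, and \<open>v \<gamma>\<^sup>m\<close> and \<open>w \<gamma>\<^sup>n\<close> are rearrangements of each other, then
  all unknown scalars cancel and \<open>V\<^sup>m W\<^sup>n X\<^sup>v - c W\<^sup>m V\<^sup>n X\<^sup>w\<close> is an identity for exactly one \<open>c\<close> (if \<open>a \<noteq> 0\<close>),
  which is an expression in \<open>\<sigma>\<close> and \<open>a\<close> (\<open>test_poly_identity_iff\<close>).

  For \<open>A\<close> and \<open>B\<close> with the same identities these constants coincide.  This says that the multiplicative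
  conditions on \<open>t\<close>, one for each pair of words with equal product, depend only on the exponent vectors
  in \<open>\<int>\<^sup>G\<close> of the words: they prescribe a character on a subgroup of \<open>\<int>\<^sup>G\<close>.  As the multiplicative group of
  an algebraically closed field is divisible, the character extends to \<open>\<int>\<^sup>G\<close> (\<open>character_extends\<close>), and its
  values on the unit vectors are the required \<open>t\<^sub>x\<close>.
\<close>

section \<open>Evaluating tensors on bilinear maps\<close>

definition bilinear_map ::
  "('k::field \<Rightarrow> 'v::ab_group_add \<Rightarrow> 'v) \<Rightarrow> ('k \<Rightarrow> 'w::ab_group_add \<Rightarrow> 'w) \<Rightarrow> ('k \<Rightarrow> 'x::ab_group_add \<Rightarrow> 'x) \<Rightarrow>
   ('v \<Rightarrow> 'w \<Rightarrow> 'x) \<Rightarrow> bool" where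
  "bilinear_map sV sW sX \<phi> \<longleftrightarrow>
     (\<forall>v. Vector_Spaces.linear sW sX (\<phi> v)) \<and> (\<forall>w. Vector_Spaces.linear sV sX (\<lambda>v. \<phi> v w))"

lemma bilinear_form_eq_map: "bilinear_form sV sW \<beta> \<longleftrightarrow> bilinear_map sV sW (*) \<beta>"
  by (simp add: bilinear_form_def bilinear_map_def)

text \<open>The linear map on the tensor product induced by a bilinear map with values in any vector space.
  It does not depend on the representation that is chosen, by the universal property.\<close>

definition tensor_lift ::
  "('k::field \<Rightarrow> 'v::ab_group_add \<Rightarrow> 'v) \<Rightarrow> ('k \<Rightarrow> 'w::ab_group_add \<Rightarrow> 'w) \<Rightarrow>
   ('v \<Rightarrow> 'w \<Rightarrow> 'x::ab_group_add) \<Rightarrow> ('k, 'v, 'w) tensor \<Rightarrow> 'x" where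
  "tensor_lift sV sW \<phi> u = (\<Sum>(v, w)\<leftarrow>(SOME ps. u = tensor_of sV sW ps). \<phi> v w)"

lemma tensor_lift_tensor_of:
  assumes "bilinear_map sV sW sX \<phi>"
  shows "tensor_lift sV sW \<phi> (tensor_of sV sW ps) = (\<Sum>(v, w)\<leftarrow>ps. \<phi> v w)"
proof -
  let ?qs = "SOME qs. tensor_of sV sW ps = tensor_of sV sW qs"
  have "tensor_of sV sW ps = tensor_of sV sW ?qs" by (rule someI) simp
  from tensor_universal[OF _ _ this, of sX \<phi>] assms show ?thesis
    by (simp add: tensor_lift_def bilinear_map_def)
qed

lemma tensor_of_eval:
  "bilinear_form sV sW \<beta> \<Longrightarrow> tensor_of sV sW ps \<beta> = (\<Sum>(v, w)\<leftarrow>ps. \<beta> v w)"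
  by (simp add: tensor_of_def)

lemma tensor_of_zero_form [simp]: "tensor_of sV sW ps (\<lambda>v w. 0) = 0"
  by (simp add: tensor_of_def case_prod_unfold)

lemma tensor_of_in_space [simp]: "tensor_of sV sW ps \<in> tensor_space sV sW"
  by (simp add: tensor_space_def)

lemma tensor_spaceE:
  assumes "u \<in> tensor_space sV sW"
  obtains ps where "u = tensor_of sV sW ps"
  using assms by (auto simp: tensor_space_def)

lemma tensor_eqI:
  assumes "u \<in> tensor_space sV sW" and "u' \<in> tensor_space sV sW"
    and "\<And>\<beta>. bilinear_form sV sW \<beta> \<Longrightarrow> u \<beta> = u' \<beta>"
  shows "u = u'"
proof
  fix \<beta> show "u \<beta> = u' \<beta>"
    using assms by (cases "bilinear_form sV sW \<beta>") (auto simp: tensor_space_def tensor_of_def)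
qed

lemma linear_imp_vector_spaces:
  assumes "Vector_Spaces.linear sX sY l"
  shows "vector_space sX" and "vector_space sY"
  using assms by (auto simp: Vector_Spaces.linear_def)

lemma linear_sum_list:
  assumes "Vector_Spaces.linear sX sY l"
  shows "l (\<Sum>(v, w)\<leftarrow>ps. \<phi> v w) = (\<Sum>(v, w)\<leftarrow>ps. l (\<phi> v w))"
proof -
  interpret Vector_Spaces.linear sX sY l by fact
  show ?thesis by (induction ps) (auto simp: add)
qed

lemma bilinear_map_compose:
  assumes "bilinear_map sV sW sX \<phi>" and "Vector_Spaces.linear sX sY l"
  shows "bilinear_map sV sW sY (\<lambda>v w. l (\<phi> v w))"
  using assms by (auto simp: bilinear_map_def Vector_Spaces.linear_iff)

text \<open>Linear functionals separate the points of a vector space, so identities between vectors built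
  from a tensor can be read off from the values of the tensor on scalar forms.\<close>

lemma linear_functional_tensor_lift:
  assumes "u \<in> tensor_space sV sW" and "bilinear_map sV sW sX \<phi>" and "Vector_Spaces.linear sX (*) l"
  shows "l (tensor_lift sV sW \<phi> u) = u (\<lambda>v w. l (\<phi> v w))"
proof -
  obtain ps where "u = tensor_of sV sW ps" using assms(1) by (rule tensor_spaceE)
  then show ?thesis
    using bilinear_map_compose[OF assms(2,3)]
    by (simp add: tensor_lift_tensor_of[OF assms(2)] linear_sum_list[OF assms(3)] tensor_of_eval
        bilinear_form_eq_map)
qed

lemma eq_by_functionals:
  assumes "vector_space sX" and "\<And>l. Vector_Spaces.linear sX (*) l \<Longrightarrow> l x = l y"
  shows "x = y"
proof (rule ccontr)
  assume "x \<noteq> y"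
  then obtain l where l: "Vector_Spaces.linear sX (*) l" "l (x - y) \<noteq> 0"
    using separating_functional[OF assms(1), of "x - y"] by auto
  interpret Vector_Spaces.linear sX "(*)" l by fact
  show False using l(2) assms(2)[OF l(1)] by (simp add: diff)
qed

lemma functional_normalised_at:
  assumes "vector_space sX" and "z \<noteq> 0"
  obtains l where "Vector_Spaces.linear sX (*) l" and "l z = 1"
proof -
  obtain l where l: "Vector_Spaces.linear sX (*) l" "l z \<noteq> 0"
    using separating_functional[OF assms] by auto
  have "Vector_Spaces.linear sX (*) (\<lambda>x. inverse (l z) * l x)"
    using l(1) by (simp add: Vector_Spaces.linear_iff algebra_simps)
  with that[of "\<lambda>x. inverse (l z) * l x"] l(2) show thesis by simp
qed

lemma bilinear_form_compose:
  assumes "bilinear_form sC sD \<beta>" and "Vector_Spaces.linear sV sC f" and "Vector_Spaces.linear sW sD h"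
  shows "bilinear_form sV sW (\<lambda>v w. \<beta> (f v) (h w))"
  using assms by (auto simp: bilinear_form_def Vector_Spaces.linear_iff)

lemma bilinear_form_add:
  assumes "bilinear_form sV sW \<beta>" and "bilinear_form sV sW \<beta>'"
  shows "bilinear_form sV sW (\<lambda>v w. \<beta> v w + \<beta>' v w)"
  using assms by (auto simp: bilinear_form_def Vector_Spaces.linear_iff algebra_simps)

lemma bilinear_form_zero:
  "vector_space sV \<Longrightarrow> vector_space sW \<Longrightarrow> bilinear_form sV sW (\<lambda>v w. 0)"
  by (auto simp: bilinear_form_def Vector_Spaces.linear_iff vector_space_times)

lemma bilinear_form_sum_list:
  assumes "vector_space sV" and "vector_space sW"
    and "\<And>x y. bilinear_form sV sW (\<beta> x y)"
  shows "bilinear_form sV sW (\<lambda>v w. \<Sum>(x, y)\<leftarrow>ps. \<beta> x y v w)"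
  by (induction ps) (auto intro!: bilinear_form_zero bilinear_form_add assms)

lemma bilinear_form_mult_functionals:
  assumes "Vector_Spaces.linear sV (*) f" and "Vector_Spaces.linear sW (*) l"
  shows "bilinear_form sV sW (\<lambda>v w. f v * l w)"
  using assms by (auto simp: bilinear_form_def Vector_Spaces.linear_iff algebra_simps)

lemma tensor_lift_add:
  assumes "bilinear_map sV sW sX \<phi>" and "u \<in> tensor_space sV sW" and "u' \<in> tensor_space sV sW"
  shows "(\<lambda>\<beta>. u \<beta> + u' \<beta>) \<in> tensor_space sV sW"
    and "tensor_lift sV sW \<phi> (\<lambda>\<beta>. u \<beta> + u' \<beta>) = tensor_lift sV sW \<phi> u + tensor_lift sV sW \<phi> u'"
proof -
  obtain ps qs where u: "u = tensor_of sV sW ps" "u' = tensor_of sV sW qs"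
    using assms(2,3) by (auto elim!: tensor_spaceE)
  have eq: "(\<lambda>\<beta>. u \<beta> + u' \<beta>) = tensor_of sV sW (ps @ qs)" by (auto simp: u tensor_of_def)
  show "(\<lambda>\<beta>. u \<beta> + u' \<beta>) \<in> tensor_space sV sW" by (simp add: eq)
  show "tensor_lift sV sW \<phi> (\<lambda>\<beta>. u \<beta> + u' \<beta>) = tensor_lift sV sW \<phi> u + tensor_lift sV sW \<phi> u'"
    unfolding eq by (simp add: u tensor_lift_tensor_of[OF assms(1)])
qed

lemma tensor_lift_scale:
  assumes "bilinear_map sV sW sX \<phi>" and "u \<in> tensor_space sV sW"
  shows "(\<lambda>\<beta>. c * u \<beta>) \<in> tensor_space sV sW"
    and "tensor_lift sV sW \<phi> (\<lambda>\<beta>. c * u \<beta>) = sX c (tensor_lift sV sW \<phi> u)"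
proof -
  obtain ps where u: "u = tensor_of sV sW ps" using assms(2) by (rule tensor_spaceE)
  have vs: "vector_space sX" using assms(1) by (auto simp: bilinear_map_def Vector_Spaces.linear_def)
  interpret X: vector_space sX by fact
  have "c * tensor_of sV sW ps \<beta> = tensor_of sV sW (map (\<lambda>(v, w). (sV c v, w)) ps) \<beta>" for \<beta>
    by (induction ps)
       (auto simp: tensor_of_def bilinear_form_def Vector_Spaces.linear_iff algebra_simps)
  then have eq: "(\<lambda>\<beta>. c * u \<beta>) = tensor_of sV sW (map (\<lambda>(v, w). (sV c v, w)) ps)" by (auto simp: u)
  show "(\<lambda>\<beta>. c * u \<beta>) \<in> tensor_space sV sW" by (simp add: eq)
  have "(\<Sum>(v, w)\<leftarrow>map (\<lambda>(v, w). (sV c v, w)) ps. \<phi> v w) = sX c (\<Sum>(v, w)\<leftarrow>ps. \<phi> v w)"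
    using assms(1)
    by (induction ps) (auto simp: bilinear_map_def Vector_Spaces.linear_iff X.scale_right_distrib)
  then show "tensor_lift sV sW \<phi> (\<lambda>\<beta>. c * u \<beta>) = sX c (tensor_lift sV sW \<phi> u)"
    unfolding eq by (simp add: u tensor_lift_tensor_of[OF assms(1)])
qed

lemma tensor_map_eval:
  "bilinear_form sC sD \<beta> \<Longrightarrow> tensor_map sC sD f h u \<beta> = u (\<lambda>v w. \<beta> (f v) (h w))"
  by (simp add: tensor_map_def tensor_ext_def tensor_of_eval)

lemma tensor_map_tensor_of:
  assumes "Vector_Spaces.linear sV sC f" and "Vector_Spaces.linear sW sD h"
  shows "tensor_map sC sD f h (tensor_of sV sW ps) = tensor_of sC sD (map (\<lambda>(v, w). (f v, h w)) ps)"
proof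
  fix \<beta>
  show "tensor_map sC sD f h (tensor_of sV sW ps) \<beta> = tensor_of sC sD (map (\<lambda>(v, w). (f v, h w)) ps) \<beta>"
  proof (cases "bilinear_form sC sD \<beta>")
    case True
    then show ?thesis
      by (simp add: tensor_map_eval tensor_of_eval bilinear_form_compose[OF True assms]
          case_prod_unfold o_def)
  next
    case False
    then have "pure sC sD a b \<beta> = 0" for a b by (simp add: tensor_of_def)
    then have "tensor_map sC sD f h (tensor_of sV sW ps) \<beta> = 0"
      by (simp add: tensor_map_def tensor_ext_def)
    with False show ?thesis by (simp add: tensor_of_def)
  qed
qed

lemma tensor_map_in_space:
  assumes "Vector_Spaces.linear sV sC f" and "Vector_Spaces.linear sW sD h" and "u \<in> tensor_space sV sW"
  shows "tensor_map sC sD f h u \<in> tensor_space sC sD"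
  using assms(3) by (auto elim!: tensor_spaceE simp: tensor_map_tensor_of[OF assms(1,2)])

lemma linear_identity: "vector_space s \<Longrightarrow> Vector_Spaces.linear s s id"
  by (simp add: Vector_Spaces.linear_iff)

lemma tensor_mult_eval:
  "bilinear_form sA sB \<beta> \<Longrightarrow>
   tensor_mult sA sB u u' \<beta> = u (\<lambda>a b. u' (\<lambda>a' b'. \<beta> (a * a') (b * b')))"
  by (simp add: tensor_mult_def tensor_ext_def tensor_of_eval)

lemma k_algebra_imp_vector_space: "k_algebra s \<Longrightarrow> vector_space s"
  by (simp add: k_algebra_def)

lemma (in k_algebra) linear_mult:
  shows "Vector_Spaces.linear scale scale ((*) x)" and "Vector_Spaces.linear scale scale (\<lambda>z. z * x)"
  by (unfold_locales; simp add: algebra_simps scale_mult_left flip: scale_mult_right)+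

lemma bilinear_form_mult_right:
  assumes "k_algebra sA" and "k_algebra sB" and "bilinear_form sA sB \<beta>"
  shows "bilinear_form sA sB (\<lambda>x y. \<beta> (x * c) (y * e))"
  by (intro bilinear_form_compose[OF assms(3)] k_algebra.linear_mult assms)

lemma bilinear_form_mult_left:
  assumes "k_algebra sA" and "k_algebra sB" and "bilinear_form sA sB \<beta>"
  shows "bilinear_form sA sB (\<lambda>x y. \<beta> (c * x) (e * y))"
  by (intro bilinear_form_compose[OF assms(3)] k_algebra.linear_mult assms)

lemma bilinear_form_mult_tensor:
  assumes "k_algebra sA" and "k_algebra sB" and "bilinear_form sA sB \<beta>" and "u \<in> tensor_space sA sB"
  shows "bilinear_form sA sB (\<lambda>a b. u (\<lambda>a' b'. \<beta> (a * a') (b * b')))"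
proof -
  obtain ps where u: "u = tensor_of sA sB ps" using assms(4) by (rule tensor_spaceE)
  show ?thesis unfolding u
    by (simp add: tensor_of_eval bilinear_form_mult_left[OF assms(1-3)])
       (intro bilinear_form_sum_list bilinear_form_mult_right assms k_algebra_imp_vector_space)
qed

lemma tensor_mult_tensor_of:
  assumes A: "k_algebra sA" and B: "k_algebra sB"
  shows "tensor_mult sA sB (tensor_of sA sB ps) (tensor_of sA sB qs) =
    tensor_of sA sB (concat (map (\<lambda>(a, b). map (\<lambda>(a', b'). (a * a', b * b')) qs) ps))"
proof
  fix \<beta>
  show "tensor_mult sA sB (tensor_of sA sB ps) (tensor_of sA sB qs) \<beta> =
    tensor_of sA sB (concat (map (\<lambda>(a, b). map (\<lambda>(a', b'). (a * a', b * b')) qs) ps)) \<beta>"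
  proof (cases "bilinear_form sA sB \<beta>")
    case True
    note bl = bilinear_form_mult_left[OF A B True]
    have "tensor_mult sA sB (tensor_of sA sB ps) (tensor_of sA sB qs) \<beta> =
        (\<Sum>(a, b)\<leftarrow>ps. \<Sum>(a', b')\<leftarrow>qs. \<beta> (a * a') (b * b'))"
      unfolding tensor_mult_eval[OF True]
      using bilinear_form_mult_tensor[OF A B True, of "tensor_of sA sB qs"]
      by (simp add: tensor_of_eval bl)
    also have "\<dots> = tensor_of sA sB (concat (map (\<lambda>(a, b). map (\<lambda>(a', b'). (a * a', b * b')) qs) ps)) \<beta>"
      unfolding tensor_of_eval[OF True]
      by (induction ps) (auto simp: case_prod_unfold o_def)
    finally show ?thesis .
  next
    case False
    then have "pure sA sB a b \<beta> = 0" for a b by (simp add: tensor_of_def)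
    then have "tensor_mult sA sB (tensor_of sA sB ps) (tensor_of sA sB qs) \<beta> = 0"
      by (simp add: tensor_mult_def tensor_ext_def)
    with False show ?thesis by (simp add: tensor_of_def)
  qed
qed

lemma tensor_map_mult:
  assumes alg: "k_algebra sA" "k_algebra sB" "k_algebra sH" and f: "algebra_hom sA sB f"
    and u: "u \<in> tensor_space sA sH" "u' \<in> tensor_space sA sH"
  shows "tensor_map sB sH f id (tensor_mult sA sH u u') =
    tensor_mult sB sH (tensor_map sB sH f id u) (tensor_map sB sH f id u')"
proof -
  obtain ps qs where "u = tensor_of sA sH ps" "u' = tensor_of sA sH qs"
    using u by (auto elim!: tensor_spaceE)
  moreover have "Vector_Spaces.linear sA sB f" "f (x * z) = f x * f z" for x z
    using f by (auto simp: algebra_hom_def)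
  ultimately show ?thesis
    by (simp add: tensor_mult_tensor_of alg tensor_map_tensor_of linear_identity k_algebra_imp_vector_space
        map_concat o_def case_prod_unfold)
qed

lemma bilinear_map_contract_right:
  assumes "vector_space sV" and "Vector_Spaces.linear sW (*) l"
  shows "bilinear_map sV sW sV (\<lambda>v w. sV (l w) v)"
proof -
  interpret vector_space sV by fact
  have "l (x + y) = l x + l y" "l (sW c x) = c * l x" for x y c
    using assms(2) by (auto simp: Vector_Spaces.linear_iff)
  with assms linear_imp_vector_spaces[OF assms(2)] show ?thesis
    by (auto simp: bilinear_map_def Vector_Spaces.linear_iff algebra_simps)
qed

lemma bilinear_map_contract_left:
  assumes "vector_space sW" and "Vector_Spaces.linear sV (*) f"
  shows "bilinear_map sV sW sW (\<lambda>v w. sW (f v) w)"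
  using bilinear_map_contract_right[OF assms] by (auto simp: bilinear_map_def)

text \<open>Expanding the second legs in a basis of \<open>W\<close> reduces a form on \<open>V \<times> W\<close> to contractions of the
  tensor with coordinate functionals.\<close>

lemma tensor_eq_by_contractions:
  assumes V: "vector_space sV" and W: "vector_space sW"
    and u: "u \<in> tensor_space sV sW" "u' \<in> tensor_space sV sW"
    and eq: "\<And>l. Vector_Spaces.linear sW (*) l \<Longrightarrow>
      tensor_lift sV sW (\<lambda>v w. sV (l w) v) u = tensor_lift sV sW (\<lambda>v w. sV (l w) v) u'"
  shows "u = u'"
proof (rule tensor_eqI[OF u])
  fix \<beta> assume \<beta>: "bilinear_form sV sW \<beta>"
  obtain ps qs where ps: "u = tensor_of sV sW ps" and qs: "u' = tensor_of sV sW qs"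
    using u by (auto elim!: tensor_spaceE)
  interpret W: vector_space sW by fact
  define B where "B = W.extend_basis {}"
  define F where "F = (\<Union>w\<in>snd ` set (ps @ qs). {b. W.representation B w b \<noteq> 0})"
  have B: "W.independent B" "W.span B = UNIV"
    unfolding B_def using W.independent_extend_basis[OF W.independent_empty]
      W.span_extend_basis[OF W.independent_empty] by auto
  have F: "finite F" unfolding F_def by (auto simp: W.finite_representation)
  have expand: "w = (\<Sum>b\<in>F. sW (W.representation B w b) b)" if "w \<in> snd ` set (ps @ qs)" for w
  proof -
    have "(\<Sum>b\<in>F. sW (W.representation B w b) b) = (\<Sum>b | W.representation B w b \<noteq> 0. sW (W.representation B w b) b)"
      using that F by (intro sum.mono_neutral_right) (auto simp: F_def)
    also have "\<dots> = w" using B by (intro W.sum_nonzero_representation_eq) auto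
    finally show ?thesis by simp
  qed
  have rep: "Vector_Spaces.linear sW (*) (\<lambda>w. W.representation B w b)" for b
    using W.linear_representation[OF B] .
  have *: "tensor_of sV sW rs \<beta> =
      (\<Sum>b\<in>F. \<beta> (tensor_lift sV sW (\<lambda>v w. sV (W.representation B w b) v) (tensor_of sV sW rs)) b)"
    if "set rs \<subseteq> set (ps @ qs)" for rs
  proof -
    have lin: "Vector_Spaces.linear sW (*) (\<beta> v)" "Vector_Spaces.linear sV (*) (\<lambda>v. \<beta> v w)" for v w
      using \<beta> by (auto simp: bilinear_form_def)
    have "\<beta> v w = (\<Sum>b\<in>F. \<beta> (sV (W.representation B w b) v) b)" if "(v, w) \<in> set rs" for v w
    proof -
      interpret bv: Vector_Spaces.linear sW "(*)" "\<beta> v" by (rule lin)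
      have "w \<in> snd ` set (ps @ qs)" using that \<open>set rs \<subseteq> set (ps @ qs)\<close> by force
      then have "\<beta> v w = \<beta> v (\<Sum>b\<in>F. sW (W.representation B w b) b)" using expand by simp
      also have "\<dots> = (\<Sum>b\<in>F. W.representation B w b * \<beta> v b)" by (simp add: bv.sum bv.scale)
      also have "\<dots> = (\<Sum>b\<in>F. \<beta> (sV (W.representation B w b) v) b)"
        using lin(2) by (simp add: Vector_Spaces.linear_iff)
      finally show ?thesis .
    qed
    then have "tensor_of sV sW rs \<beta> = (\<Sum>(v, w)\<leftarrow>rs. \<Sum>b\<in>F. \<beta> (sV (W.representation B w b) v) b)"
      unfolding tensor_of_eval[OF \<beta>] by (intro arg_cong[of _ _ sum_list] map_cong) auto
    also have "\<dots> = (\<Sum>b\<in>F. \<Sum>(v, w)\<leftarrow>rs. \<beta> (sV (W.representation B w b) v) b)"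
      by (induction rs) (auto simp: sum.distrib)
    also have "\<dots> = (\<Sum>b\<in>F. \<beta> (tensor_lift sV sW (\<lambda>v w. sV (W.representation B w b) v) (tensor_of sV sW rs)) b)"
      by (simp add: tensor_lift_tensor_of[OF bilinear_map_contract_right[OF V rep]] linear_sum_list[OF lin(2)])
    finally show ?thesis .
  qed
  show "u \<beta> = u' \<beta>"
    using *[of ps] *[of qs] eq[OF rep] by (simp add: ps qs)
qed

section \<open>Algebras given by generators and relations\<close>

definition lin_ext :: "('k::field \<Rightarrow> 'v::ab_group_add \<Rightarrow> 'v) \<Rightarrow> ('w \<Rightarrow> 'v) \<Rightarrow> ('w \<Rightarrow>\<^sub>0 'k) \<Rightarrow> 'v" where
  "lin_ext s F p = (\<Sum>w \<in> Poly_Mapping.keys p. s (Poly_Mapping.lookup p w) (F w))"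

context vector_space
begin

lemma lin_ext_superset:
  assumes "finite A" and "Poly_Mapping.keys p \<subseteq> A"
  shows "lin_ext scale F p = (\<Sum>w\<in>A. scale (Poly_Mapping.lookup p w) (F w))"
  unfolding lin_ext_def using assms by (intro sum.mono_neutral_left) (auto simp: in_keys_iff)

lemma lin_ext_add: "lin_ext scale F (p + q) = lin_ext scale F p + lin_ext scale F q"
proof -
  let ?A = "Poly_Mapping.keys p \<union> Poly_Mapping.keys q"
  have "lin_ext scale F r = (\<Sum>w\<in>?A. scale (Poly_Mapping.lookup r w) (F w))" if "r \<in> {p, q, p + q}" for r
    using that keys_add[of p q] by (intro lin_ext_superset) auto
  then show ?thesis by (simp add: lookup_add scale_left_distrib sum.distrib)
qed

lemma lin_ext_single [simp]: "lin_ext scale F (Poly_Mapping.single w c) = scale c (F w)"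
  by (cases "c = 0") (simp_all add: lin_ext_def)

lemma lin_ext_zero [simp]: "lin_ext scale F 0 = 0"
  by (simp add: lin_ext_def)

lemma lin_ext_uminus: "lin_ext scale F (- p) = - lin_ext scale F p"
  using lin_ext_add[of F p "- p"] by (simp add: eq_neg_iff_add_eq_0 add.commute)

lemma lin_ext_diff: "lin_ext scale F (p - q) = lin_ext scale F p - lin_ext scale F q"
  using lin_ext_add[of F p "- q"] by (simp add: lin_ext_uminus)

lemma lin_ext_sum: "lin_ext scale F (sum p A) = (\<Sum>i\<in>A. lin_ext scale F (p i))"
  by (induction A rule: infinite_finite_induct) (auto simp: lin_ext_add)

end

lemma poly_mapping_as_sum:
  "p = (\<Sum>w\<in>Poly_Mapping.keys p. Poly_Mapping.single w (Poly_Mapping.lookup p w))"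
  by (rule poly_mapping_eqI) (auto simp: lookup_sum lookup_single when_def in_keys_iff)

lemma (in vector_space) lin_ext_mult:
  fixes p q :: "'w::monoid_add \<Rightarrow>\<^sub>0 'a"
  shows "lin_ext scale F (p * q) = (\<Sum>w\<in>Poly_Mapping.keys p. \<Sum>w'\<in>Poly_Mapping.keys q.
      scale (Poly_Mapping.lookup p w * Poly_Mapping.lookup q w') (F (w + w')))"
proof -
  have "p * q = (\<Sum>w\<in>Poly_Mapping.keys p. Poly_Mapping.single w (Poly_Mapping.lookup p w)) *
      (\<Sum>w'\<in>Poly_Mapping.keys q. Poly_Mapping.single w' (Poly_Mapping.lookup q w'))"
    by (simp flip: poly_mapping_as_sum)
  also have "\<dots> = (\<Sum>w\<in>Poly_Mapping.keys p. \<Sum>w'\<in>Poly_Mapping.keys q.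
      Poly_Mapping.single (w + w') (Poly_Mapping.lookup p w * Poly_Mapping.lookup q w'))"
    by (simp add: sum_product mult_single)
  finally show ?thesis by (simp add: lin_ext_sum)
qed

lemma free_eval_eq_lin_ext: "free_eval sA f = lin_ext sA (\<lambda>w. prod_list (map f (letters w)))"
  by (simp add: fun_eq_iff free_eval_def lin_ext_def)

lemma letters_add [simp]: "letters (v + w) = letters v @ letters w"
  by (simp add: plus_free_word_def)

lemma letters_zero [simp]: "letters 0 = []"
  by (simp add: zero_free_word_def)

context k_algebra
begin

lemma scale_mult_scale: "scale c x * scale e y = scale (c * e) (x * y)"
  by (simp flip: scale_mult_left scale_mult_right)

lemma scale_one_mult [simp]: "scale c 1 * x = scale c x" and mult_scale_one [simp]: "x * scale c 1 = scale c x"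
  by (simp_all flip: scale_mult_left scale_mult_right)

lemma scale_power: "scale c x ^ n = scale (c ^ n) (x ^ n)"
  by (induction n) (simp_all add: scale_mult_scale)

lemma free_eval_add: "free_eval scale f (p + q) = free_eval scale f p + free_eval scale f q"
  by (simp add: free_eval_eq_lin_ext lin_ext_add)

lemma free_eval_diff: "free_eval scale f (p - q) = free_eval scale f p - free_eval scale f q"
  by (simp add: free_eval_eq_lin_ext lin_ext_diff)

lemma free_eval_zero [simp]: "free_eval scale f 0 = 0"
  by (simp add: free_eval_eq_lin_ext)

lemma free_eval_one [simp]: "free_eval scale f 1 = 1"
  by (simp add: free_eval_eq_lin_ext flip: single_one)

lemma free_eval_const [simp]: "free_eval scale f (const c) = scale c 1"
  by (simp add: free_eval_eq_lin_ext const_def)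

lemma free_eval_gen [simp]: "free_eval scale f (gen s) = f s"
  by (simp add: free_eval_eq_lin_ext gen_def)

lemma free_eval_mult [simp]: "free_eval scale f (p * q) = free_eval scale f p * free_eval scale f q"
  unfolding free_eval_eq_lin_ext lin_ext_mult
  by (simp add: lin_ext_def sum_product scale_mult_scale)

lemma free_eval_power [simp]: "free_eval scale f (p ^ n) = free_eval scale f p ^ n"
  by (induction n) auto

lemma free_eval_ideal:
  assumes "\<And>r. r \<in> R \<Longrightarrow> free_eval scale f r = 0" and "p \<in> ideal_on S R"
  shows "free_eval scale f p = 0"
  using assms(2) by induction (auto simp: assms(1) free_eval_add)

end

lemma free_alg_on_simps [simp]:
  "0 \<in> free_alg_on S" "1 \<in> free_alg_on S" "const c \<in> free_alg_on S"
  "gen s \<in> free_alg_on S \<longleftrightarrow> s \<in> S"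
proof -
  show "gen s \<in> free_alg_on S \<longleftrightarrow> s \<in> S" by (simp add: free_alg_on_def gen_def)
  show c: "const c \<in> free_alg_on S" for c by (auto simp: free_alg_on_def const_def)
  from c[of 1] show "1 \<in> free_alg_on S" by (simp add: const_def)
qed (simp add: free_alg_on_def)

lemma free_alg_on_mult: "p \<in> free_alg_on S \<Longrightarrow> q \<in> free_alg_on S \<Longrightarrow> p * q \<in> free_alg_on S"
  unfolding free_alg_on_def using keys_mult[of p q] by (auto dest!: subsetD)

lemma free_alg_on_add: "p \<in> free_alg_on S \<Longrightarrow> q \<in> free_alg_on S \<Longrightarrow> p + q \<in> free_alg_on S"
  unfolding free_alg_on_def using keys_add[of p q] by blast

lemma free_alg_on_uminus: "p \<in> free_alg_on S \<Longrightarrow> - p \<in> free_alg_on S"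
  by (simp add: free_alg_on_def in_keys_iff)

lemma free_alg_on_diff: "p \<in> free_alg_on S \<Longrightarrow> q \<in> free_alg_on S \<Longrightarrow> p - q \<in> free_alg_on S"
  using free_alg_on_add[of p S "- q"] free_alg_on_uminus[of q S] by simp

lemma free_alg_on_power: "p \<in> free_alg_on S \<Longrightarrow> p ^ n \<in> free_alg_on S"
  by (induction n) (auto intro: free_alg_on_mult)

lemma presented_by_relator:
  assumes "presented_by sA f S R" and "r \<in> R"
  shows "free_eval sA f r = 0"
proof -
  have "1 * r * 1 \<in> ideal_on S R" using assms(2) by (intro ideal_on.mult) auto
  also have "ideal_on S R = {p \<in> free_alg_on S. free_eval sA f p = 0}"
    using assms(1) by (simp add: presented_by_def)
  finally show ?thesis by simp
qed

lemma presented_by_induct [consumes 1, case_names one add scale mult]: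
  assumes pres: "presented_by sA f S R"
    and one: "P 1" and add: "\<And>a b. P a \<Longrightarrow> P b \<Longrightarrow> P (a + b)"
    and scale: "\<And>c a. P a \<Longrightarrow> P (sA c a)" and mult: "\<And>s a. s \<in> S \<Longrightarrow> P a \<Longrightarrow> P (f s * a)"
  shows "P a"
proof -
  interpret A: k_algebra sA using pres by (simp add: presented_by_def)
  have "a \<in> free_eval sA f ` free_alg_on S" using pres by (simp add: presented_by_def)
  then obtain p where p: "p \<in> free_alg_on S" "a = free_eval sA f p" by auto
  have word: "P (prod_list (map f l))" if "set l \<subseteq> S" for l
    using that by (induction l) (auto intro: one mult)
  have zero: "P 0" using scale[OF one, of 0] by simp
  have "P (\<Sum>w\<in>K. sA (Poly_Mapping.lookup p w) (prod_list (map f (letters w))))"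
    if "K \<subseteq> Poly_Mapping.keys p" for K
    using finite_subset[OF that finite_keys] that
  proof (induction rule: finite_induct)
    case empty
    show ?case using zero by simp
  next
    case (insert w K)
    then have "set (letters w) \<subseteq> S" using p(1) by (auto simp: free_alg_on_def)
    then have "P (sA (Poly_Mapping.lookup p w) (prod_list (map f (letters w))))" by (intro scale word)
    with insert show ?case by (simp add: add)
  qed
  then show ?thesis using p(2) by (simp add: free_eval_def)
qed

text \<open>The universal property of a presentation, for maps that are merely linear: besides algebra
  homomorphisms it produces functionals, such as the coordinates of a monomial Hopf algebra below.\<close>

lemma presented_by_factor:
  assumes pres: "presented_by sA f S R" and V: "vector_space sV"
    and add: "\<And>p p'. \<Phi> (p + p') = \<Phi> p + \<Phi> p'"
    and scale: "\<And>c p. \<Phi> (const c * p) = sV c (\<Phi> p)"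
    and ideal: "\<And>p. p \<in> ideal_on S R \<Longrightarrow> \<Phi> p = 0"
  obtains L where "Vector_Spaces.linear sA sV L"
    and "\<And>p. p \<in> free_alg_on S \<Longrightarrow> L (free_eval sA f p) = \<Phi> p"
proof -
  interpret A: k_algebra sA using pres by (simp add: presented_by_def)
  define pre where "pre a = (SOME p. p \<in> free_alg_on S \<and> free_eval sA f p = a)" for a
  have pre: "pre a \<in> free_alg_on S \<and> free_eval sA f (pre a) = a" for a
  proof -
    have "a \<in> free_eval sA f ` free_alg_on S" using pres by (simp add: presented_by_def)
    then have "\<exists>p. p \<in> free_alg_on S \<and> free_eval sA f p = a" by auto
    then show ?thesis unfolding pre_def by (rule someI_ex)
  qed
  then have pre1: "pre a \<in> free_alg_on S" and pre2: "free_eval sA f (pre a) = a" for a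
    by auto
  define L where "L a = \<Phi> (pre a)" for a
  have L: "L (free_eval sA f p) = \<Phi> p" if "p \<in> free_alg_on S" for p
  proof -
    let ?p = "pre (free_eval sA f p)"
    have "?p - p \<in> {p \<in> free_alg_on S. free_eval sA f p = 0}"
      using pre1 pre2 that by (simp add: A.free_eval_diff free_alg_on_diff)
    also have "\<dots> = ideal_on S R" using pres by (simp add: presented_by_def)
    finally have "\<Phi> (?p - p) = 0" by (rule ideal)
    with add[of "?p - p" p] show ?thesis by (simp add: L_def)
  qed
  have "L (a + b) = L a + L b" for a b
    using L[of "pre a + pre b"] by (simp add: pre1 pre2 free_alg_on_add A.free_eval_add add L_def)
  moreover have "L (sA c a) = sV c (L a)" for c a
    using L[of "const c * pre a"] by (simp add: pre1 pre2 free_alg_on_mult scale L_def)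
  ultimately have "Vector_Spaces.linear sA sV L"
    by (simp add: Vector_Spaces.linear_iff A.vector_space_axioms V)
  with L that show thesis by blast
qed

lemma presented_by_hom_exists:
  assumes pres: "presented_by sA f S R" and B: "k_algebra sB"
    and rel: "\<And>r. r \<in> R \<Longrightarrow> free_eval sB f' r = 0"
  obtains F where "algebra_hom sA sB F" and "\<And>s. s \<in> S \<Longrightarrow> F (f s) = f' s"
proof -
  interpret A: k_algebra sA using pres by (simp add: presented_by_def)
  interpret B: k_algebra sB by fact
  have ideal: "free_eval sB f' p = 0" if "p \<in> ideal_on S R" for p
    using B.free_eval_ideal[OF _ that] rel by blast
  have scale: "free_eval sB f' (const c * p) = sB c (free_eval sB f' p)" for c p by simp
  obtain F where lin: "Vector_Spaces.linear sA sB F"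
    and F: "\<And>p. p \<in> free_alg_on S \<Longrightarrow> F (free_eval sA f p) = free_eval sB f' p"
    using presented_by_factor[OF pres B.vector_space_axioms B.free_eval_add scale ideal] by blast
  have "F (a * b) = F a * F b" for a b
  proof -
    have "a \<in> free_eval sA f ` free_alg_on S" "b \<in> free_eval sA f ` free_alg_on S"
      using pres by (auto simp: presented_by_def)
    then obtain p p' where p: "p \<in> free_alg_on S" "a = free_eval sA f p"
      "p' \<in> free_alg_on S" "b = free_eval sA f p'" by auto
    with F[of "p * p'"] show ?thesis by (simp add: free_alg_on_mult F)
  qed
  moreover have "F 1 = 1" using F[of 1] by simp
  ultimately have "algebra_hom sA sB F" using lin by (simp add: algebra_hom_def)
  moreover have "F (f s) = f' s" if "s \<in> S" for s using F[of "gen s"] that by simp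
  ultimately show thesis using that by blast
qed

section \<open>Comodule algebras and comodule maps\<close>

text \<open>The map \<open>(id \<otimes> l) \<circ> \<rho>\<close>, by which the dual space of \<open>H\<close> acts on a comodule.\<close>

definition contract_coaction ::
  "('k::field \<Rightarrow> 'h::ring_1 \<Rightarrow> 'h) \<Rightarrow> ('k \<Rightarrow> 'a::ring_1 \<Rightarrow> 'a) \<Rightarrow> ('a \<Rightarrow> ('k, 'a, 'h) tensor) \<Rightarrow>
   ('h \<Rightarrow> 'k) \<Rightarrow> 'a \<Rightarrow> 'a" where
  "contract_coaction sH sA \<rho> l a = tensor_lift sA sH (\<lambda>x h. sA (l h) x) (\<rho> a)"

definition comodule_map ::
  "('k::field \<Rightarrow> 'h::ring_1 \<Rightarrow> 'h) \<Rightarrow> ('h \<Rightarrow> ('k, 'h, 'h) tensor) \<Rightarrow>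
   ('k \<Rightarrow> 'a::ring_1 \<Rightarrow> 'a) \<Rightarrow> ('a \<Rightarrow> ('k, 'a, 'h) tensor) \<Rightarrow> ('h \<Rightarrow> 'a) \<Rightarrow> bool" where
  "comodule_map sH \<Delta> sA \<rho> \<phi> \<longleftrightarrow>
     Vector_Spaces.linear sH sA \<phi> \<and> (\<forall>h. \<rho> (\<phi> h) = tensor_map sA sH \<phi> id (\<Delta> h))"

lemma tensor_map_compose:
  assumes "Vector_Spaces.linear sV sC f" and "vector_space sW" and "Vector_Spaces.linear sC sX f'"
    and "u \<in> tensor_space sV sW"
  shows "tensor_map sX sW f' id (tensor_map sC sW f id u) = tensor_map sX sW (f' \<circ> f) id u"
proof -
  obtain ps where u: "u = tensor_of sV sW ps" using assms(4) by (rule tensor_spaceE)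
  note i = linear_identity[OF assms(2)]
  show ?thesis
    using Vector_Spaces.linear_compose[OF assms(1,3)]
    by (simp add: u tensor_map_tensor_of[OF assms(1) i] tensor_map_tensor_of[OF assms(3) i]
        tensor_map_tensor_of[OF _ i] case_prod_unfold o_def)
qed

locale comodule_algebra_over_hopf =
  H: hopf_algebra sH \<Delta> \<epsilon> S + comodule_algebra sH \<Delta> \<epsilon> sA \<rho>
  for sH :: "'k::field \<Rightarrow> 'h::ring_1 \<Rightarrow> 'h"
    and \<Delta> :: "'h \<Rightarrow> ('k, 'h, 'h) tensor" and \<epsilon> :: "'h \<Rightarrow> 'k" and S :: "'h \<Rightarrow> 'h"
    and sA :: "'k \<Rightarrow> 'a::ring_1 \<Rightarrow> 'a" and \<rho> :: "'a \<Rightarrow> ('k, 'a, 'h) tensor"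
begin

lemma alg: "k_algebra sA" and algH: "k_algebra sH"
  by unfold_locales

lemma vs: "vector_space sA" and vsH: "vector_space sH"
  by unfold_locales

lemma comult_in_space: "\<Delta> h \<in> tensor_space sH sH"
  using H.comult_hom by (auto simp: algebra_hom_to_tensor_def)

lemma coaction_in_space: "\<rho> a \<in> tensor_space sA sH"
  and coaction_add: "\<rho> (a + b) = (\<lambda>\<beta>. \<rho> a \<beta> + \<rho> b \<beta>)"
  and coaction_scale: "\<rho> (sA c a) = (\<lambda>\<beta>. c * \<rho> a \<beta>)"
  and coaction_one: "\<rho> 1 = pure sA sH 1 1"
  and coaction_mult: "\<rho> (a * b) = tensor_mult sA sH (\<rho> a) (\<rho> b)"
  using coaction_hom by (auto simp: algebra_hom_to_tensor_def)

lemma coaction_zero: "\<rho> 0 = (\<lambda>\<beta>. 0)"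
  using coaction_scale[of 0 0] by simp

lemma coaction_diff: "\<rho> (a - b) = (\<lambda>\<beta>. \<rho> a \<beta> - \<rho> b \<beta>)"
  using coaction_add[of "a - b" b] by (auto simp: fun_eq_iff)

lemma coaction_mult_eval:
  "bilinear_form sA sH \<beta> \<Longrightarrow> \<rho> (a * b) \<beta> = \<rho> a (\<lambda>x h. \<rho> b (\<lambda>x' h'. \<beta> (x * x') (h * h')))"
  by (simp add: coaction_mult tensor_mult_eval)

lemma coaction_eqI:
  assumes "\<And>\<beta>. bilinear_form sA sH \<beta> \<Longrightarrow> \<rho> a \<beta> = tensor_of sA sH ps \<beta>"
  shows "\<rho> a = tensor_of sA sH ps"
  by (rule tensor_eqI[OF coaction_in_space _ assms]) auto

lemma counit_linear: "Vector_Spaces.linear sH (*) \<epsilon>"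
  using H.counit_hom by (simp add: algebra_hom_def)

lemma bilinear_map_contract:
  assumes "Vector_Spaces.linear sH (*) l"
  shows "bilinear_map sA sH sA (\<lambda>x h. sA (l h) x)"
  by (rule bilinear_map_contract_right[OF vs assms])

lemma contract_coaction_linear:
  assumes "Vector_Spaces.linear sH (*) l"
  shows "Vector_Spaces.linear sA sA (contract_coaction sH sA \<rho> l)"
  unfolding Vector_Spaces.linear_iff contract_coaction_def coaction_add coaction_scale
  using tensor_lift_add(2)[OF bilinear_map_contract[OF assms] coaction_in_space coaction_in_space]
    tensor_lift_scale(2)[OF bilinear_map_contract[OF assms] coaction_in_space]
  by (simp add: vs)

lemma contract_counit: "contract_coaction sH sA \<rho> \<epsilon> a = a"
proof -
  obtain ps where "\<rho> a = tensor_of sA sH ps" using coaction_in_space by (rule tensor_spaceE)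
  then show ?thesis
    using coaction_counit by (simp add: contract_coaction_def tensor_lift_tensor_of[OF bilinear_map_contract[OF counit_linear]])
qed

lemma linear_functional_contract:
  assumes "Vector_Spaces.linear sA (*) f" and "Vector_Spaces.linear sH (*) l"
  shows "f (contract_coaction sH sA \<rho> l a) = \<rho> a (\<lambda>x h. f x * l h)"
proof -
  have "f (sA c x) = c * f x" for c x using assms(1) by (simp add: Vector_Spaces.linear_iff)
  then show ?thesis
    unfolding contract_coaction_def
      linear_functional_tensor_lift[OF coaction_in_space bilinear_map_contract[OF assms(2)] assms(1)]
    by (simp add: mult.commute)
qed

lemma coaction_form_linear:
  assumes "bilinear_form sA sH \<beta>"
  shows "Vector_Spaces.linear sA (*) (\<lambda>a. \<rho> a \<beta>)"
  by (simp add: Vector_Spaces.linear_iff coaction_add coaction_scale vs vector_space_times)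

end

lemma (in hopf_algebra) regular_comodule_algebra: "comodule_algebra sH \<Delta> \<epsilon> sH \<Delta>"
  by unfold_locales (fact comult_hom coassoc counit_right)+

lemma (in hopf_algebra) regular_comodule_algebra_over_hopf:
  "comodule_algebra_over_hopf sH \<Delta> \<epsilon> S sH \<Delta>"
  by (intro comodule_algebra_over_hopf.intro hopf_algebra_axioms regular_comodule_algebra)

context comodule_algebra_over_hopf
begin

text \<open>Contracting the last leg of the coassociativity law: the dual of \<open>H\<close> acts on \<open>A\<close>, and the
  coaction intertwines this action with the one on \<open>H\<close>.\<close>

lemma coaction_contract:
  assumes l: "Vector_Spaces.linear sH (*) l" and B: "bilinear_form sA sH B"
  shows "\<rho> (contract_coaction sH sA \<rho> l b) B = \<rho> b (\<lambda>x k. B x (contract_coaction sH sH \<Delta> l k))"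
proof -
  interpret R: comodule_algebra_over_hopf sH \<Delta> \<epsilon> S sH \<Delta>
    by (rule H.regular_comodule_algebra_over_hopf)
  have lB: "Vector_Spaces.linear sH (*) (B a)" "Vector_Spaces.linear sA (*) (\<lambda>a. B a h)" for a h
    using B by (auto simp: bilinear_form_def)
  have tri: "trilinear_form sA sH sH (\<lambda>a h k. B a h * l k)"
    using lB l by (auto simp: trilinear_form_def Vector_Spaces.linear_iff algebra_simps)
  have "\<rho> b (\<lambda>a h. \<rho> a (\<lambda>a' h'. B a' h' * l h)) = \<rho> b (\<lambda>a h. \<Delta> h (\<lambda>h' h''. B a h' * l h''))"
    using fun_cong[OF coaction_coassoc[of b], of "\<lambda>a h k. B a h * l k"] tri
    by (simp add: tensor_ext_def pure3_def)
  moreover have "\<rho> a (\<lambda>a' h'. B a' h' * c) = c * \<rho> a B" for a c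
  proof -
    obtain ps where "\<rho> a = tensor_of sA sH ps" using coaction_in_space by (rule tensor_spaceE)
    moreover have "bilinear_form sA sH (\<lambda>a' h'. B a' h' * c)"
      using B by (auto simp: bilinear_form_def Vector_Spaces.linear_iff algebra_simps)
    ultimately show ?thesis
      by (simp add: tensor_of_eval B case_prod_unfold sum_list_const_mult mult.commute)
  qed
  moreover have "\<Delta> h (\<lambda>h' h''. B a h' * l h'') = B a (contract_coaction sH sH \<Delta> l h)" for a h
    by (rule R.linear_functional_contract[OF lB(1) l, symmetric])
  moreover have "\<rho> (contract_coaction sH sA \<rho> l b) B = \<rho> b (\<lambda>a h. l h * \<rho> a B)"
  proof -
    have "\<rho> (sA c x) B = c * \<rho> x B" for c x by (simp add: coaction_scale)
    then show ?thesis
      unfolding contract_coaction_def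
        linear_functional_tensor_lift[OF coaction_in_space bilinear_map_contract[OF l] coaction_form_linear[OF B]]
      by simp
  qed
  ultimately show ?thesis by simp
qed

lemma comodule_map_tensor:
  assumes "comodule_map sH \<Delta> sA \<rho> \<phi>" and "\<Delta> h = tensor_of sH sH hs"
  shows "\<rho> (\<phi> h) = tensor_of sA sH (map (\<lambda>(x, k). (\<phi> x, k)) hs)"
  using assms by (simp add: comodule_map_def tensor_map_tensor_of linear_identity vsH)

end

subsection \<open>Comodule algebra maps out of the tensor algebra\<close>

lemma tensor_algebra_generator_linear:
  assumes T: "tensor_algebra_of_copies sH \<Delta> \<epsilon> sT X \<delta>" and H: "vector_space sH" and i: "1 \<le> i"
  shows "Vector_Spaces.linear sH sT (X i)"
proof -
  have pres: "presented_by sT (case_prod X) ({1..} \<times> UNIV) (linearity_relators sH)"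
    using T by (simp add: tensor_algebra_of_copies_def)
  then interpret T: k_algebra sT by (simp add: presented_by_def)
  have "gen (i, h + h') - gen (i, h) - gen (i, h') \<in> linearity_relators sH"
    and "gen (i, sH c h) - const c * gen (i, h) \<in> linearity_relators sH" for h h' c
    unfolding linearity_relators_def using i by blast+
  from presented_by_relator[OF pres this(1)] presented_by_relator[OF pres this(2)]
  show ?thesis
    by (simp add: Vector_Spaces.linear_iff H T.vector_space_axioms T.free_eval_diff diff_eq_eq add.commute)
qed

context comodule_algebra_over_hopf
begin

text \<open>The two sides of the comodule condition are multiplicative, so it suffices that they agree on the
  generators, where they do because \<open>\<phi>\<close> is a comodule map.\<close>

lemma comodule_map_extends_to_tensor_algebra:
  assumes T: "tensor_algebra_of_copies sH \<Delta> \<epsilon> sT X \<delta>" and \<phi>: "comodule_map sH \<Delta> sA \<rho> \<phi>"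
  obtains F where "comodule_algebra_hom sH sT \<delta> sA \<rho> F" and "\<And>i h. 1 \<le> i \<Longrightarrow> F (X i h) = \<phi> h"
proof -
  have pres: "presented_by sT (case_prod X) ({1..} \<times> UNIV) (linearity_relators sH)"
    and com: "comodule_algebra sH \<Delta> \<epsilon> sT \<delta>"
    and \<delta>X: "\<And>i h. 1 \<le> i \<Longrightarrow> \<delta> (X i h) = tensor_map sT sH (X i) id (\<Delta> h)"
    using T by (auto simp: tensor_algebra_of_copies_def)
  interpret T: comodule_algebra_over_hopf sH \<Delta> \<epsilon> S sT \<delta>
    by (intro comodule_algebra_over_hopf.intro H.hopf_algebra_axioms com)
  have lin: "Vector_Spaces.linear sH sA \<phi>" and co: "\<And>h. \<rho> (\<phi> h) = tensor_map sA sH \<phi> id (\<Delta> h)"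
    using \<phi> by (auto simp: comodule_map_def)
  have rel: "free_eval sA (\<lambda>(i, h). \<phi> h) r = 0" if "r \<in> linearity_relators sH" for r
    using that lin by (auto simp: linearity_relators_def Vector_Spaces.linear_iff free_eval_diff)
  obtain F where F: "algebra_hom sT sA F"
    and FX: "\<And>s. s \<in> {1..} \<times> UNIV \<Longrightarrow> F (case_prod X s) = (case s of (i, h) \<Rightarrow> \<phi> h)"
    using presented_by_hom_exists[OF pres alg rel] by auto
  have FX': "F (X i h) = \<phi> h" if "1 \<le> i" for i h using FX[of "(i, h)"] that by simp
  have Flin: "Vector_Spaces.linear sT sA F" and F1: "F 1 = 1" and Fm: "\<And>a b. F (a * b) = F a * F b"
    using F by (auto simp: algebra_hom_def)
  have Fadd: "F (a + b) = F a + F b" and Fsc: "F (sT c a) = sA c (F a)" for a b c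
    using Flin by (auto simp: Vector_Spaces.linear_iff)
  have "\<rho> (F a) = tensor_map sA sH F id (\<delta> a)" for a
    using pres
  proof (induction a rule: presented_by_induct)
    case one
    show ?case
      unfolding F1 coaction_one T.coaction_one tensor_map_tensor_of[OF Flin linear_identity[OF vsH]]
      by (simp add: F1)
  next
    case (add a b)
    then show ?case
      by (simp add: Fadd coaction_add T.coaction_add tensor_map_def tensor_ext_def)
  next
    case (scale c a)
    then show ?case
      by (simp add: Fsc coaction_scale T.coaction_scale tensor_map_def tensor_ext_def)
  next
    case (mult s a)
    then obtain i h where s: "s = (i, h)" and i: "1 \<le> i" by auto
    have eq: "F \<circ> X i = \<phi>" using FX' i by auto
    have "\<rho> (F (X i h)) = tensor_map sA sH F id (\<delta> (X i h))"
      unfolding \<delta>X[OF i]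
        tensor_map_compose[OF tensor_algebra_generator_linear[OF T vsH i] vsH Flin comult_in_space]
      by (simp only: eq FX'[OF i] co)
    with mult show ?case
      unfolding s prod.case Fm coaction_mult T.coaction_mult
        tensor_map_mult[OF T.alg alg algH F T.coaction_in_space T.coaction_in_space]
      by (simp only:)
  qed
  with F have "comodule_algebra_hom sH sT \<delta> sA \<rho> F" by (simp add: comodule_algebra_hom_def)
  with FX' that show thesis by blast
qed

lemma comodule_map_of_tensor_algebra_hom:
  assumes T: "tensor_algebra_of_copies sH \<Delta> \<epsilon> sT X \<delta>"
    and F: "comodule_algebra_hom sH sT \<delta> sA \<rho> F" and i: "1 \<le> i"
  shows "comodule_map sH \<Delta> sA \<rho> (\<lambda>h. F (X i h))"
proof -
  have lin: "Vector_Spaces.linear sT sA F" and co: "\<And>a. \<rho> (F a) = tensor_map sA sH F id (\<delta> a)"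
    using F by (auto simp: comodule_algebra_hom_def algebra_hom_def)
  have \<delta>X: "\<delta> (X i h) = tensor_map sT sH (X i) id (\<Delta> h)" for h
    using T i by (auto simp: tensor_algebra_of_copies_def)
  note X = tensor_algebra_generator_linear[OF T vsH i]
  show ?thesis
    using Vector_Spaces.linear_compose[OF X lin] tensor_map_compose[OF X vsH lin comult_in_space]
    by (simp add: comodule_map_def co \<delta>X o_def)
qed

end

section \<open>The translation map of a Galois object\<close>

text \<open>Denoted \<open>\<kappa>\<close> in the comments below.\<close>

definition translation ::
  "('k::field \<Rightarrow> 'h::ring_1 \<Rightarrow> 'h) \<Rightarrow> ('k \<Rightarrow> 'a::ring_1 \<Rightarrow> 'a) \<Rightarrow> ('a \<Rightarrow> ('k, 'a, 'h) tensor) \<Rightarrow>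
   'h \<Rightarrow> ('k, 'a, 'a) tensor" where
  "translation sH sA \<rho> h = inv_into (tensor_space sA sA) (galois_map sH sA \<rho>) (pure sA sH 1 h)"

text \<open>Contractions of the first leg of the translation map are comodule maps from \<open>H\<close>, so they yield
  elements of \<open>A\<close> with a prescribed coaction.\<close>

definition section_map ::
  "('k::field \<Rightarrow> 'h::ring_1 \<Rightarrow> 'h) \<Rightarrow> ('k \<Rightarrow> 'a::ring_1 \<Rightarrow> 'a) \<Rightarrow> ('a \<Rightarrow> ('k, 'a, 'h) tensor) \<Rightarrow>
   ('a \<Rightarrow> 'k) \<Rightarrow> 'h \<Rightarrow> 'a" where
  "section_map sH sA \<rho> f h = tensor_lift sA sA (\<lambda>a b. sA (f a) b) (translation sH sA \<rho> h)"

locale hopf_galois_object = comodule_algebra_over_hopf +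
  assumes galois: "galois_object sH \<Delta> \<epsilon> sA \<rho>"
begin

lemma galois_bij: "bij_betw (galois_map sH sA \<rho>) (tensor_space sA sA) (tensor_space sA sH)"
  and coinvariant_iff: "\<rho> a = pure sA sH a 1 \<longleftrightarrow> (\<exists>c. a = sA c 1)"
  using galois by (auto simp: galois_object_def coinvariants_def set_eq_iff)

lemma galois_map_eval:
  assumes "bilinear_form sA sH \<beta>"
  shows "galois_map sH sA \<rho> u \<beta> = u (\<lambda>a b. \<rho> b (\<lambda>x h. \<beta> (a * x) h))"
  unfolding galois_map_def tensor_ext_def tensor_mult_eval[OF assms]
  by (simp add: tensor_of_eval bilinear_form_mult_tensor[OF alg algH assms coaction_in_space])

lemma bilinear_form_galois:
  assumes "bilinear_form sA sH \<beta>"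
  shows "bilinear_form sA sA (\<lambda>a b. \<rho> b (\<lambda>x h. \<beta> (a * x) h))"
proof -
  have b: "bilinear_form sA sH (\<lambda>x h. \<beta> (a * x) h)" for a
    using bilinear_form_mult_left[OF alg algH assms, of a 1] by simp
  have "Vector_Spaces.linear sA (*) (\<lambda>a. \<rho> c (\<lambda>x h. \<beta> (a * x) h))" for c
  proof -
    obtain ps where ps: "\<rho> c = tensor_of sA sH ps" using coaction_in_space by (rule tensor_spaceE)
    have sum: "\<rho> c (\<lambda>x h. \<beta> (a * x) h) = (\<Sum>(x, h)\<leftarrow>ps. \<beta> (a * x) h)" for a
      by (simp add: ps tensor_of_eval[OF b])
    have \<beta>: "\<beta> (x + x') h = \<beta> x h + \<beta> x' h" "\<beta> (sA c x) h = c * \<beta> x h" for x x' h c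
      using assms by (auto simp: bilinear_form_def Vector_Spaces.linear_iff)
    show ?thesis unfolding sum
      by (auto simp: Vector_Spaces.linear_iff vs vector_space_times distrib_right \<beta> case_prod_unfold
          sum_list_addf sum_list_const_mult simp flip: scale_mult_left)
  qed
  then show ?thesis
    using coaction_form_linear[OF b] by (simp add: bilinear_form_def)
qed

lemma galois_map_tensor_of_eval:
  assumes "bilinear_form sA sH \<beta>"
  shows "galois_map sH sA \<rho> (tensor_of sA sA ps) \<beta> = (\<Sum>(a, b)\<leftarrow>ps. \<rho> b (\<lambda>x h. \<beta> (a * x) h))"
  by (simp add: galois_map_eval[OF assms] tensor_of_eval[OF bilinear_form_galois[OF assms]])

lemma galois_map_in_space: "u \<in> tensor_space sA sA \<Longrightarrow> galois_map sH sA \<rho> u \<in> tensor_space sA sH"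
  using galois_bij by (auto simp: bij_betw_def)

lemma galois_map_inject:
  "u \<in> tensor_space sA sA \<Longrightarrow> u' \<in> tensor_space sA sA \<Longrightarrow>
   galois_map sH sA \<rho> u = galois_map sH sA \<rho> u' \<Longrightarrow> u = u'"
  using galois_bij by (auto simp: bij_betw_def inj_on_def)

lemma translation: "translation sH sA \<rho> h \<in> tensor_space sA sA"
  and galois_map_translation: "galois_map sH sA \<rho> (translation sH sA \<rho> h) = pure sA sH 1 h"
proof -
  have "pure sA sH 1 h \<in> galois_map sH sA \<rho> ` tensor_space sA sA"
    using galois_bij by (simp add: bij_betw_def)
  then show "translation sH sA \<rho> h \<in> tensor_space sA sA"
    and "galois_map sH sA \<rho> (translation sH sA \<rho> h) = pure sA sH 1 h"
    unfolding translation_def by (rule inv_into_into, rule f_inv_into_f)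
qed

lemma translation_eqI:
  assumes "u \<in> tensor_space sA sA"
    and "\<And>\<beta>. bilinear_form sA sH \<beta> \<Longrightarrow> galois_map sH sA \<rho> u \<beta> = \<beta> 1 h"
  shows "translation sH sA \<rho> h = u"
proof (rule galois_map_inject[OF translation assms(1)])
  show "galois_map sH sA \<rho> (translation sH sA \<rho> h) = galois_map sH sA \<rho> u"
    unfolding galois_map_translation
    by (rule tensor_eqI[OF _ galois_map_in_space[OF assms(1)]])
       (simp_all add: assms(2) tensor_of_eval)
qed

lemma translation_eval:
  "bilinear_form sA sH \<beta> \<Longrightarrow> galois_map sH sA \<rho> (translation sH sA \<rho> h) \<beta> = \<beta> 1 h"
  by (simp add: galois_map_translation tensor_of_eval)

lemma section_map_linear:
  assumes f: "Vector_Spaces.linear sA (*) f"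
  shows "Vector_Spaces.linear sH sA (section_map sH sA \<rho> f)"
proof -
  note bl = bilinear_map_contract_left[OF vs f]
  have "translation sH sA \<rho> (h + h') = (\<lambda>\<beta>. translation sH sA \<rho> h \<beta> + translation sH sA \<rho> h' \<beta>)"
    (is "_ = ?u") for h h'
  proof (rule translation_eqI)
    show "?u \<in> tensor_space sA sA" by (rule tensor_lift_add(1)[OF bl translation translation])
    fix \<beta> assume \<beta>: "bilinear_form sA sH \<beta>"
    then have "\<beta> 1 (h + h') = \<beta> 1 h + \<beta> 1 h'" by (simp add: bilinear_form_def Vector_Spaces.linear_iff)
    with translation_eval[OF \<beta>, of h] translation_eval[OF \<beta>, of h']
    show "galois_map sH sA \<rho> ?u \<beta> = \<beta> 1 (h + h')" by (simp add: galois_map_eval[OF \<beta>])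
  qed
  moreover have "translation sH sA \<rho> (sH c h) = (\<lambda>\<beta>. c * translation sH sA \<rho> h \<beta>)" (is "_ = ?u") for c h
  proof (rule translation_eqI)
    show "?u \<in> tensor_space sA sA" by (rule tensor_lift_scale(1)[OF bl translation])
    fix \<beta> assume \<beta>: "bilinear_form sA sH \<beta>"
    then have "\<beta> 1 (sH c h) = c * \<beta> 1 h" by (simp add: bilinear_form_def Vector_Spaces.linear_iff)
    with translation_eval[OF \<beta>, of h]
    show "galois_map sH sA \<rho> ?u \<beta> = \<beta> 1 (sH c h)" by (simp add: galois_map_eval[OF \<beta>])
  qed
  ultimately show ?thesis
    unfolding Vector_Spaces.linear_iff section_map_def
    by (simp add: vs vsH tensor_lift_add(2)[OF bl translation translation] tensor_lift_scale(2)[OF bl translation])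
qed

text \<open>Both sides of \<open>\<kappa>(h\<^sub>1) \<otimes> h\<^sub>2 = (id \<otimes> \<rho>)(\<kappa>(h))\<close>, \<open>\<kappa>\<close> being the translation map, have the same
  image under the injective Galois map once the last leg is contracted.\<close>

lemma section_map_comodule:
  assumes f: "Vector_Spaces.linear sA (*) f"
  shows "comodule_map sH \<Delta> sA \<rho> (section_map sH sA \<rho> f)"
proof -
  interpret R: comodule_algebra_over_hopf sH \<Delta> \<epsilon> S sH \<Delta>
    by (rule H.regular_comodule_algebra_over_hopf)
  let ?\<theta> = "section_map sH sA \<rho> f"
  note lin\<theta> = section_map_linear[OF f]
  note bl = bilinear_map_contract_left[OF vs f]
  have D: "contract_coaction sH sA \<rho> l (?\<theta> h) = ?\<theta> (contract_coaction sH sH \<Delta> l h)"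
    if l: "Vector_Spaces.linear sH (*) l" for l h
  proof -
    let ?D = "contract_coaction sH sA \<rho> l" and ?L = "contract_coaction sH sH \<Delta> l"
    obtain ps where ps: "translation sH sA \<rho> h = tensor_of sA sA ps"
      using translation by (rule tensor_spaceE)
    have "translation sH sA \<rho> (?L h) = tensor_of sA sA (map (\<lambda>(a, b). (a, ?D b)) ps)"
    proof (rule translation_eqI)
      fix \<beta> assume \<beta>: "bilinear_form sA sH \<beta>"
      have b: "bilinear_form sA sH (\<lambda>x h. \<beta> (a * x) h)" for a
        using bilinear_form_mult_left[OF alg algH \<beta>, of a 1] by simp
      have b': "bilinear_form sA sH (\<lambda>x h. \<beta> x (?L h))"
        using bilinear_form_compose[OF \<beta> linear_identity[OF vs] R.contract_coaction_linear[OF l]] by simp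
      show "galois_map sH sA \<rho> (tensor_of sA sA (map (\<lambda>(a, b). (a, ?D b)) ps)) \<beta> = \<beta> 1 (?L h)"
        using translation_eval[OF b', of h] unfolding ps galois_map_tensor_of_eval[OF b']
        by (simp add: galois_map_tensor_of_eval[OF \<beta>] case_prod_unfold o_def coaction_contract[OF l b])
    qed simp
    then show ?thesis
      using contract_coaction_linear[OF l]
      unfolding section_map_def ps tensor_lift_tensor_of[OF bl] linear_sum_list[OF contract_coaction_linear[OF l]]
      by (simp add: tensor_lift_tensor_of[OF bl] case_prod_unfold o_def Vector_Spaces.linear_iff)
  qed
  have "\<rho> (?\<theta> h) = tensor_map sA sH ?\<theta> id (\<Delta> h)" for h
  proof (rule tensor_eq_by_contractions[OF vs vsH coaction_in_space])
    show "tensor_map sA sH ?\<theta> id (\<Delta> h) \<in> tensor_space sA sH"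
      by (rule tensor_map_in_space[OF lin\<theta> linear_identity[OF vsH] comult_in_space])
    fix l assume l: "Vector_Spaces.linear sH (*) l"
    obtain hs where hs: "\<Delta> h = tensor_of sH sH hs" using comult_in_space by (rule tensor_spaceE)
    have sc: "?\<theta> (sH c x) = sA c (?\<theta> x)" for c x using lin\<theta> by (simp add: Vector_Spaces.linear_iff)
    have "tensor_lift sA sH (\<lambda>v w. sA (l w) v) (\<rho> (?\<theta> h)) = ?\<theta> (contract_coaction sH sH \<Delta> l h)"
      using D[OF l] by (simp add: contract_coaction_def)
    also have "\<dots> = tensor_lift sA sH (\<lambda>v w. sA (l w) v) (tensor_map sA sH ?\<theta> id (\<Delta> h))"
      unfolding contract_coaction_def hs tensor_map_tensor_of[OF lin\<theta> linear_identity[OF vsH]]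
          tensor_lift_tensor_of[OF bilinear_map_contract[OF l]]
          tensor_lift_tensor_of[OF R.bilinear_map_contract[OF l]] linear_sum_list[OF lin\<theta>]
      by (simp add: case_prod_unfold o_def sc)
    finally show "tensor_lift sA sH (\<lambda>v w. sA (l w) v) (\<rho> (?\<theta> h)) =
      tensor_lift sA sH (\<lambda>v w. sA (l w) v) (tensor_map sA sH ?\<theta> id (\<Delta> h))" .
  qed
  with lin\<theta> show ?thesis by (simp add: comodule_map_def)
qed

lemma section_map_one:
  assumes f: "Vector_Spaces.linear sA (*) f" and "f 1 = 1"
  shows "section_map sH sA \<rho> f 1 = 1"
proof -
  have "translation sH sA \<rho> 1 = pure sA sA 1 1"
    by (rule translation_eqI) (simp_all add: galois_map_tensor_of_eval coaction_one tensor_of_eval)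
  then show ?thesis
    by (simp add: section_map_def tensor_lift_tensor_of[OF bilinear_map_contract_left[OF vs f]] assms(2))
qed

text \<open>Writing \<open>\<kappa>(h) = \<Sum>\<^sub>b b \<otimes> \<theta>\<^sub>b(h)\<close> over a basis and multiplying the legs gives \<open>\<epsilon>(h)\<close>, so the
  values of the sections at a grouplike \<open>h\<close> generate \<open>A\<close> as a left ideal.\<close>

lemma section_maps_generate:
  obtains K F where "finite K" and "\<And>b. Vector_Spaces.linear sA (*) (F b)"
    and "(\<Sum>b\<in>K. b * section_map sH sA \<rho> (F b) h) = sA (\<epsilon> h) 1"
proof -
  obtain ps where ps: "translation sH sA \<rho> h = tensor_of sA sA ps"
    using translation by (rule tensor_spaceE)
  define B where "B = extend_basis {}"
  define F where "F b a = representation B a b" for b a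
  define K where "K = (\<Union>a\<in>fst ` set ps. {b. representation B a b \<noteq> 0})"
  have B: "independent B" "span B = UNIV"
    unfolding B_def using independent_extend_basis[OF independent_empty]
      span_extend_basis[OF independent_empty] by auto
  have K: "finite K" unfolding K_def by (auto simp: finite_representation)
  have lin: "Vector_Spaces.linear sA (*) (F b)" for b
    unfolding F_def by (rule linear_representation[OF B])
  have expand: "a = (\<Sum>b\<in>K. sA (F b a) b)" if "a \<in> fst ` set ps" for a
  proof -
    have "(\<Sum>b\<in>K. sA (F b a) b) = (\<Sum>b | representation B a b \<noteq> 0. sA (F b a) b)"
      using that K by (intro sum.mono_neutral_right) (auto simp: K_def F_def)
    also have "\<dots> = a" using B unfolding F_def by (intro sum_nonzero_representation_eq) auto
    finally show ?thesis by simp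
  qed
  have "(\<Sum>(a, b)\<leftarrow>ps. a * b) = sA (\<epsilon> h) 1"
  proof (rule eq_by_functionals[OF vs])
    fix l assume l: "Vector_Spaces.linear sA (*) l"
    note lm = Vector_Spaces.linear_compose[OF linear_mult(1) l, unfolded o_def]
    have \<beta>: "bilinear_form sA sH (\<lambda>x k. l x * \<epsilon> k)"
      by (rule bilinear_form_mult_functionals[OF l counit_linear])
    have "(\<Sum>(a, b)\<leftarrow>ps. l (a * b)) = (\<Sum>(a, b)\<leftarrow>ps. \<rho> b (\<lambda>x k. l (a * x) * \<epsilon> k))"
      by (simp add: linear_functional_contract[OF lm counit_linear, symmetric] contract_counit)
    also have "\<dots> = l 1 * \<epsilon> h"
      using translation_eval[OF \<beta>, of h] by (simp add: ps galois_map_tensor_of_eval[OF \<beta>])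
    finally show "l (\<Sum>(a, b)\<leftarrow>ps. a * b) = l (sA (\<epsilon> h) 1)"
      using l by (simp add: linear_sum_list[OF l] Vector_Spaces.linear_iff)
  qed
  moreover have "(\<Sum>(a, b)\<leftarrow>ps. a * b) = (\<Sum>b\<in>K. b * section_map sH sA \<rho> (F b) h)"
  proof -
    have "a * c = (\<Sum>b\<in>K. b * sA (F b a) c)" if "(a, c) \<in> set ps" for a c
    proof -
      have "a \<in> fst ` set ps" using that by force
      from expand[OF this] have "a * c = (\<Sum>b\<in>K. sA (F b a) b) * c" by simp
      then show ?thesis by (simp add: sum_distrib_right flip: scale_mult_left scale_mult_right)
    qed
    then have "(\<Sum>(a, c)\<leftarrow>ps. a * c) = (\<Sum>(a, c)\<leftarrow>ps. \<Sum>b\<in>K. b * sA (F b a) c)"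
      by (intro arg_cong[of _ _ sum_list] map_cong) auto
    also have "\<dots> = (\<Sum>b\<in>K. b * (\<Sum>(a, c)\<leftarrow>ps. sA (F b a) c))"
      by (induction ps) (auto simp: sum.distrib distrib_left)
    finally show ?thesis
      by (simp add: section_map_def ps tensor_lift_tensor_of[OF bilinear_map_contract_left[OF vs lin]])
  qed
  ultimately show thesis using that[OF K lin] by simp
qed

end

section \<open>The standard basis of a monomial Hopf algebra\<close>

lemma units_group_simps [simp]:
  "carrier units_group = UNIV - {0}" "monoid.mult units_group a b = a * b" "one units_group = 1"
  by (simp_all add: units_group_def)

lemma group_units_group: "group (units_group :: 'k::field monoid)"
proof (rule groupI)
  fix x :: 'k assume "x \<in> carrier units_group"
  then show "\<exists>y\<in>carrier units_group. y \<otimes>\<^bsub>units_group\<^esub> x = \<one>\<^bsub>units_group\<^esub>"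
    by (intro bexI[of _ "inverse x"]) auto
qed (auto simp: mult.assoc)

lemma pow_units_group [simp]: "a [^]\<^bsub>units_group\<^esub> (n::nat) = (a::'k::field) ^ n"
proof -
  interpret group "units_group :: 'k monoid" by (rule group_units_group)
  show ?thesis by (induction n) auto
qed

locale monomial_hopf =
  fixes G :: "'g monoid" (structure) and g :: 'g and \<chi> :: "'g \<Rightarrow> 'k::field" and \<mu> :: 'k
    and sH :: "'k \<Rightarrow> 'h::ring_1 \<Rightarrow> 'h" and \<iota> :: "'g \<Rightarrow> 'h" and y :: 'h
    and \<Delta> :: "'h \<Rightarrow> ('k, 'h, 'h) tensor" and \<epsilon> :: "'h \<Rightarrow> 'k" and S :: "'h \<Rightarrow> 'h"
  assumes datum: "group_datum G g \<chi> \<mu>"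
    and monomial: "monomial_hopf_algebra G g \<chi> \<mu> sH \<iota> y \<Delta> \<epsilon> S"
begin

sublocale G: group G
  using datum by (simp add: group_datum_def)

sublocale H: hopf_algebra sH \<Delta> \<epsilon> S
  using monomial by (simp add: monomial_hopf_algebra_def)

abbreviation q :: 'k where "q \<equiv> \<chi> g"

definition d :: nat where "d = group.ord units_group q"

definition \<gamma> :: 'g where "\<gamma> = g [^] d"

lemma pres: "presented_by sH (case_monomial_gen \<iota> y) (monomial_gens G) (monomial_relators G g \<chi> \<mu>)"
  using monomial by (simp add: monomial_hopf_algebra_def)

lemma finG: "finite (carrier G)" and gG [simp]: "g \<in> carrier G" and q_neq_1: "q \<noteq> 1"
  and g_central: "x \<in> carrier G \<Longrightarrow> g \<otimes> x = x \<otimes> g"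
  and chi_hom: "\<chi> \<in> hom G units_group"
  and mu_chi: "\<mu> \<noteq> 0 \<Longrightarrow> x \<in> carrier G \<Longrightarrow> \<chi> x ^ d = 1"
  using datum by (auto simp: group_datum_def d_def)

lemma chi_mult [simp]: "x \<in> carrier G \<Longrightarrow> z \<in> carrier G \<Longrightarrow> \<chi> (x \<otimes> z) = \<chi> x * \<chi> z"
  using hom_mult[OF chi_hom] by simp

lemma chi_nonzero [simp]: "x \<in> carrier G \<Longrightarrow> \<chi> x \<noteq> 0"
  using hom_in_carrier[OF chi_hom] by auto

lemma chi_one [simp]: "\<chi> \<one> = 1"
  using chi_mult[of \<one> \<one>] chi_nonzero[of \<one>] by (simp del: chi_mult)

lemma chi_pow: "x \<in> carrier G \<Longrightarrow> \<chi> (x [^] (n::nat)) = \<chi> x ^ n"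
  by (induction n) auto

lemma q_power_eq_1_iff: "q ^ n = 1 \<longleftrightarrow> d dvd n"
  using group.pow_eq_id[OF group_units_group, of q n] by (simp add: d_def)

lemma q_power_d [simp]: "q ^ d = 1"
  by (simp add: q_power_eq_1_iff)

lemma d_pos: "0 < d"
proof -
  have "q ^ Coset.order G = 1" using chi_pow[of g "Coset.order G"] G.pow_order_eq_1[of g] by simp
  then have "d dvd Coset.order G" by (simp add: q_power_eq_1_iff)
  moreover have "0 < Coset.order G" using finG G.order_gt_0_iff_finite by simp
  ultimately show ?thesis by (rule dvd_pos_nat[rotated])
qed

lemma q_power_neq_1: "0 < j \<Longrightarrow> j < d \<Longrightarrow> q ^ j \<noteq> 1"
  by (simp add: q_power_eq_1_iff nat_dvd_not_less)

lemma gpow_central: "x \<in> carrier G \<Longrightarrow> g [^] (n::nat) \<otimes> x = x \<otimes> g [^] n"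
proof (induction n)
  case (Suc n)
  have "g [^] Suc n \<otimes> x = g [^] n \<otimes> (g \<otimes> x)" using Suc.prems by (simp add: G.m_assoc)
  also have "\<dots> = (g [^] n \<otimes> x) \<otimes> g" using Suc.prems by (simp add: g_central G.m_assoc)
  also have "\<dots> = x \<otimes> g [^] Suc n" using Suc by (simp add: G.m_assoc)
  finally show ?case .
qed simp

lemma gamma_closed [simp]: "\<gamma> \<in> carrier G" and chi_gamma [simp]: "\<chi> \<gamma> = 1"
  by (simp_all add: \<gamma>_def chi_pow)

lemma gamma_central: "x \<in> carrier G \<Longrightarrow> \<gamma> \<otimes> x = x \<otimes> \<gamma>"
  unfolding \<gamma>_def by (rule gpow_central)

lemma iota_mult: "x \<in> carrier G \<Longrightarrow> z \<in> carrier G \<Longrightarrow> \<iota> x * \<iota> z = \<iota> (x \<otimes> z)"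
  and iota_one [simp]: "\<iota> \<one> = 1"
  and y_iota: "x \<in> carrier G \<Longrightarrow> y * \<iota> x = sH (\<chi> x) (\<iota> x * y)"
  and y_power_d: "y ^ d = sH \<mu> (1 - \<iota> g ^ d)"
proof -
  note rel = presented_by_relator[OF pres]
  show "\<iota> x * \<iota> z = \<iota> (x \<otimes> z)" if "x \<in> carrier G" "z \<in> carrier G"
  proof -
    have "gen (Grp x) * gen (Grp z) - gen (Grp (x \<otimes> z)) \<in> monomial_relators G g \<chi> \<mu>"
      unfolding monomial_relators_def using that by blast
    from rel[OF this] show ?thesis by (simp add: H.free_eval_diff)
  qed
  have "gen (Grp \<one>) - 1 \<in> monomial_relators G g \<chi> \<mu>"
    unfolding monomial_relators_def by blast
  from rel[OF this] show "\<iota> \<one> = 1" by (simp add: H.free_eval_diff)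
  show "y * \<iota> x = sH (\<chi> x) (\<iota> x * y)" if "x \<in> carrier G"
  proof -
    have "gen Y * gen (Grp x) - const (\<chi> x) * gen (Grp x) * gen Y \<in> monomial_relators G g \<chi> \<mu>"
      unfolding monomial_relators_def using that by blast
    from rel[OF this] show ?thesis by (simp add: H.free_eval_diff H.scale_mult_left)
  qed
  have "gen Y ^ d - const \<mu> * (1 - gen (Grp g) ^ d) \<in> monomial_relators G g \<chi> \<mu>"
    unfolding monomial_relators_def Let_def d_def by blast
  from rel[OF this] show "y ^ d = sH \<mu> (1 - \<iota> g ^ d)" by (simp add: H.free_eval_diff)
qed

lemma iota_pow: "x \<in> carrier G \<Longrightarrow> \<iota> x ^ n = \<iota> (x [^] n)"
  by (induction n) (simp_all add: iota_mult power_Suc2 del: power_Suc)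

lemma comult_iota: "x \<in> carrier G \<Longrightarrow> \<Delta> (\<iota> x) = pure sH sH (\<iota> x) (\<iota> x)"
  and counit_iota: "x \<in> carrier G \<Longrightarrow> \<epsilon> (\<iota> x) = 1"
  and comult_y: "\<Delta> y = tensor_of sH sH [(1, y), (y, \<iota> g)]"
  using monomial by (auto simp: monomial_hopf_algebra_def)

text \<open>The transpose of the left regular representation written in the expected basis \<open>x y\<^sup>i\<close>:
  a right action of words on functions of \<open>(x, i)\<close>.  It respects the relations, and a word
  \<open>x y\<^sup>i\<close> turns \<open>\<phi>\<close> into a function with value \<open>\<phi> (x, i)\<close> at \<open>(1, 0)\<close>; this separates the
  monomials.\<close>

fun step :: "('g \<times> nat \<Rightarrow> 'k) \<Rightarrow> 'g monomial_gen \<Rightarrow> 'g \<times> nat \<Rightarrow> 'k" where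
  "step \<phi> (Grp z) = (\<lambda>(x, i). \<phi> (z \<otimes> x, i))"
| "step \<phi> Y = (\<lambda>(x, i). \<chi> x * (if Suc i < d then \<phi> (x, Suc i) else \<mu> * (\<phi> (x, 0) - \<phi> (\<gamma> \<otimes> x, 0))))"

definition act :: "('k, 'g monomial_gen) free_alg \<Rightarrow> ('g \<times> nat \<Rightarrow> 'k) \<Rightarrow> 'g \<times> nat \<Rightarrow> 'k" where
  "act p \<phi> v = lin_ext (*) (\<lambda>w. foldl step \<phi> (letters w) v) p"

lemmas lin_ext_scalar = vector_space.lin_ext_add[OF vector_space_times]
  vector_space.lin_ext_diff[OF vector_space_times] vector_space.lin_ext_single[OF vector_space_times]
  vector_space.lin_ext_zero[OF vector_space_times]

lemma step_sum: "step (\<lambda>v. \<Sum>w\<in>A. c w * \<phi> w v) s = (\<lambda>v. \<Sum>w\<in>A. c w * step (\<phi> w) s v)"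
  by (cases s) (auto simp: fun_eq_iff sum_distrib_left right_diff_distrib sum_subtractf mult.left_commute)

lemma foldl_step_sum:
  "foldl step (\<lambda>v. \<Sum>w\<in>A. c w * \<phi> w v) l = (\<lambda>v. \<Sum>w\<in>A. c w * foldl step (\<phi> w) l v)"
  by (induction l arbitrary: \<phi>) (simp_all add: step_sum)

lemma act_add: "act (p + p') \<phi> v = act p \<phi> v + act p' \<phi> v"
  by (simp add: act_def lin_ext_scalar)

lemma act_diff: "act (p - p') \<phi> v = act p \<phi> v - act p' \<phi> v"
  by (simp add: act_def lin_ext_scalar)

lemma act_const: "act (const c) \<phi> v = c * \<phi> v"
  by (simp add: act_def const_def lin_ext_scalar)

lemma act_one: "act 1 \<phi> = \<phi>"
  using act_const[of 1] by (simp add: fun_eq_iff const_def)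

lemma act_gen: "act (gen s) \<phi> = step \<phi> s"
  by (simp add: act_def gen_def fun_eq_iff lin_ext_scalar)

lemma act_mult: "act (p * p') \<phi> = act p' (act p \<phi>)"
proof
  fix v
  have "act p' (act p \<phi>) v = (\<Sum>w'\<in>Poly_Mapping.keys p'. Poly_Mapping.lookup p' w' *
      (\<Sum>w\<in>Poly_Mapping.keys p. Poly_Mapping.lookup p w * foldl step (foldl step \<phi> (letters w)) (letters w') v))"
    unfolding act_def[of p'] lin_ext_def act_def[of p, abs_def] foldl_step_sum ..
  also have "\<dots> = act (p * p') \<phi> v"
    unfolding act_def[of "p * p'"] vector_space.lin_ext_mult[OF vector_space_times] sum_distrib_left
    by (subst sum.swap) (simp add: algebra_simps)
  finally show "act (p * p') \<phi> v = act p' (act p \<phi>) v" ..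
qed

lemma act_Grp_power: "x \<in> carrier G \<Longrightarrow> z \<in> carrier G \<Longrightarrow> act (gen (Grp z) ^ n) \<phi> (x, i) = \<phi> (z [^] n \<otimes> x, i)"
proof (induction n arbitrary: x)
  case (Suc n)
  then show ?case by (simp add: power_Suc2 act_mult act_gen G.m_assoc del: power_Suc)
qed (simp add: act_one)

lemma act_Y_power:
  "i + n < d \<Longrightarrow> act (gen Y ^ n) \<phi> (x, i) = \<chi> x ^ n * \<phi> (x, i + n)"
proof (induction n arbitrary: i)
  case (Suc n)
  then show ?case by (simp add: power_Suc2 act_mult act_gen del: power_Suc) 
qed (simp add: act_one)

lemma act_relator:
  assumes "r \<in> monomial_relators G g \<chi> \<mu>" and x: "x \<in> carrier G" and i: "i < d"
  shows "act r \<phi> (x, i) = 0"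
proof -
  consider x1 z1 where "r = gen (Grp x1) * gen (Grp z1) - gen (Grp (x1 \<otimes> z1))"
      "x1 \<in> carrier G" "z1 \<in> carrier G"
    | "r = gen (Grp \<one>) - 1"
    | x1 where "r = gen Y * gen (Grp x1) - const (\<chi> x1) * gen (Grp x1) * gen Y" "x1 \<in> carrier G"
    | "r = gen Y ^ d - const \<mu> * (1 - gen (Grp g) ^ d)"
    using assms(1) unfolding monomial_relators_def Let_def d_def by blast
  then show ?thesis
  proof cases
    case 1
    with x show ?thesis by (simp add: act_diff act_mult act_gen G.m_assoc)
  next
    case 2
    with x show ?thesis by (simp add: act_diff act_one act_gen)
  next
    case (3 x1)
    have "\<gamma> \<otimes> (x1 \<otimes> x) = x1 \<otimes> (\<gamma> \<otimes> x)"
      using x 3 gamma_central[of x1] by (simp flip: G.m_assoc)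
    with x 3(2) show ?thesis
      unfolding 3(1) by (simp add: act_diff act_mult act_gen act_const right_diff_distrib)
  next
    case 4
    \<comment> \<open>starting from \<open>(x, i)\<close>, exactly one of the \<open>d\<close> factors raises the exponent from \<open>d - 1\<close> to \<open>d\<close>\<close>
    have split: "gen Y ^ d = gen Y ^ i * (gen Y * gen Y ^ (d - Suc i))"
      using i by (simp flip: power_Suc power_add)
    have "act (gen Y ^ d) \<phi> (x, i) =
        \<chi> x ^ (d - Suc i) * (\<chi> x * (\<mu> * (\<chi> x ^ i * \<phi> (x, i) - \<chi> x ^ i * \<phi> (\<gamma> \<otimes> x, i))))"
      unfolding split act_mult act_gen using x i
      by (simp add: act_Y_power)
    also have "\<dots> = \<chi> x ^ (d - Suc i + Suc i) * \<mu> * (\<phi> (x, i) - \<phi> (\<gamma> \<otimes> x, i))"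
      by (simp only: power_add power_Suc) (simp add: algebra_simps)
    also have "\<dots> = \<mu> * (\<phi> (x, i) - \<phi> (\<gamma> \<otimes> x, i))"
      using i x mu_chi[of x] by (cases "\<mu> = 0") auto
    finally show ?thesis
      using x unfolding 4 by (simp add: act_diff act_mult act_const act_one act_Grp_power \<gamma>_def right_diff_distrib)
  qed
qed

lemma foldl_step_vanish:
  assumes "\<And>x i. x \<in> carrier G \<Longrightarrow> i < d \<Longrightarrow> \<phi> (x, i) = 0" and "set l \<subseteq> monomial_gens G"
    and "x \<in> carrier G" and "i < d"
  shows "foldl step \<phi> l (x, i) = 0"
  using assms
proof (induction l arbitrary: \<phi> x i)
  case (Cons s l)
  have "step \<phi> s (x, i) = 0" if "x \<in> carrier G" "i < d" for x i
    using Cons.prems(1,2) that by (cases s) (auto simp: monomial_gens_def d_pos)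
  then show ?case using Cons.IH[of "step \<phi> s"] Cons.prems by auto
qed auto

lemma act_ideal:
  assumes "p \<in> ideal_on (monomial_gens G) (monomial_relators G g \<chi> \<mu>)"
    and "x \<in> carrier G" and "i < d"
  shows "act p \<phi> (x, i) = 0"
  using assms
proof (induction arbitrary: \<phi> x i rule: ideal_on.induct)
  case zero
  then show ?case by (simp add: act_def lin_ext_scalar)
next
  case (mult r p p')
  have "foldl step (act r (act p \<phi>)) (letters w) (x, i) = 0" if "w \<in> Poly_Mapping.keys p'" for w
    using mult that by (intro foldl_step_vanish act_relator) (auto simp: free_alg_on_def)
  then show ?case by (simp add: act_mult act_def[of p'] lin_ext_def)
next
  case (add p p')
  then show ?case by (simp add: act_add)
qed

definition I :: "('g \<times> nat) set" where "I = carrier G \<times> {..<d}"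

lemma finI: "finite I"
  using finG by (simp add: I_def)

text \<open>Act on the indicator function of \<open>v\<close> and evaluate at \<open>(1, 0)\<close>.\<close>

lemma coordinate_exists:
  "\<exists>L. Vector_Spaces.linear sH (*) L \<and>
     (\<forall>x\<in>carrier G. \<forall>i<d. L (\<iota> x * y ^ i) = (if (x, i) = v then 1 else 0))"
proof -
  let ?\<phi> = "\<lambda>w. if w = v then 1 else 0"
  have scale: "act (const c * p) ?\<phi> (\<one>, 0) = c * act p ?\<phi> (\<one>, 0)" for c p
  proof -
    have "act (const c * p) ?\<phi> (\<one>, 0) = act (p * const c) ?\<phi> (\<one>, 0)"
      unfolding act_def vector_space.lin_ext_mult[OF vector_space_times] by (subst sum.swap) (auto simp: const_def mult.commute)
    then show ?thesis by (simp add: act_mult act_const)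
  qed
  obtain L where L: "Vector_Spaces.linear sH (*) L"
    and ev: "\<And>p. p \<in> free_alg_on (monomial_gens G) \<Longrightarrow>
        L (free_eval sH (case_monomial_gen \<iota> y) p) = act p ?\<phi> (\<one>, 0)"
    using presented_by_factor[OF pres vector_space_times, of "\<lambda>p. act p ?\<phi> (\<one>, 0)"]
      act_add scale act_ideal d_pos by auto
  have "L (\<iota> x * y ^ i) = (if (x, i) = v then 1 else 0)" if "x \<in> carrier G" "i < d" for x i
  proof -
    have "gen (Grp x) * gen Y ^ i \<in> free_alg_on (monomial_gens G)"
      using that by (intro free_alg_on_mult free_alg_on_power) (auto simp: monomial_gens_def)
    from ev[OF this] show ?thesis using that by (simp add: act_mult act_gen act_Y_power)
  qed
  with L show ?thesis by blast
qed

definition coord :: "'g \<times> nat \<Rightarrow> 'h \<Rightarrow> 'k" where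
  "coord v = (SOME L. Vector_Spaces.linear sH (*) L \<and>
     (\<forall>x\<in>carrier G. \<forall>i<d. L (\<iota> x * y ^ i) = (if (x, i) = v then 1 else 0)))"

lemma coord_linear: "Vector_Spaces.linear sH (*) (coord v)"
  and coord_monomial: "x \<in> carrier G \<Longrightarrow> i < d \<Longrightarrow> coord v (\<iota> x * y ^ i) = (if (x, i) = v then 1 else 0)"
  using someI_ex[OF coordinate_exists[of v]] unfolding coord_def by auto

lemma y_power_iota: "x \<in> carrier G \<Longrightarrow> y ^ n * \<iota> x = sH (\<chi> x ^ n) (\<iota> x * y ^ n)"
proof (induction n)
  case (Suc n)
  have "y ^ Suc n * \<iota> x = y * (y ^ n * \<iota> x)" by (simp add: mult.assoc)
  also have "\<dots> = sH (\<chi> x ^ n) (y * \<iota> x * y ^ n)" using Suc by (simp add: mult.assoc flip: H.scale_mult_right)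
  also have "\<dots> = sH (\<chi> x ^ Suc n) (\<iota> x * y ^ Suc n)"
    using Suc.prems by (simp add: y_iota mult.assoc mult.commute flip: H.scale_mult_left)
  finally show ?case .
qed simp

text \<open>The span contains \<open>1\<close> and is stable under left multiplication by the generators.\<close>

lemma monomials_span: "h \<in> H.span ((\<lambda>(x, i). \<iota> x * y ^ i) ` I)" (is "_ \<in> H.span ?E")
  using pres
proof (induction h rule: presented_by_induct)
  case one
  have "\<iota> \<one> * y ^ 0 \<in> ?E" using d_pos by (force simp: I_def)
  then show ?case using H.span_base[of 1 ?E] by simp
next
  case (mult s h)
  have base: "\<iota> x * y ^ i \<in> H.span ?E" if "x \<in> carrier G" "i < d" for x i
    using that by (intro H.span_base) (force simp: I_def)
  have gen: "case_monomial_gen \<iota> y s * e \<in> H.span ?E" if e: "e \<in> ?E" for e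
  proof -
    obtain x i where x: "x \<in> carrier G" and i: "i < d" and e: "e = \<iota> x * y ^ i"
      using e by (auto simp: I_def)
    show ?thesis
    proof (cases s)
      case (Grp z)
      then have "z \<in> carrier G" using mult.hyps by (auto simp: monomial_gens_def)
      then have "case_monomial_gen \<iota> y s * e = \<iota> (z \<otimes> x) * y ^ i"
        using x Grp by (simp add: e iota_mult flip: mult.assoc)
      then show ?thesis using base[of "z \<otimes> x" i] x i \<open>z \<in> carrier G\<close> by simp
    next
      case Y
      have "y * e = y * \<iota> x * y ^ i" by (simp add: e mult.assoc)
      also have "\<dots> = sH (\<chi> x) (\<iota> x * y ^ Suc i)"
        using x by (simp add: y_iota mult.assoc flip: H.scale_mult_left)
      finally have eq: "y * e = sH (\<chi> x) (\<iota> x * y ^ Suc i)" .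
      have "\<iota> x * y ^ Suc i \<in> H.span ?E"
      proof (cases "Suc i < d")
        case False
        then have "Suc i = d" using i by simp
        then have "\<iota> x * y ^ Suc i = sH \<mu> (\<iota> x * y ^ 0 - \<iota> (x \<otimes> \<gamma>) * y ^ 0)"
          using x by (simp add: y_power_d iota_pow \<gamma>_def right_diff_distrib iota_mult
              flip: H.scale_mult_right del: power_Suc)
        then show ?thesis
          using x d_pos by (simp add: H.span_scale H.span_diff base[of _ 0, simplified])
      qed (use base[of x "Suc i"] x in auto)
      with eq Y show ?thesis by (simp add: H.span_scale)
    qed
  qed
  show ?case using mult.IH
  proof (induction h rule: H.span_induct_alt)
    case base
    show ?case by (simp add: H.span_zero)
  next
    case (step c e h)
    have "case_monomial_gen \<iota> y s * (sH c e + h) =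
        sH c (case_monomial_gen \<iota> y s * e) + case_monomial_gen \<iota> y s * h"
      by (simp add: distrib_left flip: H.scale_mult_right)
    with step gen show ?case by (simp add: H.span_add H.span_scale)
  qed
qed (auto intro: H.span_add H.span_scale)

lemma monomial_expansion: "h = (\<Sum>(x, i)\<in>I. sH (coord (x, i) h) (\<iota> x * y ^ i))"
  using monomials_span[of h]
proof (induction h rule: H.span_induct_alt)
  case base
  have "coord v 0 = 0" for v using coord_linear[of v]
    by (metis Vector_Spaces.linear_iff H.scale_zero_left mult_zero_left)
  then show ?case by (simp add: case_prod_unfold)
next
  case (step c e h)
  obtain z j where zj: "(z, j) \<in> I" and e: "e = \<iota> z * y ^ j" using step by auto
  have coord: "coord (x, i) (sH c e + h) = c * (if (z, j) = (x, i) then 1 else 0) + coord (x, i) h" for x i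
    using coord_linear[of "(x, i)"] zj
    by (auto simp: Vector_Spaces.linear_iff e coord_monomial I_def)
  have "(\<Sum>(x, i)\<in>I. sH (coord (x, i) (sH c e + h)) (\<iota> x * y ^ i)) =
      (\<Sum>v\<in>I. if (z, j) = v then sH c e else 0) + (\<Sum>(x, i)\<in>I. sH (coord (x, i) h) (\<iota> x * y ^ i))"
    unfolding sum.distrib[symmetric] coord
    by (intro sum.cong) (auto simp: e H.scale_left_distrib split: if_splits)
  then show ?case using zj finI step(2) by simp
qed

end

section \<open>Gaussian binomial coefficients\<close>

text \<open>The coefficients of \<open>(P + Q)\<^sup>n = \<Sum>\<^sub>j qbinom q n j Q\<^sup>j P\<^sup>n\<^sup>-\<^sup>j\<close> for \<open>P Q = q Q P\<close>.\<close>

fun qbinom :: "'k::field \<Rightarrow> nat \<Rightarrow> nat \<Rightarrow> 'k" where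
  "qbinom q n 0 = 1"
| "qbinom q 0 (Suc j) = 0"
| "qbinom q (Suc n) (Suc j) = qbinom q n (Suc j) + q ^ (n - j) * qbinom q n j"

lemma qbinom_eq_0: "n < j \<Longrightarrow> qbinom q n j = 0"
  by (induction q n j rule: qbinom.induct) auto

text \<open>A recursion along a row.  For \<open>j = 0\<close> the factor on the right is \<open>1 - q\<^sup>n\<close>, so at a primitive \<open>n\<close>-th root
  of unity all the inner entries vanish in turn.\<close>

lemma qbinom_absorb:
  "j \<le> n \<Longrightarrow> (1 - q ^ Suc j) * qbinom q n (Suc j) = (1 - q ^ (n - j)) * qbinom q n j"
proof (induction n arbitrary: j)
  case (Suc n)
  have *: "(1 - q ^ Suc j) * qbinom q (Suc n) (Suc j) = (1 - q ^ Suc n) * qbinom q n j" if "j \<le> n" for j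
  proof -
    have p: "q ^ (n - j) * q ^ Suc j = q ^ Suc n" using that by (simp flip: power_add)
    have "(1 - q ^ Suc j) * qbinom q (Suc n) (Suc j) =
        (1 - q ^ Suc j) * qbinom q n (Suc j) + (q ^ (n - j) - q ^ (n - j) * q ^ Suc j) * qbinom q n j"
      by (simp add: algebra_simps)
    then show ?thesis unfolding Suc.IH[OF that] p by (simp add: algebra_simps)
  qed
  show ?case
  proof (cases j)
    case 0
    then show ?thesis using *[of 0] by simp
  next
    case (Suc i)
    show ?thesis
    proof (cases "j = Suc n")
      case True
      then show ?thesis by (simp add: qbinom_eq_0)
    next
      case False
      then have j: "j \<le> n" "i \<le> n" using Suc.prems Suc by auto
      have e: "Suc n - j = n - i" using Suc by simp
      have "(1 - q ^ (Suc n - j)) * qbinom q (Suc n) j =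
          (1 - q ^ (n - i)) * qbinom q n j + q ^ (n - i) * ((1 - q ^ (n - i)) * qbinom q n i)"
        unfolding e by (simp add: Suc algebra_simps)
      also have "(1 - q ^ (n - i)) * qbinom q n i = (1 - q ^ j) * qbinom q n j"
        using Suc.IH[OF j(2)] Suc by simp
      also have "(1 - q ^ (n - i)) * qbinom q n j + q ^ (n - i) * ((1 - q ^ j) * qbinom q n j) =
          (1 - q ^ (n - i) * q ^ j) * qbinom q n j" by (simp add: algebra_simps)
      also have "q ^ (n - i) * q ^ j = q ^ Suc n" using Suc j(2) by (simp flip: power_add)
      finally show ?thesis using *[OF j(1)] by simp
    qed
  qed
qed simp

lemma qbinom_vanishes:
  assumes "q ^ n = 1" and "\<And>j. 0 < j \<Longrightarrow> j < n \<Longrightarrow> q ^ j \<noteq> 1" and "0 < j" and "j < n"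
  shows "qbinom q n j = 0"
  using assms(3,4)
proof (induction j rule: nat_induct_non_zero)
  case 1
  then show ?case using qbinom_absorb[of 0 n q] assms(1) assms(2)[of 1] by auto
next
  case (Suc j)
  then show ?case using qbinom_absorb[of j n q] assms(2)[of "Suc j"] by auto
qed

lemma qbinom_self: "qbinom q n n = 1"
  by (induction n) (simp_all add: qbinom_eq_0)

section \<open>Comodule algebras with a frame\<close>

text \<open>Elements \<open>u\<^sub>x\<close> and \<open>Z\<close> on which the coaction has the form that the coproduct has on \<open>x\<close> and \<open>y\<close>.  In
  particular \<open>H\<close> is framed by its own generators.\<close>

locale monomial_frame =
  monomial_hopf G g \<chi> \<mu> sH \<iota> y \<Delta> \<epsilon> S + comodule_algebra_over_hopf sH \<Delta> \<epsilon> S sA \<rho>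
  for G :: "'g monoid" (structure) and g :: 'g and \<chi> :: "'g \<Rightarrow> 'k::field" and \<mu> :: 'k
    and sH :: "'k \<Rightarrow> 'h::ring_1 \<Rightarrow> 'h" and \<iota> :: "'g \<Rightarrow> 'h" and y :: 'h
    and \<Delta> :: "'h \<Rightarrow> ('k, 'h, 'h) tensor" and \<epsilon> :: "'h \<Rightarrow> 'k" and S :: "'h \<Rightarrow> 'h"
    and sA :: "'k \<Rightarrow> 'a::ring_1 \<Rightarrow> 'a" and \<rho> :: "'a \<Rightarrow> ('k, 'a, 'h) tensor" +
  fixes u :: "'g \<Rightarrow> 'a" and Z :: 'a
  assumes coaction_u: "x \<in> carrier G \<Longrightarrow> \<rho> (u x) = pure sA sH (u x) (\<iota> x)"
    and coaction_Z: "\<rho> Z = tensor_of sA sH [(1, y), (Z, \<iota> g)]"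
begin

text \<open>The summands \<open>1 \<otimes> y\<close> and \<open>Z \<otimes> g\<close> of \<open>\<rho>(Z)\<close> commute up to the factor \<open>q\<close>, because \<open>y\<close> and
  \<open>g\<close> do.\<close>

lemma coaction_Z_power:
  assumes "bilinear_form sA sH \<beta>"
  shows "\<rho> (Z ^ n) \<beta> = (\<Sum>j\<le>n. qbinom q n j * \<beta> (Z ^ j) (\<iota> g ^ j * y ^ (n - j)))"
  using assms
proof (induction n arbitrary: \<beta>)
  case 0
  then show ?case by (simp add: coaction_one tensor_of_eval)
next
  case (Suc n)
  note right = bilinear_form_mult_right[OF alg algH Suc.prems]
  have inner: "\<rho> Z (\<lambda>x' h'. \<beta> (x * x') (h * h')) = \<beta> x (h * y) + \<beta> (x * Z) (h * \<iota> g)" for x h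
    by (simp add: coaction_Z tensor_of_eval bilinear_form_mult_left[OF alg algH Suc.prems])
  have "\<rho> (Z ^ Suc n) \<beta> = \<rho> (Z ^ n) (\<lambda>x h. \<beta> x (h * y) + \<beta> (x * Z) (h * \<iota> g))"
    unfolding power_Suc2 coaction_mult_eval[OF Suc.prems] inner ..
  also have "\<dots> = (\<Sum>j\<le>n. qbinom q n j *
      (\<beta> (Z ^ j) (\<iota> g ^ j * y ^ (n - j) * y) + \<beta> (Z ^ j * Z) (\<iota> g ^ j * y ^ (n - j) * \<iota> g)))"
    using right[of 1 y] by (intro Suc.IH bilinear_form_add right) simp
  also have "\<dots> = (\<Sum>j\<le>n. qbinom q n j * \<beta> (Z ^ j) (\<iota> g ^ j * y ^ (Suc n - j))) +
      (\<Sum>j\<le>n. q ^ (n - j) * qbinom q n j * \<beta> (Z ^ Suc j) (\<iota> g ^ Suc j * y ^ (n - j)))"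
  proof -
    have "\<iota> g ^ j * y ^ (n - j) * y = \<iota> g ^ j * y ^ (Suc n - j)" if "j \<le> n" for j
      using that by (simp add: Suc_diff_le mult.assoc flip: power_Suc2)
    moreover have "\<beta> a (\<iota> g ^ j * y ^ m * \<iota> g) = q ^ m * \<beta> a (\<iota> g ^ Suc j * y ^ m)" for a j m
    proof -
      have "\<iota> g ^ j * y ^ m * \<iota> g = sH (q ^ m) (\<iota> g ^ Suc j * y ^ m)"
        unfolding mult.assoc y_power_iota[OF gG] power_Suc2 by (simp flip: H.scale_mult_right)
      then show ?thesis using Suc.prems by (simp add: bilinear_form_def Vector_Spaces.linear_iff)
    qed
    ultimately show ?thesis
      by (simp add: distrib_left sum.distrib mult_ac flip: power_Suc2)
  qed
  also have "(\<Sum>j\<le>n. qbinom q n j * \<beta> (Z ^ j) (\<iota> g ^ j * y ^ (Suc n - j))) =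
      (\<Sum>j\<le>Suc n. qbinom q n j * \<beta> (Z ^ j) (\<iota> g ^ j * y ^ (Suc n - j)))"
    by (simp add: qbinom_eq_0)
  also have "\<dots> = \<beta> 1 (y ^ Suc n) +
      (\<Sum>j\<le>n. qbinom q n (Suc j) * \<beta> (Z ^ Suc j) (\<iota> g ^ Suc j * y ^ (n - j)))"
    unfolding sum.atMost_Suc_shift by simp
  finally show ?case
    unfolding sum.atMost_Suc_shift by (simp add: distrib_right sum.distrib add.assoc)
qed

lemma coaction_u_mult:
  assumes "x \<in> carrier G" and "bilinear_form sA sH \<beta>"
  shows "\<rho> (u x * a) \<beta> = \<rho> a (\<lambda>z h. \<beta> (u x * z) (\<iota> x * h))"
    and "\<rho> (a * u x) \<beta> = \<rho> a (\<lambda>z h. \<beta> (z * u x) (h * \<iota> x))"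
  using assms
  by (simp_all add: coaction_mult_eval coaction_u tensor_of_eval bilinear_form_mult_tensor alg algH coaction_in_space
      bilinear_form_mult_left)

lemma coaction_frame:
  assumes "x \<in> carrier G" and "bilinear_form sA sH \<beta>"
  shows "\<rho> (u x * Z ^ n) \<beta> =
    (\<Sum>j\<le>n. qbinom q n j * \<beta> (u x * Z ^ j) (\<iota> (x \<otimes> g [^] j) * y ^ (n - j)))"
  using assms
  by (simp add: coaction_u_mult coaction_Z_power bilinear_form_mult_left alg algH iota_pow iota_mult
      flip: mult.assoc)

text \<open>The map \<open>x y\<^sup>i \<mapsto> u\<^sub>x Z\<^sup>i\<close>, which identifies \<open>A\<close> with \<open>H\<close> as a comodule when \<open>A\<close> is a Galois object.\<close>

definition frame_map :: "'h \<Rightarrow> 'a" where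
  "frame_map h = (\<Sum>(x, i)\<in>I. sA (coord (x, i) h) (u x * Z ^ i))"

lemma frame_map_linear: "Vector_Spaces.linear sH sA frame_map"
proof -
  have "coord v (a + b) = coord v a + coord v b" "coord v (sH c a) = c * coord v a" for v a b c
    using coord_linear[of v] by (auto simp: Vector_Spaces.linear_iff)
  then show ?thesis
    unfolding Vector_Spaces.linear_iff frame_map_def
    by (simp add: vs vsH case_prod_unfold scale_left_distrib sum.distrib scale_sum_right)
qed

lemma frame_map_monomial:
  assumes "x \<in> carrier G" and "i < d"
  shows "frame_map (\<iota> x * y ^ i) = u x * Z ^ i"
proof -
  have "frame_map (\<iota> x * y ^ i) = (\<Sum>v\<in>I. if v = (x, i) then u x * Z ^ i else 0)"
    unfolding frame_map_def using assms by (intro sum.cong) (auto simp: coord_monomial split: if_splits)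
  then show ?thesis using assms finI by (simp add: I_def)
qed

end

context monomial_hopf
begin

lemma regular_frame: "monomial_frame G g \<chi> \<mu> sH \<iota> y \<Delta> \<epsilon> S sH \<Delta> \<iota> y"
  by (intro monomial_frame.intro monomial_hopf_axioms H.regular_comodule_algebra_over_hopf
      monomial_frame_axioms.intro comult_iota comult_y)

lemma linear_eq_on_monomials:
  assumes "Vector_Spaces.linear sH sV f" and "Vector_Spaces.linear sH sV f'"
    and "\<And>x i. x \<in> carrier G \<Longrightarrow> i < d \<Longrightarrow> f (\<iota> x * y ^ i) = f' (\<iota> x * y ^ i)"
  shows "f h = f' h"
proof -
  interpret F: Vector_Spaces.linear sH sV f by fact
  interpret F': Vector_Spaces.linear sH sV f' by fact
  have "f (\<Sum>(x, i)\<in>I. sH (coord (x, i) h) (\<iota> x * y ^ i)) = f' (\<Sum>(x, i)\<in>I. sH (coord (x, i) h) (\<iota> x * y ^ i))"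
    using assms(3) by (auto simp: F.sum F'.sum case_prod_unfold F.scale F'.scale I_def intro!: sum.cong)
  then show ?thesis by (simp flip: monomial_expansion)
qed

end

context monomial_frame
begin

lemma frame_map_comodule: "comodule_map sH \<Delta> sA \<rho> frame_map"
proof -
  interpret R: monomial_frame G g \<chi> \<mu> sH \<iota> y \<Delta> \<epsilon> S sH \<Delta> \<iota> y by (rule regular_frame)
  have "\<rho> (frame_map h) = tensor_map sA sH frame_map id (\<Delta> h)" for h
  proof (rule tensor_eqI[OF coaction_in_space])
    show "tensor_map sA sH frame_map id (\<Delta> h) \<in> tensor_space sA sH"
      by (rule tensor_map_in_space[OF frame_map_linear linear_identity[OF vsH] comult_in_space])
    fix \<beta> assume \<beta>: "bilinear_form sA sH \<beta>"
    have \<beta>': "bilinear_form sH sH (\<lambda>v w. \<beta> (frame_map v) w)"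
      using bilinear_form_compose[OF \<beta> frame_map_linear linear_identity[OF vsH]] by simp
    have "\<rho> (frame_map h) \<beta> = \<Delta> h (\<lambda>v w. \<beta> (frame_map v) w)"
    proof (rule linear_eq_on_monomials[where sV = "(*)" and f = "\<lambda>h. \<rho> (frame_map h) \<beta>"
          and f' = "\<lambda>h. \<Delta> h (\<lambda>v w. \<beta> (frame_map v) w)"])
      show "Vector_Spaces.linear sH (*) (\<lambda>h. \<rho> (frame_map h) \<beta>)"
        using Vector_Spaces.linear_compose[OF frame_map_linear coaction_form_linear[OF \<beta>]]
        by (simp add: o_def)
      show "Vector_Spaces.linear sH (*) (\<lambda>h. \<Delta> h (\<lambda>v w. \<beta> (frame_map v) w))"
        by (rule R.coaction_form_linear[OF \<beta>'])
      fix x i assume "x \<in> carrier G" "i < d"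
      then show "\<rho> (frame_map (\<iota> x * y ^ i)) \<beta> = \<Delta> (\<iota> x * y ^ i) (\<lambda>v w. \<beta> (frame_map v) w)"
        by (simp add: frame_map_monomial coaction_frame[OF _ \<beta>] R.coaction_frame[OF _ \<beta>'])
    qed
    then show "\<rho> (frame_map h) \<beta> = tensor_map sA sH frame_map id (\<Delta> h) \<beta>"
      by (simp add: tensor_map_eval[OF \<beta>])
  qed
  with frame_map_linear show ?thesis by (simp add: comodule_map_def)
qed

lemma coaction_Z_power_d:
  assumes "bilinear_form sA sH \<beta>"
  shows "\<rho> (Z ^ d) \<beta> = \<beta> 1 (y ^ d) + \<beta> (Z ^ d) (\<iota> \<gamma>)"
proof -
  have "\<rho> (Z ^ d) \<beta> = (\<Sum>j\<in>{0, d}. qbinom q d j * \<beta> (Z ^ j) (\<iota> g ^ j * y ^ (d - j)))"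
    unfolding coaction_Z_power[OF assms]
    by (rule sum.mono_neutral_right)
       (auto simp: qbinom_vanishes[OF q_power_d q_power_neq_1])
  then show ?thesis using d_pos by (simp add: qbinom_self iota_pow \<gamma>_def)
qed

text \<open>The triangular shape of the coaction: only \<open>u\<^sub>z Z\<^sup>m\<close> itself contributes the monomial \<open>z y\<^sup>m\<close>
  among the products of \<open>Z\<close>-degree at most \<open>m\<close>.\<close>

lemma frame_map_inj:
  assumes nz: "\<And>x. x \<in> carrier G \<Longrightarrow> u x \<noteq> 0" and zero: "frame_map h = 0"
  shows "h = 0"
proof -
  have "coord (z, m) h = 0" if "(z, m) \<in> I" for z m
    using that
  proof (induction "d - m" arbitrary: z m rule: less_induct)
    case less
    then have z: "z \<in> carrier G" and m: "m < d" by (auto simp: I_def)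
    obtain f where f: "Vector_Spaces.linear sA (*) f" "f (u z) = 1"
      using functional_normalised_at[OF vs nz[OF z]] by blast
    define \<beta> where "\<beta> a k = f a * coord (z, m) k" for a k
    have \<beta>: "bilinear_form sA sH \<beta>"
      unfolding \<beta>_def by (rule bilinear_form_mult_functionals[OF f(1) coord_linear])
    have summand: "coord (x, i) h * \<rho> (u x * Z ^ i) \<beta> = (if (x, i) = (z, m) then coord (z, m) h else 0)"
      if xi: "(x, i) \<in> I" for x i
    proof (cases "m < i")
      case True
      then have "coord (x, i) h = 0" using less.hyps[of i x] xi by (auto simp: I_def)
      with True show ?thesis by simp
    next
      case False
      have x: "x \<in> carrier G" and i: "i < d" using xi by (auto simp: I_def)
      have "\<rho> (u x * Z ^ i) \<beta> = (\<Sum>j\<le>i. if j = 0 then (if (x, i) = (z, m) then 1 else 0) else 0)"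
        unfolding coaction_frame[OF x \<beta>]
      proof (rule sum.cong)
        fix j assume "j \<in> {..i}"
        then have c: "coord (z, m) (\<iota> (x \<otimes> g [^] j) * y ^ (i - j)) =
            (if (x \<otimes> g [^] j, i - j) = (z, m) then 1 else 0)"
          using x i by (intro coord_monomial) auto
        show "qbinom q i j * \<beta> (u x * Z ^ j) (\<iota> (x \<otimes> g [^] j) * y ^ (i - j)) =
            (if j = 0 then if (x, i) = (z, m) then 1 else 0 else 0)"
          unfolding \<beta>_def c using False \<open>j \<in> {..i}\<close> f(2) x by (cases j) auto
      qed simp
      then show ?thesis by simp
    qed
    have lin: "Vector_Spaces.linear sA (*) (\<lambda>a. \<rho> a \<beta>)" by (rule coaction_form_linear[OF \<beta>])
    interpret L: Vector_Spaces.linear sA "(*)" "\<lambda>a. \<rho> a \<beta>" by (rule lin)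
    have "0 = \<rho> (frame_map h) \<beta>" by (simp add: zero coaction_zero)
    also have "\<dots> = (\<Sum>(x, i)\<in>I. coord (x, i) h * \<rho> (u x * Z ^ i) \<beta>)"
      by (simp add: frame_map_def L.sum L.scale case_prod_unfold)
    also have "\<dots> = (\<Sum>v\<in>I. if v = (z, m) then coord (z, m) h else 0)"
    proof (intro sum.cong refl)
      fix v assume v: "v \<in> I"
      obtain x i where "v = (x, i)" by (cases v)
      with summand[of x i] v show "(case v of (x, i) \<Rightarrow> coord (x, i) h * \<rho> (u x * Z ^ i) \<beta>) =
          (if v = (z, m) then coord (z, m) h else 0)" by simp
    qed
    also have "\<dots> = coord (z, m) h" using finI less.prems by simp
    finally show ?case by simp
  qed
  then have "(\<Sum>(x, i)\<in>I. sH (coord (x, i) h) (\<iota> x * y ^ i)) = 0"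
    by (intro sum.neutral) auto
  then show ?thesis by (simp flip: monomial_expansion)
qed

end

section \<open>The structure of Galois objects of a monomial Hopf algebra\<close>

locale monomial_galois =
  monomial_hopf G g \<chi> \<mu> sH \<iota> y \<Delta> \<epsilon> S + hopf_galois_object sH \<Delta> \<epsilon> S sA \<rho>
  for G :: "'g monoid" (structure) and g :: 'g and \<chi> :: "'g \<Rightarrow> 'k::field" and \<mu> :: 'k
    and sH :: "'k \<Rightarrow> 'h::ring_1 \<Rightarrow> 'h" and \<iota> :: "'g \<Rightarrow> 'h" and y :: 'h
    and \<Delta> :: "'h \<Rightarrow> ('k, 'h, 'h) tensor" and \<epsilon> :: "'h \<Rightarrow> 'k" and S :: "'h \<Rightarrow> 'h"
    and sA :: "'k \<Rightarrow> 'a::ring_1 \<Rightarrow> 'a" and \<rho> :: "'a \<Rightarrow> ('k, 'a, 'h) tensor"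
begin

text \<open>The homogeneous component of \<open>A\<close> belonging to the grouplike element \<open>x\<close>.\<close>

definition comp :: "'g \<Rightarrow> 'a set" where
  "comp x = {a. \<rho> a = pure sA sH a (\<iota> x)}"

lemma compI: "(\<And>\<beta>. bilinear_form sA sH \<beta> \<Longrightarrow> \<rho> a \<beta> = \<beta> a (\<iota> x)) \<Longrightarrow> a \<in> comp x"
  unfolding comp_def by (auto intro!: coaction_eqI simp: tensor_of_eval)

lemma compD: "a \<in> comp x \<Longrightarrow> bilinear_form sA sH \<beta> \<Longrightarrow> \<rho> a \<beta> = \<beta> a (\<iota> x)"
  by (simp add: comp_def tensor_of_eval)

lemma comp_mult:
  assumes "x \<in> carrier G" and "z \<in> carrier G" and "a \<in> comp x" and "b \<in> comp z"
  shows "a * b \<in> comp (x \<otimes> z)"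
  using assms by (intro compI)
    (simp add: coaction_mult_eval compD bilinear_form_mult_left bilinear_form_mult_right alg algH iota_mult)

lemma comp_one_iff: "a \<in> comp \<one> \<longleftrightarrow> (\<exists>c. a = sA c 1)"
  by (simp add: comp_def coinvariant_iff)

lemma section_map_in_comp:
  assumes "x \<in> carrier G" and "Vector_Spaces.linear sA (*) f"
  shows "section_map sH sA \<rho> f (\<iota> x) \<in> comp x"
  using comodule_map_tensor[OF section_map_comodule[OF assms(2)] comult_iota[OF assms(1)]]
  by (simp add: comp_def)

text \<open>The sections write \<open>1\<close> as an element of \<open>A A\<^sub>x\<close>, and likewise of \<open>A A\<^sub>z\<close> for \<open>z = x\<^sup>-\<^sup>1\<close>.  Hence \<open>A\<^sub>z A\<^sub>x \<noteq> 0\<close>,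
  and this product consists of coinvariants, that is, of scalars.\<close>

lemma comp_has_unit:
  assumes x: "x \<in> carrier G"
  obtains w w' where "w \<in> comp x" and "w' \<in> comp (inv x)" and "w * w' = 1" and "w' * w = 1"
proof -
  obtain K F where K: "finite (K :: 'a set)" "\<And>b. Vector_Spaces.linear sA (*) (F b)"
    and one: "(\<Sum>b\<in>K. b * section_map sH sA \<rho> (F b) (\<iota> x)) = 1"
    using section_maps_generate[of "\<iota> x"] counit_iota[OF x] by (metis scale_one)
  obtain K' F' where K': "finite (K' :: 'a set)" "\<And>b. Vector_Spaces.linear sA (*) (F' b)"
    and one': "(\<Sum>b\<in>K'. b * section_map sH sA \<rho> (F' b) (\<iota> (inv x))) = 1"
    using section_maps_generate[of "\<iota> (inv x)"] counit_iota[of "inv x"] x by (metis G.inv_closed scale_one)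
  have "\<exists>w\<in>comp x. \<exists>w'\<in>comp (inv x). w' * w \<noteq> 0"
  proof (rule ccontr)
    assume "\<not> ?thesis"
    then have *: "w' * w = 0" if "w \<in> comp x" "w' \<in> comp (inv x)" for w w' using that by blast
    have "w = 0" if "w \<in> comp x" for w
    proof -
      have "w = (\<Sum>b\<in>K'. b * section_map sH sA \<rho> (F' b) (\<iota> (inv x))) * w" by (simp add: one')
      also have "\<dots> = 0" unfolding sum_distrib_right
        using *[OF that section_map_in_comp[OF _ K'(2)]] x
        by (intro sum.neutral) (simp add: mult.assoc)
      finally show ?thesis .
    qed
    from this[OF section_map_in_comp[OF x K(2)]] show False using one by simp
  qed
  then obtain w w' where w: "w \<in> comp x" and w': "w' \<in> comp (inv x)" and nz: "w' * w \<noteq> 0" by blast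
  obtain c where c: "w' * w = sA c 1" using comp_mult[OF _ x w' w] x by (auto simp: comp_one_iff)
  obtain e where e: "w * w' = sA e 1" using comp_mult[OF x _ w w'] x by (auto simp: comp_one_iff)
  have "sA e w = sA c w" using c e by (metis mult.assoc scale_one_mult mult_scale_one)
  moreover have "w \<noteq> 0" "c \<noteq> 0" using nz c by auto
  ultimately have "e = c" by simp
  have "sA (inverse c) w' * w = 1" "w * sA (inverse c) w' = 1"
    using c e \<open>c \<noteq> 0\<close> \<open>e = c\<close> by (simp_all flip: scale_mult_left scale_mult_right)
  moreover have "sA (inverse c) w' \<in> comp (inv x)"
    using compD[OF w'] by (intro compI) (auto simp: coaction_scale bilinear_form_def Vector_Spaces.linear_iff)
  ultimately show thesis using that w by blast
qed

text \<open>Multiplication by a unit of the inverse degree moves \<open>A\<^sub>x\<close> into the scalars.\<close>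

lemma comp_one_dimensional:
  assumes x: "x \<in> carrier G" and w: "w \<in> comp x" "v * w = 1" and a: "a \<in> comp x"
  obtains c where "a = sA c w"
proof -
  obtain b b' where b: "b \<in> comp x" "b' \<in> comp (inv x)" "b * b' = 1" "b' * b = 1"
    by (rule comp_has_unit[OF x])
  have *: "\<exists>c. a = sA c b" if ax: "a \<in> comp x" for a
  proof -
    obtain c where "a * b' = sA c 1" using comp_mult[OF x _ ax b(2)] x by (auto simp: comp_one_iff)
    then have "a * (b' * b) = sA c b" by (simp flip: mult.assoc)
    with b show ?thesis by auto
  qed
  from *[OF w(1)] *[OF a] obtain c c' where c: "w = sA c b" "a = sA c' b" by blast
  have "c \<noteq> 0" using c(1) w(2) by auto
  then have "a = sA (c' / c) w" using c by simp
  with that show thesis .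
qed

lemma skew_primitive_exists:
  obtains Z where "\<rho> Z = tensor_of sA sH [(1, y), (Z, \<iota> g)]"
proof -
  obtain f where f: "Vector_Spaces.linear sA (*) f" "f 1 = 1"
    using functional_normalised_at[OF vs, of 1] by auto
  show thesis
    using comodule_map_tensor[OF section_map_comodule[OF f(1)] comult_y] section_map_one[OF f] that by simp
qed

end

text \<open>With these commutation rules, multiplication in \<open>A\<close> is known up to the cocycle of the \<open>u\<^sub>x\<close> and the
  value of \<open>Z\<^sup>d\<close>.\<close>

locale normalised_frame =
  monomial_galois G g \<chi> \<mu> sH \<iota> y \<Delta> \<epsilon> S sA \<rho> + monomial_frame G g \<chi> \<mu> sH \<iota> y \<Delta> \<epsilon> S sA \<rho> u Z
  for G :: "'g monoid" (structure) and g :: 'g and \<chi> :: "'g \<Rightarrow> 'k::field" and \<mu> :: 'k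
    and sH :: "'k \<Rightarrow> 'h::ring_1 \<Rightarrow> 'h" and \<iota> :: "'g \<Rightarrow> 'h" and y :: 'h
    and \<Delta> :: "'h \<Rightarrow> ('k, 'h, 'h) tensor" and \<epsilon> :: "'h \<Rightarrow> 'k" and S :: "'h \<Rightarrow> 'h"
    and sA :: "'k \<Rightarrow> 'a::ring_1 \<Rightarrow> 'a" and \<rho> :: "'a \<Rightarrow> ('k, 'a, 'h) tensor"
    and u :: "'g \<Rightarrow> 'a" and Z :: 'a +
  assumes u_inverse: "x \<in> carrier G \<Longrightarrow> \<exists>b. u x * b = 1 \<and> b * u x = 1"
    and Z_u: "x \<in> carrier G \<Longrightarrow> Z * u x = sA (\<chi> x) (u x * Z)"

context monomial_galois
begin

text \<open>The relation \<open>y x = \<chi>(x) x y\<close> makes the terms \<open>u\<^sub>x \<otimes> x y\<close> of the coaction cancel, so the difference is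
  homogeneous of degree \<open>g x\<close>.\<close>

lemma skew_commutator:
  assumes u: "\<And>x. x \<in> carrier G \<Longrightarrow> u x \<in> comp x" "\<And>x. x \<in> carrier G \<Longrightarrow> \<exists>b. u x * b = 1 \<and> b * u x = 1"
    and Z: "\<rho> Z = tensor_of sA sH [(1, y), (Z, \<iota> g)]" and x: "x \<in> carrier G"
  obtains c where "sA (\<chi> x) (u x * Z) - Z * u x = sA c (u g * u x)"
proof -
  interpret monomial_frame G g \<chi> \<mu> sH \<iota> y \<Delta> \<epsilon> S sA \<rho> u Z
    using u(1) Z by unfold_locales (auto simp: comp_def)
  have "sA (\<chi> x) (u x * Z) - Z * u x \<in> comp (g \<otimes> x)"
  proof (rule compI)
    fix \<beta> assume \<beta>: "bilinear_form sA sH \<beta>"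
    have lin: "\<beta> (sA c a) h = c * \<beta> a h" "\<beta> a (sH c h) = c * \<beta> a h" "\<beta> (a - b) h = \<beta> a h - \<beta> b h" for a b c h
    proof -
      interpret L: Vector_Spaces.linear sA "(*)" "\<lambda>a. \<beta> a h" using \<beta> by (simp add: bilinear_form_def)
      interpret R: Vector_Spaces.linear sH "(*)" "\<beta> a" using \<beta> by (simp add: bilinear_form_def)
      show "\<beta> (sA c a) h = c * \<beta> a h" "\<beta> a (sH c h) = c * \<beta> a h" "\<beta> (a - b) h = \<beta> a h - \<beta> b h"
        by (rule L.scale R.scale L.diff)+
    qed
    have "\<rho> (u x * Z) \<beta> = \<beta> (u x) (\<iota> x * y) + \<beta> (u x * Z) (\<iota> (g \<otimes> x))"
      using x by (simp add: coaction_u_mult(1)[OF x \<beta>] coaction_Z tensor_of_eval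
          bilinear_form_mult_left[OF alg algH \<beta>] iota_mult g_central)
    moreover have "\<rho> (Z * u x) \<beta> = \<beta> (u x) (y * \<iota> x) + \<beta> (Z * u x) (\<iota> (g \<otimes> x))"
      using x by (simp add: coaction_u_mult(2)[OF x \<beta>] coaction_Z tensor_of_eval
          bilinear_form_mult_right[OF alg algH \<beta>] iota_mult)
    ultimately show "\<rho> (sA (\<chi> x) (u x * Z) - Z * u x) \<beta> =
        \<beta> (sA (\<chi> x) (u x * Z) - Z * u x) (\<iota> (g \<otimes> x))"
      using x by (simp add: coaction_diff coaction_scale y_iota lin distrib_left)
  qed
  moreover have "u g * u x \<in> comp (g \<otimes> x)" by (rule comp_mult[OF gG x u(1)[OF gG] u(1)[OF x]])
  moreover obtain b where b: "b * u g = 1" using u(2)[OF gG] by blast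
  moreover obtain b' where b': "b' * u x = 1" using u(2)[OF x] by blast
  moreover have "(b' * b) * (u g * u x) = b' * (b * u g) * u x" by (simp only: mult.assoc)
  ultimately show thesis
    using comp_one_dimensional[of "g \<otimes> x" "u g * u x" "b' * b"] x that by auto
qed

text \<open>The correction \<open>\<lambda> u\<^sub>g\<close> is chosen to make \<open>Z\<close> an exact eigenvector for conjugation by \<open>u\<^sub>g\<close>;
  since \<open>g\<close> is central and \<open>\<chi> g \<noteq> 1\<close>, it is then one for all the \<open>u\<^sub>x\<close>.\<close>

lemma normalised_frame_exists:
  obtains u Z where "normalised_frame G g \<chi> \<mu> sH \<iota> y \<Delta> \<epsilon> S sA \<rho> u Z" and "u \<one> = 1"
proof -
  have "\<exists>w. w \<in> comp x \<and> (\<exists>b. w * b = 1 \<and> b * w = 1)" if "x \<in> carrier G" for x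
    using comp_has_unit[OF that] by blast
  then obtain u0 where u0: "\<And>x. x \<in> carrier G \<Longrightarrow> u0 x \<in> comp x \<and> (\<exists>b. u0 x * b = 1 \<and> b * u0 x = 1)"
    by metis
  define u where "u x = (if x = \<one> then 1 else u0 x)" for x
  have one: "1 \<in> comp \<one>" unfolding comp_one_iff by (intro exI[of _ 1]) simp
  have u: "u x \<in> comp x" "\<exists>b. u x * b = 1 \<and> b * u x = 1" if "x \<in> carrier G" for x
    using u0[OF that] one by (auto simp: u_def intro: exI[of _ 1])
  obtain Z0 where Z0: "\<rho> Z0 = tensor_of sA sH [(1, y), (Z0, \<iota> g)]" by (rule skew_primitive_exists)
  obtain c where c: "sA q (u g * Z0) - Z0 * u g = sA c (u g * u g)"
    using skew_commutator[OF u Z0 gG] .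
  define l where "l = c / (1 - q)"
  have q1: "1 - q \<noteq> 0" using q_neq_1 by simp
  define Z where "Z = Z0 + sA l (u g)"
  have Z: "\<rho> Z = tensor_of sA sH [(1, y), (Z, \<iota> g)]"
  proof (rule coaction_eqI)
    fix \<beta> assume \<beta>: "bilinear_form sA sH \<beta>"
    then have "\<beta> (a + b) h = \<beta> a h + \<beta> b h" "\<beta> (sA c a) h = c * \<beta> a h" for a b c h
      by (auto simp: bilinear_form_def Vector_Spaces.linear_iff)
    then show "\<rho> Z \<beta> = tensor_of sA sH [(1, y), (Z, \<iota> g)] \<beta>"
      by (simp add: Z_def coaction_add coaction_scale Z0 tensor_of_eval[OF \<beta>] compD[OF u(1)[OF gG] \<beta>])
  qed
  have "Z * u g = Z0 * u g + sA l (u g * u g)"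
    by (simp add: Z_def distrib_right flip: scale_mult_left)
  also have "Z0 * u g = sA q (u g * Z0) - sA c (u g * u g)" using c by (simp add: algebra_simps)
  also have "c = l * (1 - q)" using q1 by (simp add: l_def)
  finally have Zg: "Z * u g = sA q (u g * Z)"
    by (simp add: Z_def distrib_left scale_right_distrib algebra_simps flip: scale_mult_right)
  have "Z * u x = sA (\<chi> x) (u x * Z)" if x: "x \<in> carrier G" for x
  proof -
    obtain e where e: "sA (\<chi> x) (u x * Z) - Z * u x = sA e (u g * u x)"
      using skew_commutator[OF u Z x] .
    then have Zx: "Z * u x = sA (\<chi> x) (u x * Z) - sA e (u g * u x)" by (simp add: algebra_simps)
    obtain b where b: "b * u g = 1" using u(2)[OF gG] by blast
    obtain b' where b': "b' * u x = 1" using u(2)[OF x] by blast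
    have "(b' * b) * (u g * u x) = b' * (b * u g) * u x" by (simp only: mult.assoc)
    then have inv: "(b' * b) * (u g * u x) = 1" using b b' by simp
    have cm: "u g * u x \<in> comp (g \<otimes> x)" "u x * u g \<in> comp (g \<otimes> x)"
      using comp_mult[OF gG x u(1)[OF gG] u(1)[OF x]] comp_mult[OF x gG u(1)[OF x] u(1)[OF gG]]
      by (simp_all only: g_central[OF x])
    obtain w where w: "u x * u g = sA w (u g * u x)"
      by (rule comp_one_dimensional[OF G.m_closed[OF gG x] cm(1) inv cm(2)])
    have "w \<noteq> 0"
    proof
      assume "w = 0"
      then have "u x * u g = 0" using w by simp
      then have "b * (b' * (u x * u g)) = 0" by simp
      then have "b * (b' * u x * u g) = 0" by (simp add: mult.assoc)
      then show False using b b' by simp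
    qed
    have w': "u x * (u g * a) = sA w (u g * (u x * a))" for a
      using w by (simp flip: mult.assoc scale_mult_left)
    \<comment> \<open>moving \<open>Z\<close> past \<open>u\<^sub>x u\<^sub>g\<close> directly, or after swapping \<open>u\<^sub>x\<close> and \<open>u\<^sub>g\<close>, gives \<open>e\<close> and \<open>e q\<close> times the same unit\<close>
    define R where "R = u g * u g * u x"
    have "Z * (u x * u g) = Z * u x * u g" by (simp add: mult.assoc)
    also have "\<dots> = sA (\<chi> x) (u x * (Z * u g)) - sA e (u g * (u x * u g))"
      by (simp add: Zx left_diff_distrib mult.assoc flip: scale_mult_left)
    also have "\<dots> = sA (\<chi> x * q * w) (u g * u x * Z) - sA (e * w) R"
      by (simp add: Zg w w' R_def mult.assoc mult_ac(2) flip: scale_mult_right scale_mult_left)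
    finally have 1: "Z * (u x * u g) = sA (\<chi> x * q * w) (u g * u x * Z) - sA (e * w) R" .
    have "Z * (u x * u g) = sA w (Z * u g * u x)" by (simp add: w mult.assoc flip: scale_mult_right)
    also have "\<dots> = sA (w * q) (u g * (Z * u x))" by (simp add: Zg mult.assoc flip: scale_mult_left)
    also have "\<dots> = sA (\<chi> x * q * w) (u g * u x * Z) - sA (e * w * q) R"
      by (simp add: Zx R_def right_diff_distrib scale_right_diff_distrib mult.assoc mult_ac flip: scale_mult_right)
    finally have "sA (e * w) R = sA (e * w * q) R" using 1 by simp
    moreover have "R \<noteq> 0"
    proof
      assume "R = 0"
      then have "(b' * b) * (b * R) = 0" by simp
      moreover have "b * R = u g * u x" using b by (simp add: R_def flip: mult.assoc)
      ultimately show False using inv by simp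
    qed
    ultimately have "e * w = e * w * q" by simp
    then have "e = 0" using \<open>w \<noteq> 0\<close> q_neq_1 by simp
    with Zx show ?thesis by simp
  qed
  then have "normalised_frame G g \<chi> \<mu> sH \<iota> y \<Delta> \<epsilon> S sA \<rho> u Z"
    using u Z by unfold_locales (auto simp: comp_def)
  moreover have "u \<one> = 1" by (simp add: u_def)
  ultimately show thesis using that by blast
qed

end

context normalised_frame
begin

lemma u_comp: "x \<in> carrier G \<Longrightarrow> u x \<in> comp x"
  by (simp add: comp_def coaction_u)

lemma u_cancel_left:
  assumes "x \<in> carrier G" and "u x * a = u x * b"
  shows "a = b"
proof -
  obtain c where c: "c * u x = 1" using u_inverse[OF assms(1)] by blast
  have "c * (u x * a) = c * (u x * b)" using assms(2) by simp
  then show ?thesis by (simp add: c flip: mult.assoc)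
qed

lemma u_mult_eq_0_iff: "x \<in> carrier G \<Longrightarrow> u x * a = 0 \<longleftrightarrow> a = 0"
  using u_cancel_left[of x a 0] by auto

lemma u_nonzero: "x \<in> carrier G \<Longrightarrow> u x \<noteq> 0"
  using u_inverse[of x] by auto

lemma comp_multiple:
  assumes "x \<in> carrier G" and "a \<in> comp x"
  obtains c where "a = sA c (u x)"
proof -
  obtain b where "b * u x = 1" using u_inverse[OF assms(1)] by blast
  then show thesis by (rule comp_one_dimensional[OF assms(1) u_comp[OF assms(1)] _ assms(2) that])
qed

text \<open>Elements \<open>a \<otimes> w\<close> with \<open>w\<close> in the range of the frame map already exhaust the target of the
  Galois map, by triangularity and invertibility of the \<open>u\<^sub>x\<close>; as the Galois map is injective, the frame
  map is onto.\<close>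

definition reached :: "('k, 'a, 'h) tensor \<Rightarrow> bool" where
  "reached t \<longleftrightarrow> (\<exists>ps. snd ` set ps \<subseteq> range frame_map \<and>
     (\<forall>\<beta>. bilinear_form sA sH \<beta> \<longrightarrow> galois_map sH sA \<rho> (tensor_of sA sA ps) \<beta> = t \<beta>))"

lemma reached_add:
  assumes "reached s" and "reached t"
  shows "reached (\<lambda>\<beta>. s \<beta> + t \<beta>)"
proof -
  obtain ps where "snd ` set ps \<subseteq> range frame_map"
    "\<And>\<beta>. bilinear_form sA sH \<beta> \<Longrightarrow> galois_map sH sA \<rho> (tensor_of sA sA ps) \<beta> = s \<beta>"
    using assms(1) by (auto simp: reached_def)
  moreover obtain qs where "snd ` set qs \<subseteq> range frame_map"
    "\<And>\<beta>. bilinear_form sA sH \<beta> \<Longrightarrow> galois_map sH sA \<rho> (tensor_of sA sA qs) \<beta> = t \<beta>"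
    using assms(2) by (auto simp: reached_def)
  ultimately show ?thesis
    unfolding reached_def by (intro exI[of _ "ps @ qs"]) (auto simp: galois_map_tensor_of_eval)
qed

lemma reached_sum:
  assumes "finite F" and "\<And>i. i \<in> F \<Longrightarrow> reached (t i)"
  shows "reached (\<lambda>\<beta>. \<Sum>i\<in>F. t i \<beta>)"
  using assms
proof (induction F rule: finite_induct)
  case empty
  show ?case unfolding reached_def by (intro exI[of _ "[]"]) (simp add: galois_map_tensor_of_eval)
next
  case (insert i F)
  then show ?case using reached_add[of "t i" "\<lambda>\<beta>. \<Sum>i\<in>F. t i \<beta>"] by simp
qed

lemma reached_cong:
  assumes "reached s" and "\<And>\<beta>. bilinear_form sA sH \<beta> \<Longrightarrow> s \<beta> = t \<beta>"
  shows "reached t"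
  using assms unfolding reached_def by metis

lemma reached_monomial:
  "i < d \<Longrightarrow> x \<in> carrier G \<Longrightarrow> reached (\<lambda>\<beta>. \<beta> c (\<iota> x * y ^ i))"
proof (induction i arbitrary: x c rule: less_induct)
  case (less i)
  obtain b where b: "b * u x = 1" using u_inverse[OF less.prems(2)] by blast
  have first: "reached (\<lambda>\<beta>. \<rho> (u x * Z ^ i) (\<lambda>z h. \<beta> (c * b * z) h))"
    unfolding reached_def
    by (rule exI[of _ "[(c * b, u x * Z ^ i)]"])
       (auto simp: galois_map_tensor_of_eval frame_map_monomial[symmetric] less.prems)
  have rest: "reached (\<lambda>\<beta>. \<beta> (sA (- qbinom q i j) (c * Z ^ j)) (\<iota> (x \<otimes> g [^] j) * y ^ (i - j)))"
    if "j \<in> {1..i}" for j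
    using that less.prems by (intro less.IH) auto
  show ?case
  proof (rule reached_cong[OF reached_add[OF first reached_sum[OF _ rest]]])
    fix \<beta> assume \<beta>: "bilinear_form sA sH \<beta>"
    have \<beta>': "bilinear_form sA sH (\<lambda>z h. \<beta> (c * b * z) h)"
      using bilinear_form_mult_left[OF alg algH \<beta>, of "c * b" 1] by simp
    have cb: "c * b * (u x * a) = c * a" for a
    proof -
      have "c * b * (u x * a) = c * (b * u x) * a" by (simp only: mult.assoc)
      then show ?thesis by (simp add: b)
    qed
    have sc: "\<beta> (sA e a) h = e * \<beta> a h" for e a h
      using \<beta> by (simp add: bilinear_form_def Vector_Spaces.linear_iff)
    have split: "{..i} = insert 0 {1..i}" by auto
    have "\<rho> (u x * Z ^ i) (\<lambda>z h. \<beta> (c * b * z) h) =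
        (\<Sum>j\<le>i. qbinom q i j * \<beta> (c * Z ^ j) (\<iota> (x \<otimes> g [^] j) * y ^ (i - j)))"
      unfolding coaction_frame[OF less.prems(2) \<beta>'] cb ..
    also have "\<dots> = \<beta> c (\<iota> x * y ^ i) +
        (\<Sum>j\<in>{1..i}. qbinom q i j * \<beta> (c * Z ^ j) (\<iota> (x \<otimes> g [^] j) * y ^ (i - j)))"
      unfolding split using less.prems by (subst sum.insert) auto
    finally show "\<rho> (u x * Z ^ i) (\<lambda>z h. \<beta> (c * b * z) h) +
        (\<Sum>j\<in>{1..i}. \<beta> (sA (- qbinom q i j) (c * Z ^ j)) (\<iota> (x \<otimes> g [^] j) * y ^ (i - j))) =
        \<beta> c (\<iota> x * y ^ i)"
      by (simp add: sc sum_negf del: scale_minus_left)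
  qed simp
qed

lemma reached_coaction: "reached (\<rho> b)"
proof -
  have pure: "reached (\<lambda>\<beta>. \<beta> a h)" for a h
  proof (rule reached_cong)
    show "reached (\<lambda>\<beta>. \<Sum>v\<in>I. \<beta> (sA (coord v h) a) (\<iota> (fst v) * y ^ snd v))"
      by (intro reached_sum finI reached_monomial) (auto simp: I_def)
    fix \<beta> assume \<beta>: "bilinear_form sA sH \<beta>"
    interpret R: Vector_Spaces.linear sH "(*)" "\<beta> a" using \<beta> by (simp add: bilinear_form_def)
    have "\<beta> a h = \<beta> a (\<Sum>(x, i)\<in>I. sH (coord (x, i) h) (\<iota> x * y ^ i))"
      by (simp flip: monomial_expansion)
    also have "\<dots> = (\<Sum>v\<in>I. coord v h * \<beta> a (\<iota> (fst v) * y ^ snd v))"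
      by (simp add: R.sum R.scale case_prod_unfold)
    also have "\<dots> = (\<Sum>v\<in>I. \<beta> (sA (coord v h) a) (\<iota> (fst v) * y ^ snd v))"
      using \<beta> by (simp add: bilinear_form_def Vector_Spaces.linear_iff)
    finally show "(\<Sum>v\<in>I. \<beta> (sA (coord v h) a) (\<iota> (fst v) * y ^ snd v)) = \<beta> a h" ..
  qed
  obtain bs where bs: "\<rho> b = tensor_of sA sH bs" using coaction_in_space by (rule tensor_spaceE)
  have "reached (\<lambda>\<beta>. \<Sum>(a, h)\<leftarrow>bs. \<beta> a h)"
  proof (induction bs)
    case Nil
    show ?case using reached_sum[of "{}"] by simp
  next
    case (Cons p bs)
    then show ?case using reached_add[OF pure[of "fst p" "snd p"]] by (simp add: case_prod_unfold)
  qed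
  then show ?thesis by (rule reached_cong) (simp add: bs tensor_of_eval)
qed

lemma frame_map_bij: "bij frame_map"
proof -
  interpret F: Vector_Spaces.linear sH sA frame_map by (rule frame_map_linear)
  have inj: "inj frame_map"
  proof (rule injI)
    fix h h' assume "frame_map h = frame_map h'"
    then have "frame_map (h - h') = 0" by (simp add: F.diff)
    then show "h = h'" using frame_map_inj[OF u_nonzero] by fastforce
  qed
  interpret VP: vector_space_pair sH sA by unfold_locales
  obtain r where r: "Vector_Spaces.linear sA sH r" "r \<circ> frame_map = id"
    using VP.linear_injective_left_inverse[OF frame_map_linear inj] by blast
  obtain f where f: "Vector_Spaces.linear sA (*) f" "f 1 = 1"
    using functional_normalised_at[OF vs, of 1] by auto
  \<comment> \<open>a projection with kernel the range of the frame map\<close>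
  define P where "P a = a - frame_map (r a)" for a
  have P: "Vector_Spaces.linear sA sA P"
    using r(1) frame_map_linear by (simp add: P_def Vector_Spaces.linear_iff scale_right_diff_distrib)
  have P0: "P (frame_map h) = 0" for h using fun_cong[OF r(2), of h] by (simp add: P_def)
  have bl: "bilinear_map sA sA sA (\<lambda>a b. sA (f a) (P b))"
    using P f(1) vs
    by (auto simp: bilinear_map_def Vector_Spaces.linear_iff scale_right_distrib scale_left_distrib mult.commute)
  have "b \<in> range frame_map" for b
  proof -
    obtain ps where ps: "snd ` set ps \<subseteq> range frame_map"
      and ev: "\<And>\<beta>. bilinear_form sA sH \<beta> \<Longrightarrow> galois_map sH sA \<rho> (tensor_of sA sA ps) \<beta> = \<rho> b \<beta>"
      using reached_coaction[of b] by (auto simp: reached_def)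
    have "pure sA sA 1 b = tensor_of sA sA ps"
    proof (rule galois_map_inject)
      show "galois_map sH sA \<rho> (pure sA sA 1 b) = galois_map sH sA \<rho> (tensor_of sA sA ps)"
        by (rule tensor_eqI[where sV = sA and sW = sH])
          (simp_all add: galois_map_in_space ev galois_map_tensor_of_eval[where ps = "[(1, b)]"])
    qed simp_all
    then have "tensor_lift sA sA (\<lambda>a b. sA (f a) (P b)) (pure sA sA 1 b) =
        tensor_lift sA sA (\<lambda>a b. sA (f a) (P b)) (tensor_of sA sA ps)" by simp
    then have "P b = (\<Sum>(a, w)\<leftarrow>ps. sA (f a) (P w))"
      unfolding tensor_lift_tensor_of[OF bl] by (simp add: f(2))
    also have "\<dots> = 0" using ps by (induction ps) (auto simp: P0)
    finally show ?thesis by (simp add: P_def)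
  qed
  with inj show ?thesis by (auto simp: bij_def)
qed

text \<open>The one parameter of \<open>A\<close> besides the cocycle of the \<open>u\<^sub>x\<close>.\<close>

definition top_coeff :: 'k where
  "top_coeff = (SOME a. Z ^ d = sA \<mu> 1 + sA a (u \<gamma>))"

text \<open>The Gaussian binomials in \<open>\<rho>(Z\<^sup>d)\<close> vanish except at the two ends, so \<open>Z\<^sup>d - \<mu>\<close> is homogeneous
  of degree \<open>\<gamma> = g\<^sup>d\<close>.\<close>

lemma Z_power_d: "Z ^ d = sA \<mu> 1 + sA top_coeff (u \<gamma>)"
proof -
  have "Z ^ d - sA \<mu> 1 \<in> comp \<gamma>"
  proof (rule compI)
    fix \<beta> assume \<beta>: "bilinear_form sA sH \<beta>"
    interpret R: Vector_Spaces.linear sH "(*)" "\<beta> 1" using \<beta> by (simp add: bilinear_form_def)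
    interpret L: Vector_Spaces.linear sA "(*)" "\<lambda>a. \<beta> a (\<iota> \<gamma>)" using \<beta> by (simp add: bilinear_form_def)
    show "\<rho> (Z ^ d - sA \<mu> 1) \<beta> = \<beta> (Z ^ d - sA \<mu> 1) (\<iota> \<gamma>)"
      by (simp add: coaction_diff coaction_scale coaction_one coaction_Z_power_d[OF \<beta>] y_power_d
          tensor_of_eval[OF \<beta>] R.scale R.diff L.scale L.diff iota_pow right_diff_distrib flip: \<gamma>_def)
  qed
  then obtain a where "Z ^ d - sA \<mu> 1 = sA a (u \<gamma>)" by (rule comp_multiple[OF gamma_closed])
  then have "Z ^ d = sA \<mu> 1 + sA a (u \<gamma>)" by (simp add: algebra_simps)
  then show ?thesis unfolding top_coeff_def by (rule someI)
qed

abbreviation deg :: "'g list \<Rightarrow> 'g" where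
  "deg xs \<equiv> foldr (\<otimes>) xs \<one>"

text \<open>The values of the cocycle collected while multiplying out a word.\<close>

definition word_coeff :: "'g list \<Rightarrow> 'k" where
  "word_coeff xs = (SOME c. prod_list (map u xs) = sA c (u (deg xs)))"

end

lemma (in monomial_hopf) deg_closed: "set xs \<subseteq> carrier G \<Longrightarrow> foldr (\<otimes>) xs \<one> \<in> carrier G"
  by (induction xs) auto

lemma (in monomial_hopf) deg_append:
  "set xs \<subseteq> carrier G \<Longrightarrow> set zs \<subseteq> carrier G \<Longrightarrow>
   foldr (\<otimes>) (xs @ zs) \<one> = foldr (\<otimes>) xs \<one> \<otimes> foldr (\<otimes>) zs \<one>"
proof (induction xs)
  case Nil
  then show ?case using deg_closed[of zs] by simp
next
  case (Cons x xs)
  then show ?case using deg_closed[of zs] deg_closed[of xs] by (simp add: G.m_assoc)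
qed

context normalised_frame
begin

lemma word_coeff:
  assumes "u \<one> = 1" and "set xs \<subseteq> carrier G"
  shows "prod_list (map u xs) = sA (word_coeff xs) (u (deg xs))"
proof -
  have "\<exists>c. prod_list (map u xs) = sA c (u (deg xs))"
    using assms(2)
  proof (induction xs)
    case Nil
    show ?case by (intro exI[of _ 1]) (simp add: assms(1))
  next
    case (Cons x xs)
    then obtain c where c: "prod_list (map u xs) = sA c (u (deg xs))" by auto
    have x: "x \<in> carrier G" "deg xs \<in> carrier G" using Cons.prems by (auto simp: deg_closed)
    obtain e where "u x * u (deg xs) = sA e (u (x \<otimes> deg xs))"
      by (rule comp_multiple[OF G.m_closed[OF x] comp_mult[OF x u_comp[OF x(1)] u_comp[OF x(2)]]])
    then show ?case by (intro exI[of _ "c * e"]) (simp add: c flip: scale_mult_right)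
  qed
  then show ?thesis unfolding word_coeff_def by (rule someI_ex)
qed

lemma prod_u_nonzero: "set xs \<subseteq> carrier G \<Longrightarrow> a \<noteq> 0 \<Longrightarrow> prod_list (map u xs) * a \<noteq> 0"
  by (induction xs) (auto simp: mult.assoc u_mult_eq_0_iff)

lemma word_coeff_nonzero:
  assumes "u \<one> = 1" and "set xs \<subseteq> carrier G"
  shows "word_coeff xs \<noteq> 0"
  using prod_u_nonzero[OF assms(2), of 1] word_coeff[OF assms] by auto

end

section \<open>Comparing two frames\<close>

text \<open>The map \<open>u\<^sub>x Z\<^sup>i \<mapsto> v\<^sub>x (Z')\<^sup>i\<close> is one frame map composed with the inverse of the other, hence a
  bijective comodule map.  It
  commutes with left multiplication by the generators because both algebras reduce such products to
  the basis by the same formulas.\<close>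

lemma (in monomial_hopf) frames_isomorphic:
  fixes sA :: "'k \<Rightarrow> 'a::ring_1 \<Rightarrow> 'a" and sB :: "'k \<Rightarrow> 'b::ring_1 \<Rightarrow> 'b"
  assumes A: "normalised_frame G g \<chi> \<mu> sH \<iota> y \<Delta> \<epsilon> S sA \<rho>A u Z"
    and B: "normalised_frame G g \<chi> \<mu> sH \<iota> y \<Delta> \<epsilon> S sB \<rho>B v Z'"
    and cocycle: "\<And>x z. x \<in> carrier G \<Longrightarrow> z \<in> carrier G \<Longrightarrow>
      \<exists>c. u x * u z = sA c (u (x \<otimes> z)) \<and> v x * v z = sB c (v (x \<otimes> z))"
    and top: "Z ^ d = sA \<mu> 1 + sA a (u \<gamma>)" "Z' ^ d = sB \<mu> 1 + sB a (v \<gamma>)"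
  shows "isomorphic_comodule_algebras sH sA \<rho>A sB \<rho>B"
proof -
  interpret A: normalised_frame G g \<chi> \<mu> sH \<iota> y \<Delta> \<epsilon> S sA \<rho>A u Z by (rule A)
  interpret B: normalised_frame G g \<chi> \<mu> sH \<iota> y \<Delta> \<epsilon> S sB \<rho>B v Z' by (rule B)
  define f where "f = B.frame_map \<circ> inv_into UNIV A.frame_map"
  have bijA: "bij A.frame_map" and bijB: "bij B.frame_map"
    by (rule A.frame_map_bij B.frame_map_bij)+
  have f: "f (A.frame_map h) = B.frame_map h" for h
    using bij_is_inj[OF bijA] by (simp add: f_def)
  have surjA: "\<exists>h. a = A.frame_map h" for a using bij_is_surj[OF bijA] by (rule surjD)
  have linA: "Vector_Spaces.linear sH sA A.frame_map" and linB: "Vector_Spaces.linear sH sB B.frame_map"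
    by (rule A.frame_map_linear B.frame_map_linear)+
  have bij: "bij f" unfolding f_def by (intro bij_comp bij_imp_bij_inv bijA bijB)
  have add: "f (a + b) = f a + f b" for a b
  proof -
    obtain h h' where "a = A.frame_map h" "b = A.frame_map h'" using surjA by metis
    moreover have "A.frame_map (h + h') = A.frame_map h + A.frame_map h'"
      "B.frame_map (h + h') = B.frame_map h + B.frame_map h'"
      using linA linB by (simp_all add: Vector_Spaces.linear_iff)
    ultimately show ?thesis using f by metis
  qed
  have scale: "f (sA c a) = sB c (f a)" for c a
  proof -
    obtain h where "a = A.frame_map h" using surjA by metis
    moreover have "A.frame_map (sH c h) = sA c (A.frame_map h)"
      "B.frame_map (sH c h) = sB c (B.frame_map h)"
      using linA linB by (simp_all add: Vector_Spaces.linear_iff)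
    ultimately show ?thesis using f by metis
  qed
  have lin: "Vector_Spaces.linear sA sB f"
    using add scale A.vs B.vs by (simp add: Vector_Spaces.linear_iff)
  note compose = Vector_Spaces.linear_compose[unfolded o_def]
  have mon: "f (u x * Z ^ i) = v x * Z' ^ i" if "x \<in> carrier G" "i < d" for x i
    using f[of "\<iota> x * y ^ i"] by (simp add: A.frame_map_monomial B.frame_map_monomial that)
  have mon0: "f (u x) = v x" if "x \<in> carrier G" for x
    using mon[OF that d_pos] by simp
  \<comment> \<open>the exponent \<open>d\<close> is where \<open>top\<close> enters\<close>
  have mon_d: "f (u x * Z ^ i) = v x * Z' ^ i" if x: "x \<in> carrier G" and "i \<le> d" for x i
  proof (cases "i = d")
    case True
    obtain c where c: "u x * u \<gamma> = sA c (u (x \<otimes> \<gamma>))" "v x * v \<gamma> = sB c (v (x \<otimes> \<gamma>))"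
      using cocycle[OF x gamma_closed] by blast
    have "u x * Z ^ d = sA \<mu> (u x) + sA a (u x * u \<gamma>)"
      by (simp add: top distrib_left flip: A.scale_mult_right)
    moreover have "v x * Z' ^ d = sB \<mu> (v x) + sB a (v x * v \<gamma>)"
      by (simp add: top distrib_left flip: B.scale_mult_right)
    ultimately show ?thesis using x by (simp add: True add scale c mon0)
  qed (use that mon in auto)
  have step_u: "f (u z * a) = v z * f a" if z: "z \<in> carrier G" for z a
  proof -
    obtain h where h: "a = A.frame_map h" using surjA by metis
    have "f (u z * A.frame_map h) = v z * B.frame_map h"
    proof (rule linear_eq_on_monomials[where f = "\<lambda>h. f (u z * A.frame_map h)"
          and f' = "\<lambda>h. v z * B.frame_map h"])
      show "Vector_Spaces.linear sH sB (\<lambda>h. f (u z * A.frame_map h))"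
        by (rule compose[OF compose[OF linA A.linear_mult(1)] lin])
      show "Vector_Spaces.linear sH sB (\<lambda>h. v z * B.frame_map h)"
        by (rule compose[OF linB B.linear_mult(1)])
      fix x i assume x: "x \<in> carrier G" and i: "i < d"
      obtain c where c: "u z * u x = sA c (u (z \<otimes> x))" "v z * v x = sB c (v (z \<otimes> x))"
        using cocycle[OF z x] by blast
      have "u z * (u x * Z ^ i) = sA c (u (z \<otimes> x) * Z ^ i)" 
        by (simp add: c A.scale_mult_left flip: mult.assoc)
      moreover have "v z * (v x * Z' ^ i) = sB c (v (z \<otimes> x) * Z' ^ i)" 
        by (simp add: c B.scale_mult_left flip: mult.assoc)
      ultimately show "f (u z * A.frame_map (\<iota> x * y ^ i)) = v z * B.frame_map (\<iota> x * y ^ i)"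
        using x i z by (simp add: A.frame_map_monomial B.frame_map_monomial scale mon)
    qed
    then show ?thesis by (simp add: h f)
  qed
  have step_Z: "f (Z * a) = Z' * f a" for a
  proof -
    obtain h where h: "a = A.frame_map h" using surjA by metis
    have "f (Z * A.frame_map h) = Z' * B.frame_map h"
    proof (rule linear_eq_on_monomials[where f = "\<lambda>h. f (Z * A.frame_map h)"
          and f' = "\<lambda>h. Z' * B.frame_map h"])
      show "Vector_Spaces.linear sH sB (\<lambda>h. f (Z * A.frame_map h))"
        by (rule compose[OF compose[OF linA A.linear_mult(1)] lin])
      show "Vector_Spaces.linear sH sB (\<lambda>h. Z' * B.frame_map h)"
        by (rule compose[OF linB B.linear_mult(1)])
      fix x i assume x: "x \<in> carrier G" and i: "i < d"
      have "Z * (u x * Z ^ i) = Z * u x * Z ^ i" by (simp add: mult.assoc)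
      also have "\<dots> = sA (\<chi> x) (u x * Z ^ Suc i)"
        by (simp add: A.Z_u[OF x] mult.assoc flip: A.scale_mult_left)
      finally have 1: "Z * (u x * Z ^ i) = sA (\<chi> x) (u x * Z ^ Suc i)" .
      have "Z' * (v x * Z' ^ i) = Z' * v x * Z' ^ i" by (simp add: mult.assoc)
      also have "\<dots> = sB (\<chi> x) (v x * Z' ^ Suc i)"
        by (simp add: B.Z_u[OF x] mult.assoc flip: B.scale_mult_left)
      finally have "Z' * (v x * Z' ^ i) = sB (\<chi> x) (v x * Z' ^ Suc i)" .
      with 1 show "f (Z * A.frame_map (\<iota> x * y ^ i)) = Z' * B.frame_map (\<iota> x * y ^ i)"
        using x i by (simp add: A.frame_map_monomial B.frame_map_monomial scale mon_d del: power_Suc)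
    qed
    then show ?thesis by (simp add: h f)
  qed
  have step_Z_power: "f (Z ^ i * a) = Z' ^ i * f a" for i a
    by (induction i) (simp_all add: mult.assoc step_Z)
  have mult: "f (a * b) = f a * f b" for a b
  proof -
    obtain h where h: "a = A.frame_map h" using surjA by metis
    have "f (A.frame_map h * b) = B.frame_map h * f b"
    proof (rule linear_eq_on_monomials[where f = "\<lambda>h. f (A.frame_map h * b)"
          and f' = "\<lambda>h. B.frame_map h * f b"])
      show "Vector_Spaces.linear sH sB (\<lambda>h. f (A.frame_map h * b))"
        by (rule compose[OF compose[OF linA A.linear_mult(2)] lin])
      show "Vector_Spaces.linear sH sB (\<lambda>h. B.frame_map h * f b)"
        by (rule compose[OF linB B.linear_mult(2)])
      fix x i assume "x \<in> carrier G" "i < d"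
      then show "f (A.frame_map (\<iota> x * y ^ i) * b) = B.frame_map (\<iota> x * y ^ i) * f b"
        by (simp add: A.frame_map_monomial B.frame_map_monomial mult.assoc step_u step_Z_power)
    qed
    then show ?thesis by (simp add: h f)
  qed
  obtain e where "f e = 1" using bij_is_surj[OF bij] by (metis surjD)
  then have one: "f 1 = 1" using mult[of 1 e] by simp
  have "\<rho>B (f a) = tensor_map sB sH f id (\<rho>A a)" for a
  proof -
    obtain h where h: "a = A.frame_map h" using surjA by metis
    have "f \<circ> A.frame_map = B.frame_map" using f by auto
    then have "tensor_map sB sH f id (tensor_map sA sH A.frame_map id (\<Delta> h)) =
        tensor_map sB sH B.frame_map id (\<Delta> h)"
      using tensor_map_compose[OF linA A.vsH lin A.comult_in_space] by metis
    then show ?thesis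
      using A.frame_map_comodule B.frame_map_comodule by (simp only: h f comodule_map_def)
  qed
  then have "comodule_algebra_hom sH sA \<rho>A sB \<rho>B f"
    using lin one mult by (simp add: comodule_algebra_hom_def algebra_hom_def)
  with bij show ?thesis by (auto simp: isomorphic_comodule_algebras_def)
qed

lemma (in normalised_frame) rescaled_frame:
  assumes t: "\<And>x. x \<in> carrier G \<Longrightarrow> t x \<noteq> 0"
  shows "normalised_frame G g \<chi> \<mu> sH \<iota> y \<Delta> \<epsilon> S sA \<rho> (\<lambda>x. sA (t x) (u x)) Z"
proof unfold_locales
  fix x assume x: "x \<in> carrier G"
  show "\<rho> (sA (t x) (u x)) = pure sA sH (sA (t x) (u x)) (\<iota> x)"
  proof (rule coaction_eqI)
    fix \<beta> assume \<beta>: "bilinear_form sA sH \<beta>"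
    then have "\<beta> (sA c a) h = c * \<beta> a h" for c a h
      by (simp add: bilinear_form_def Vector_Spaces.linear_iff)
    then show "\<rho> (sA (t x) (u x)) \<beta> = pure sA sH (sA (t x) (u x)) (\<iota> x) \<beta>"
      by (simp add: coaction_scale coaction_u[OF x] tensor_of_eval[OF \<beta>])
  qed
  obtain b where "u x * b = 1" "b * u x = 1" using u_inverse[OF x] by blast
  then show "\<exists>b. sA (t x) (u x) * b = 1 \<and> b * sA (t x) (u x) = 1"
    using t[OF x] by (intro exI[of _ "sA (inverse (t x)) b"]) (simp add: scale_mult_scale)
  show "Z * sA (t x) (u x) = sA (\<chi> x) (sA (t x) (u x) * Z)"
    by (simp add: Z_u[OF x] mult.commute flip: scale_mult_right scale_mult_left)
qed (rule coaction_Z)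

section \<open>Test polynomials\<close>

context monomial_hopf
begin

text \<open>The factor between \<open>(u\<^sub>g Z - Z u\<^sub>g)\<^sup>d\<close> and \<open>u\<^sub>g\<^sup>d Z\<^sup>d\<close>.\<close>

definition kappa :: 'k where
  "kappa = (1 - q) ^ d * (\<Prod>i<d. q ^ i)"

text \<open>A comodule map \<open>H \<rightarrow> A\<close> determines \<open>Z\<close> only up to a multiple of \<open>u\<^sub>g\<close>, which the commutator with \<open>u\<^sub>g\<close>
  removes.\<close>

definition skew_poly :: "(nat \<Rightarrow> 'h \<Rightarrow> 't::ring_1) \<Rightarrow> 't" where
  "skew_poly X = X 1 (\<iota> g) * X 1 y - X 1 y * X 1 (\<iota> g)"

text \<open>A map to \<open>A\<close> gives this polynomial the value \<open>a N\<close>, where \<open>a = top_coeff\<close> and \<open>N\<close> is a multiple of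
  \<open>u\<^sub>g\<^sup>d u\<^sub>\<gamma>\<close>; the subtracted term accounts for the summand \<open>\<mu>\<close> of \<open>Z\<^sup>d\<close>.\<close>

definition top_poly :: "('k \<Rightarrow> 't::ring_1 \<Rightarrow> 't) \<Rightarrow> (nat \<Rightarrow> 'h \<Rightarrow> 't) \<Rightarrow> 't" where
  "top_poly sT X = skew_poly X ^ d - sT (kappa * \<mu>) (X 1 1 ^ d * X 1 (\<iota> g) ^ d)"

text \<open>The value of this monomial is \<open>t\<^sub>\<gamma> N\<close> with the same \<open>N\<close>: the scalar of the letter \<open>\<gamma>\<close> takes the place
  of \<open>a\<close>.\<close>

definition gamma_poly :: "('k \<Rightarrow> 't::ring_1 \<Rightarrow> 't) \<Rightarrow> (nat \<Rightarrow> 'h \<Rightarrow> 't) \<Rightarrow> 't" where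
  "gamma_poly sT X = sT kappa (X 1 1 ^ d * X 1 (\<iota> g) ^ d * X 1 (\<iota> \<gamma>))"

definition word_poly :: "(nat \<Rightarrow> 'h \<Rightarrow> 't::ring_1) \<Rightarrow> 'g list \<Rightarrow> 't" where
  "word_poly X xs = prod_list (map (\<lambda>x. X 1 (\<iota> x)) xs)"

text \<open>The exponents \<open>m\<close> and \<open>n\<close> are exchanged between the two terms in order that both contain the same power
  of the common unit.\<close>

definition test_poly ::
  "('k \<Rightarrow> 't::ring_1 \<Rightarrow> 't) \<Rightarrow> (nat \<Rightarrow> 'h \<Rightarrow> 't) \<Rightarrow> nat \<Rightarrow> nat \<Rightarrow> 'k \<Rightarrow> 'g list \<Rightarrow> 'g list \<Rightarrow> 't" where
  "test_poly sT X m n c xs zs =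
     gamma_poly sT X ^ m * top_poly sT X ^ n * word_poly X xs -
     sT c (top_poly sT X ^ m * gamma_poly sT X ^ n * word_poly X zs)"

lemma kappa_nonzero: "kappa \<noteq> 0"
  using q_neq_1 by (simp add: kappa_def)

end

context normalised_frame
begin

lemma Z_power_u: "x \<in> carrier G \<Longrightarrow> Z ^ n * u x = sA (\<chi> x ^ n) (u x * Z ^ n)"
proof (induction n)
  case (Suc n)
  have "Z ^ Suc n * u x = Z * (Z ^ n * u x)" by (simp add: mult.assoc)
  also have "\<dots> = sA (\<chi> x ^ n) (Z * u x * Z ^ n)" using Suc by (simp add: mult.assoc flip: scale_mult_right)
  also have "\<dots> = sA (\<chi> x ^ Suc n) (u x * Z ^ Suc n)"
    using Suc.prems by (simp add: Z_u mult.assoc mult.commute flip: scale_mult_left)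
  finally show ?case .
qed simp

lemma u_g_Z_power: "(u g * Z) ^ n = sA (\<Prod>i<n. q ^ i) (u g ^ n * Z ^ n)"
proof (induction n)
  case (Suc n)
  have "(u g * Z) ^ Suc n = sA (\<Prod>i<n. q ^ i) (u g ^ n * (Z ^ n * u g) * Z)"
    unfolding power_Suc2 Suc by (simp add: mult.assoc flip: scale_mult_left)
  also have "\<dots> = sA (\<Prod>i<Suc n. q ^ i) (u g ^ n * u g * (Z ^ n * Z))"
    by (simp add: Z_power_u mult.assoc flip: scale_mult_left scale_mult_right)
  finally show ?case by (simp only: power_Suc2)
qed simp

text \<open>The elements of \<open>A\<close> with the coaction required of the images are known: those of \<open>X\<^sup>x\<close> by
  one-dimensionality of the components, that of \<open>X\<^sup>y\<close> because \<open>F(X\<^sup>y) - t\<^sub>1 Z\<close> has degree \<open>g\<close>.\<close>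

lemma hom_on_generators:
  assumes u1: "u \<one> = 1" and T: "tensor_algebra_of_copies sH \<Delta> \<epsilon> sT X \<delta>"
    and F: "comodule_algebra_hom sH sT \<delta> sA \<rho> F"
  obtains t s where "\<forall>x\<in>carrier G. F (X 1 (\<iota> x)) = sA (t x) (u x)"
    and "F (X 1 y) = sA (t \<one>) Z + sA s (u g)"
proof -
  have \<phi>: "comodule_map sH \<Delta> sA \<rho> (\<lambda>h. F (X 1 h))"
    by (rule comodule_map_of_tensor_algebra_hom[OF T F]) simp
  have "\<exists>c. F (X 1 (\<iota> x)) = sA c (u x)" if x: "x \<in> carrier G" for x
  proof -
    have "F (X 1 (\<iota> x)) \<in> comp x"
      using comodule_map_tensor[OF \<phi> comult_iota[OF x]] by (simp add: comp_def)
    then obtain c where "F (X 1 (\<iota> x)) = sA c (u x)" by (rule comp_multiple[OF x])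
    then show ?thesis ..
  qed
  then obtain t where t: "\<And>x. x \<in> carrier G \<Longrightarrow> F (X 1 (\<iota> x)) = sA (t x) (u x)" by metis
  have t1: "F (X 1 1) = sA (t \<one>) 1" using t[of \<one>] by (simp add: u1)
  have "F (X 1 y) - sA (t \<one>) Z \<in> comp g"
  proof (rule compI)
    fix \<beta> assume \<beta>: "bilinear_form sA sH \<beta>"
    interpret L: Vector_Spaces.linear sA "(*)" "\<lambda>a. \<beta> a h" for h using \<beta> by (simp add: bilinear_form_def)
    show "\<rho> (F (X 1 y) - sA (t \<one>) Z) \<beta> = \<beta> (F (X 1 y) - sA (t \<one>) Z) (\<iota> g)"
      using comodule_map_tensor[OF \<phi> comult_y]
      by (simp add: coaction_diff coaction_scale coaction_Z tensor_of_eval[OF \<beta>] t1 L.diff L.scale distrib_left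
          del: One_nat_def)
  qed
  then obtain s where "F (X 1 y) - sA (t \<one>) Z = sA s (u g)" by (rule comp_multiple[OF gG])
  then have "F (X 1 y) = sA (t \<one>) Z + sA s (u g)" by (simp add: algebra_simps)
  with t that show thesis by blast
qed

lemma test_poly_eval:
  assumes u1: "u \<one> = 1" and F: "algebra_hom sT sA F"
    and t_all: "\<forall>x\<in>carrier G. F (X 1 (\<iota> x)) = sA (t x) (u x)"
    and y: "F (X 1 y) = sA (t \<one>) Z + sA s (u g)"
    and xs: "set xs \<subseteq> carrier G" "set zs \<subseteq> carrier G" "deg xs = deg zs"
  defines "N \<equiv> sA (kappa * (t \<one> * t g) ^ d) (u g ^ d * u \<gamma>)"
  shows "F (top_poly sT X) = sA top_coeff N"
    and "F (test_poly sT X m n c xs zs) =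
      sA (t \<gamma> ^ m * prod_list (map t xs) * (top_coeff ^ n * word_coeff xs) -
          c * (t \<gamma> ^ n * prod_list (map t zs) * (top_coeff ^ m * word_coeff zs)))
        (N ^ (m + n) * u (deg xs))"
proof -
  have t: "F (X 1 (\<iota> x)) = sA (t x) (u x)" if "x \<in> carrier G" for x using t_all that by blast
  have F1: "F 1 = 1" and Fm: "\<And>a b. F (a * b) = F a * F b" and Flin: "Vector_Spaces.linear sT sA F"
    using F by (auto simp: algebra_hom_def)
  interpret L: Vector_Spaces.linear sT sA F by (rule Flin)
  have Fp: "F (a ^ k) = F a ^ k" for a k by (induction k) (simp_all add: F1 Fm)
  have t1: "F (X 1 1) = sA (t \<one>) 1" using t[of \<one>] by (simp add: u1)
  have "F (skew_poly X) = sA (t g) (u g) * (sA (t \<one>) Z + sA s (u g)) - (sA (t \<one>) Z + sA s (u g)) * sA (t g) (u g)"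
    by (simp add: skew_poly_def L.diff Fm t y del: One_nat_def)
  also have "\<dots> = sA (t g * t \<one>) (u g * Z) - sA (t \<one> * t g * q) (u g * Z)"
    by (simp add: distrib_left distrib_right scale_mult_scale Z_u mult.commute[of s])
  also have "\<dots> = sA (t \<one> * t g * (1 - q)) (u g * Z)"
    by (simp add: mult.commute[of "t g"] right_diff_distrib scale_left_diff_distrib)
  finally have skew: "F (skew_poly X) = sA (t \<one> * t g * (1 - q)) (u g * Z)" .
  have "F (skew_poly X ^ d) = sA (kappa * (t \<one> * t g) ^ d) (u g ^ d * Z ^ d)"
    by (simp add: Fp skew scale_power u_g_Z_power kappa_def power_mult_distrib mult_ac)
  also have "\<dots> = sA (kappa * (t \<one> * t g) ^ d * \<mu>) (u g ^ d) + sA top_coeff N"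
    by (simp add: Z_power_d N_def distrib_left scale_right_distrib mult.commute flip: scale_mult_right)
  finally show top: "F (top_poly sT X) = sA top_coeff N"
    by (simp add: top_poly_def L.diff L.scale Fm Fp t t1 scale_power scale_mult_scale power_mult_distrib mult_ac
        del: One_nat_def)
  have gam: "F (gamma_poly sT X) = sA (t \<gamma>) N"
    by (simp add: gamma_poly_def N_def L.scale Fm Fp t t1 scale_power scale_mult_scale power_mult_distrib mult_ac
        del: One_nat_def)
  have word: "F (word_poly X ws) = sA (prod_list (map t ws) * word_coeff ws) (u (deg ws))"
    if ws: "set ws \<subseteq> carrier G" for ws
  proof -
    have "F (word_poly X ws) = sA (prod_list (map t ws)) (prod_list (map u ws))"
      unfolding word_poly_def using ws
      by (induction ws) (simp_all add: F1 Fm t scale_mult_scale del: One_nat_def)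
    then show ?thesis by (simp add: word_coeff[OF u1 ws])
  qed
  have 1: "F (gamma_poly sT X ^ m * top_poly sT X ^ n * word_poly X xs) =
      sA (t \<gamma> ^ m * prod_list (map t xs) * (top_coeff ^ n * word_coeff xs)) (N ^ (m + n) * u (deg xs))"
    by (simp add: Fm Fp gam top word[OF xs(1)] scale_power scale_mult_scale power_add mult_ac)
  have "F (top_poly sT X ^ m * gamma_poly sT X ^ n * word_poly X zs) =
      sA (t \<gamma> ^ n * prod_list (map t zs) * (top_coeff ^ m * word_coeff zs)) (N ^ (m + n) * u (deg xs))"
    by (simp add: Fm Fp gam top word[OF xs(2)] scale_power scale_mult_scale power_add mult_ac xs(3))
  with 1 show "F (test_poly sT X m n c xs zs) =
      sA (t \<gamma> ^ m * prod_list (map t xs) * (top_coeff ^ n * word_coeff xs) -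
          c * (t \<gamma> ^ n * prod_list (map t zs) * (top_coeff ^ m * word_coeff zs)))
        (N ^ (m + n) * u (deg xs))"
    by (simp add: test_poly_def L.diff L.scale scale_left_diff_distrib)
qed

text \<open>Equal content makes the unknown scalars in the two terms of the test polynomial equal.  Conversely
  the frame map induces a map \<open>F\<^sub>0\<close> with all scalars equal to \<open>1\<close>, under which the value of the test polynomial
  is a unit times the difference of the two sides of the criterion.\<close>

lemma test_poly_identity_iff:
  assumes u1: "u \<one> = 1" and T: "tensor_algebra_of_copies sH \<Delta> \<epsilon> sT X \<delta>"
    and xs: "set xs \<subseteq> carrier G" "set zs \<subseteq> carrier G" "deg xs = deg zs"
    and content: "mset xs + replicate_mset m \<gamma> = mset zs + replicate_mset n \<gamma>"
  shows "test_poly sT X m n c xs zs \<in> polynomial_identities sH sT \<delta> sA \<rho> \<longleftrightarrow>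
      top_coeff ^ n * word_coeff xs = c * (top_coeff ^ m * word_coeff zs)" (is ?test)
    and "top_poly sT X \<in> polynomial_identities sH sT \<delta> sA \<rho> \<longleftrightarrow> top_coeff = 0" (is ?top)
proof -
  have "comodule_map sH \<Delta> sA \<rho> frame_map" by (rule frame_map_comodule)
  then obtain F0 where F0: "comodule_algebra_hom sH sT \<delta> sA \<rho> F0"
    and F0X: "\<And>i h. 1 \<le> i \<Longrightarrow> F0 (X i h) = frame_map h"
    using comodule_map_extends_to_tensor_algebra[OF T] by metis
  have F0': "algebra_hom sT sA F0" using F0 by (simp add: comodule_algebra_hom_def)
  obtain t0 s0 where t0: "\<forall>x\<in>carrier G. F0 (X 1 (\<iota> x)) = sA (t0 x) (u x)"
    and y0: "F0 (X 1 y) = sA (t0 \<one>) Z + sA s0 (u g)"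
    using hom_on_generators[OF u1 T F0] by metis
  have t0_1: "t0 x = 1" if x: "x \<in> carrier G" for x
  proof -
    have "F0 (X 1 (\<iota> x)) = u x" using F0X frame_map_monomial[OF x d_pos] by simp
    then have "sA (t0 x) (u x) = sA 1 (u x)" using t0 x by simp
    then show ?thesis unfolding scale_cancel_right using u_nonzero[OF x] by blast
  qed
  define N where "N = sA (kappa * (t0 \<one> * t0 g) ^ d) (u g ^ d * u \<gamma>)"
  have u_power: "u g ^ k * a \<noteq> 0" if "a \<noteq> 0" for a k
    using that by (induction k) (auto simp: mult.assoc u_mult_eq_0_iff)
  have "N * a \<noteq> 0" if "a \<noteq> 0" for a
    using that kappa_nonzero u_power[of "u \<gamma> * a"]
    by (simp add: N_def t0_1 mult.assoc u_mult_eq_0_iff flip: scale_mult_left)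
  then have N_power: "N ^ k * a \<noteq> 0" if "a \<noteq> 0" for a k
    using that by (induction k) (auto simp: mult.assoc)
  have N: "N ^ (m + n) * u (deg xs) \<noteq> 0"
    by (rule N_power) (use u_nonzero deg_closed xs(1) in blast)
  have N1: "N \<noteq> 0" using N_power[of 1 1] by simp
  have prod_content: "t \<gamma> ^ m * prod_list (map t xs) = t \<gamma> ^ n * prod_list (map t zs)" for t :: "'g \<Rightarrow> 'k"
  proof -
    have eq: "prod_mset (image_mset t (mset ws + replicate_mset k \<gamma>)) = t \<gamma> ^ k * prod_list (map t ws)" for ws k
      by (simp add: prod_mset_prod_list[symmetric] mult.commute)
    from eq[of xs m] eq[of zs n] show ?thesis by (simp only: content)
  qed
  let ?E = "top_coeff ^ n * word_coeff xs - c * (top_coeff ^ m * word_coeff zs)"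
  have eval: "F (top_poly sT X) = sA top_coeff (sA (kappa * (t \<one> * t g) ^ d) (u g ^ d * u \<gamma>))"
    "F (test_poly sT X m n c xs zs) = sA (t \<gamma> ^ m * prod_list (map t xs) * ?E)
        ((sA (kappa * (t \<one> * t g) ^ d) (u g ^ d * u \<gamma>)) ^ (m + n) * u (deg xs))"
    if "comodule_algebra_hom sH sT \<delta> sA \<rho> F" "\<forall>x\<in>carrier G. F (X 1 (\<iota> x)) = sA (t x) (u x)"
      "F (X 1 y) = sA (t \<one>) Z + sA s (u g)" for F t s
  proof -
    have F': "algebra_hom sT sA F" using that(1) by (simp add: comodule_algebra_hom_def)
    have scalar: "t \<gamma> ^ m * prod_list (map t xs) * (top_coeff ^ n * word_coeff xs) -
          c * (t \<gamma> ^ n * prod_list (map t zs) * (top_coeff ^ m * word_coeff zs)) =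
        t \<gamma> ^ m * prod_list (map t xs) * ?E"
      unfolding prod_content[of t] by (simp only: right_diff_distrib mult_ac)
    show "F (top_poly sT X) = sA top_coeff (sA (kappa * (t \<one> * t g) ^ d) (u g ^ d * u \<gamma>))"
      by (rule test_poly_eval(1)[where X = X and t = t and s = s, OF u1 F' that(2,3) xs])
    show "F (test_poly sT X m n c xs zs) = sA (t \<gamma> ^ m * prod_list (map t xs) * ?E)
        ((sA (kappa * (t \<one> * t g) ^ d) (u g ^ d * u \<gamma>)) ^ (m + n) * u (deg xs))"
      by (rule trans[OF test_poly_eval(2)[where X = X and t = t and s = s, OF u1 F' that(2,3) xs]])
         (simp only: scalar)
  qed
  have t0_prod: "t0 \<gamma> ^ m * prod_list (map t0 xs) = 1"
  proof -
    have "prod_list (map t0 xs) = 1" using xs(1) by (induction xs) (auto simp: t0_1)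
    then show ?thesis by (simp add: t0_1)
  qed
  show ?test
  proof
    assume "test_poly sT X m n c xs zs \<in> polynomial_identities sH sT \<delta> sA \<rho>"
    then have "F0 (test_poly sT X m n c xs zs) = 0" using F0 by (simp add: polynomial_identities_def)
    then have "sA ?E (N ^ (m + n) * u (deg xs)) = 0"
      unfolding eval(2)[OF F0 t0 y0] by (simp only: N_def t0_prod mult_1_left)
    then have "?E = 0" using N by simp
    then show "top_coeff ^ n * word_coeff xs = c * (top_coeff ^ m * word_coeff zs)" by simp
  next
    assume "top_coeff ^ n * word_coeff xs = c * (top_coeff ^ m * word_coeff zs)"
    then have E: "?E = 0" by simp
    have "F (test_poly sT X m n c xs zs) = 0" if F: "comodule_algebra_hom sH sT \<delta> sA \<rho> F" for F
    proof -
      obtain t s where t: "\<forall>x\<in>carrier G. F (X 1 (\<iota> x)) = sA (t x) (u x)"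
        and y: "F (X 1 y) = sA (t \<one>) Z + sA s (u g)"
        by (rule hom_on_generators[OF u1 T F])
      show ?thesis unfolding eval(2)[OF F t y] E by simp
    qed
    then show "test_poly sT X m n c xs zs \<in> polynomial_identities sH sT \<delta> sA \<rho>"
      by (simp add: polynomial_identities_def)
  qed
  show ?top
  proof
    assume "top_poly sT X \<in> polynomial_identities sH sT \<delta> sA \<rho>"
    then have "F0 (top_poly sT X) = 0" using F0 by (simp add: polynomial_identities_def)
    then have "sA top_coeff N = 0" unfolding eval(1)[OF F0 t0 y0] N_def .
    then show "top_coeff = 0" using N1 by simp
  next
    assume a: "top_coeff = 0"
    have "F (top_poly sT X) = 0" if F: "comodule_algebra_hom sH sT \<delta> sA \<rho> F" for F
    proof -
      obtain t s where t: "\<forall>x\<in>carrier G. F (X 1 (\<iota> x)) = sA (t x) (u x)"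
        and y: "F (X 1 y) = sA (t \<one>) Z + sA s (u g)"
        by (rule hom_on_generators[OF u1 T F])
      show ?thesis unfolding eval(1)[OF F t y] a by simp
    qed
    then show "top_poly sT X \<in> polynomial_identities sH sT \<delta> sA \<rho>"
      by (simp add: polynomial_identities_def)
  qed
qed

text \<open>Concatenation contributes one further value of the cocycle, at the pair of products of the words; it
  is the same for both pairs of words and cancels.\<close>

lemma word_coeff_append:
  assumes u1: "u \<one> = 1"
    and sets: "set xs \<subseteq> carrier G" "set zs \<subseteq> carrier G" "set xs' \<subseteq> carrier G" "set zs' \<subseteq> carrier G"
    and degs: "deg xs = deg zs" "deg xs' = deg zs'"
  shows "word_coeff (xs @ xs') * (word_coeff zs * word_coeff zs') =
    word_coeff (zs @ zs') * (word_coeff xs * word_coeff xs')"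
proof -
  have eq: "sA (word_coeff (ws @ ws')) (u (deg ws \<otimes> deg ws')) =
      sA (word_coeff ws * word_coeff ws') (u (deg ws) * u (deg ws'))"
    if "set ws \<subseteq> carrier G" "set ws' \<subseteq> carrier G" for ws ws'
  proof -
    have "sA (word_coeff (ws @ ws')) (u (deg (ws @ ws'))) = prod_list (map u (ws @ ws'))"
      using word_coeff[OF u1, of "ws @ ws'"] that by simp
    also have "\<dots> = sA (word_coeff ws * word_coeff ws') (u (deg ws) * u (deg ws'))"
      by (simp add: word_coeff[OF u1] that scale_mult_scale)
    finally show ?thesis using deg_append[OF that] by simp
  qed
  let ?D = "deg zs \<otimes> deg zs'"
  have "sA (word_coeff zs * word_coeff zs') (sA (word_coeff (xs @ xs')) (u ?D)) =
      sA (word_coeff xs * word_coeff xs') (sA (word_coeff (zs @ zs')) (u ?D))"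
    using eq[OF sets(1,3)] eq[OF sets(2,4)] by (simp add: degs mult.commute)
  moreover have "u ?D \<noteq> 0" using sets by (intro u_nonzero) (simp add: deg_closed)
  ultimately show ?thesis by (simp add: mult_ac)
qed

lemma word_coeff_Nil: "u \<one> = 1 \<Longrightarrow> word_coeff [] = 1"
  using word_coeff[of "[]"] scale_cancel_right[of "word_coeff []" 1 1] by simp

lemma word_coeff_single:
  assumes "u \<one> = 1" and "x \<in> carrier G"
  shows "word_coeff [x] = 1"
proof -
  have "sA (word_coeff [x]) (u x) = sA 1 (u x)" using word_coeff[of "[x]"] assms by simp
  then show ?thesis unfolding scale_cancel_right using u_nonzero[OF assms(2)] by blast
qed

end

section \<open>Extending multiplicative characters\<close>

lemma prod_powi_difference:
  fixes t :: "'i \<Rightarrow> 'k::field"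
  assumes "finite J" and "\<And>i. t i \<noteq> 0" and "set_mset M \<subseteq> J" and "set_mset N \<subseteq> J"
  shows "(\<Prod>i\<in>J. t i powi (int (count M i) - int (count N i))) =
    prod_mset (image_mset t M) / prod_mset (image_mset t N)"
proof -
  have eq: "prod_mset (image_mset t L) = (\<Prod>i\<in>J. t i ^ count L i)" if "set_mset L \<subseteq> J" for L
    unfolding image_prod_mset_multiplicity using that assms(1)
    by (intro prod.mono_neutral_left) (auto simp: not_in_iff)
  show ?thesis
    unfolding eq[OF assms(3)] eq[OF assms(4)] prod_dividef[symmetric]
    by (intro prod.cong refl) (simp add: power_int_diff assms(2))
qed

text \<open>The multiplicative group of an algebraically closed field is divisible, hence injective: a
  homomorphism from a subgroup of a lattice, given here as a relation \<open>P\<close>, extends to the lattice.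
  The coordinates are treated one at a time; the least positive value \<open>n\<close> of the new coordinate on the
  subgroup demands an \<open>n\<close>-th root.\<close>

lemma character_extends:
  fixes P :: "('i \<Rightarrow> int) \<Rightarrow> 'k::alg_closed_field \<Rightarrow> bool"
  assumes "finite J"
    and "\<And>v w c e. P v c \<Longrightarrow> P w e \<Longrightarrow> P (\<lambda>i. v i + w i) (c * e)"
    and "\<And>v c. P v c \<Longrightarrow> P (\<lambda>i. - v i) (inverse c)"
    and "\<And>v c. P v c \<Longrightarrow> c \<noteq> 0"
    and "\<And>c. P (\<lambda>_. 0) c \<Longrightarrow> c = 1"
    and "\<And>v c i. P v c \<Longrightarrow> i \<notin> J \<Longrightarrow> v i = 0"
  shows "\<exists>t. (\<forall>i. t i \<noteq> 0) \<and> (\<forall>v c. P v c \<longrightarrow> (\<Prod>i\<in>J. t i powi v i) = c)"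
  using assms
proof (induction J arbitrary: P rule: finite_induct)
  case empty
  have "c = 1" if "P v c" for v c
  proof -
    have "v = (\<lambda>_. 0)" using empty.prems(5)[OF that] by auto
    with that show ?thesis using empty.prems(4) by blast
  qed
  then show ?case by (intro exI[of _ "\<lambda>_. 1"]) auto
next
  case (insert j J)
  note add = insert.prems(1) and neg = insert.prems(2) and nz = insert.prems(3)
    and triv = insert.prems(4) and supp = insert.prems(5)
  define P0 where "P0 v c \<longleftrightarrow> P v c \<and> v j = 0" for v c
  have "\<exists>t. (\<forall>i. t i \<noteq> 0) \<and> (\<forall>v c. P0 v c \<longrightarrow> (\<Prod>i\<in>J. t i powi v i) = c)"
  proof (rule insert.IH)
    show "v i = 0" if "P0 v c" "i \<notin> J" for v c i
      using that supp[of v c i] by (cases "i = j") (auto simp: P0_def)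
    show "c = 1" if "P0 (\<lambda>_. 0) c" for c using that triv by (auto simp: P0_def)
    show "c \<noteq> 0" if "P0 v c" for v c using that nz by (auto simp: P0_def)
    show "P0 (\<lambda>i. v i + w i) (c * e)" if "P0 v c" "P0 w e" for v w c e
      using that add by (auto simp: P0_def)
    show "P0 (\<lambda>i. - v i) (inverse c)" if "P0 v c" for v c using that neg by (auto simp: P0_def)
  qed
  then obtain t where t: "\<And>i. t i \<noteq> 0" and tP: "\<And>v c. P0 v c \<Longrightarrow> (\<Prod>i\<in>J. t i powi v i) = c" by blast
  show ?case
  proof (cases "\<exists>v c. P v c \<and> v j \<noteq> 0")
    case False
    have "(\<Prod>i\<in>insert j J. t i powi v i) = c" if "P v c" for v c
    proof -
      have "v j = 0" using False that by blast
      then show ?thesis using tP[of v c] that insert.hyps by (simp add: P0_def)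
    qed
    with t show ?thesis by blast
  next
    case True
    define Q where "Q n \<longleftrightarrow> 0 < n \<and> (\<exists>v c. P v c \<and> v j = int n)" for n
    obtain v0 c0 where v0: "P v0 c0" "v0 j \<noteq> 0" using True by blast
    have "Q (nat \<bar>v0 j\<bar>)"
    proof (cases "v0 j > 0")
      case True
      with v0 show ?thesis unfolding Q_def by (intro conjI exI[of _ v0] exI[of _ c0]) auto
    next
      case False
      with v0 neg[OF v0(1)] show ?thesis
        unfolding Q_def by (intro conjI exI[of _ "\<lambda>i. - v0 i"] exI[of _ "inverse c0"]) auto
    qed
    define n where "n = (LEAST n. Q n)"
    have "Q n" unfolding n_def by (rule LeastI) fact
    then obtain w e where n: "0 < n" and w: "P w e" "w j = int n" by (auto simp: Q_def)
    define R where "R = (\<Prod>i\<in>J. t i powi w i)"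
    have R: "R \<noteq> 0" using t by (simp add: R_def insert.hyps)
    obtain s where s: "s ^ n = e / R" using nth_root_exists[OF n] by blast
    have "s ^ n \<noteq> 0" using nz[OF w(1)] R s by simp
    then have s0: "s \<noteq> 0" using n by (auto simp: power_0_left)
    have zero: "P (\<lambda>_. 0) 1" using add[OF w(1) neg[OF w(1)]] nz[OF w(1)] by simp
    have pos: "P (\<lambda>i. int k * w i) (e ^ k)" for k
    proof (induction k)
      case (Suc k)
      then show ?case using add[OF w(1) Suc] by (simp add: algebra_simps)
    qed (use zero in simp)
    have multiple: "P (\<lambda>i. k * w i) (e powi k)" for k
    proof (cases "0 \<le> k")
      case True
      then show ?thesis using pos[of "nat k"] by (simp add: power_int_def)
    next
      case False
      then show ?thesis using neg[OF pos[of "nat (- k)"]] by (simp add: power_int_def power_inverse)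
    qed
    define t' where "t' = t(j := s)"
    have "(\<Prod>i\<in>insert j J. t' i powi v i) = c" if v: "P v c" for v c
    proof -
      define k where "k = v j div int n"
      define r where "r i = v i - k * w i" for i
      have r: "P r (c * e powi (- k))"
        using add[OF v multiple[of "- k"]] by (simp add: r_def[abs_def])
      have rj: "r j = v j mod int n" by (simp add: r_def k_def w(2) minus_div_mult_eq_mod)
      have "r j = 0"
      proof (rule ccontr)
        assume "r j \<noteq> 0"
        moreover have "0 \<le> r j" "r j < int n" using n by (simp_all add: rj)
        ultimately have "Q (nat (r j))" "nat (r j) < n" using r by (auto simp: Q_def)
        then show False unfolding n_def using not_less_Least by blast
      qed
      then have vj: "v j = k * int n" by (simp add: r_def w(2))
      have "c * e powi (- k) = (\<Prod>i\<in>J. t i powi r i)" using tP[of r] r \<open>r j = 0\<close> by (simp add: P0_def)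
      also have "\<dots> = (\<Prod>i\<in>J. t i powi v i) / R powi k"
      proof -
        have "R powi k = (\<Prod>i\<in>J. t i powi (k * w i))"
          unfolding R_def
          by (induction J rule: infinite_finite_induct)
             (simp_all add: power_int_mult_distrib power_int_mult mult.commute[of k])
        then show ?thesis
          by (simp add: r_def power_int_diff t prod_dividef)
      qed
      finally have J: "(\<Prod>i\<in>J. t i powi v i) = c * e powi (- k) * R powi k" using R by (simp add: field_simps)
      have "s powi v j = (s powi int n) powi k" by (simp only: vj mult.commute[of k] power_int_mult)
      also have "\<dots> = e powi k / R powi k" by (simp add: s power_int_divide_distrib)
      finally have "s powi v j * (\<Prod>i\<in>J. t i powi v i) = c"
        using R nz[OF w(1)] by (simp add: J power_int_minus field_simps)
      moreover have "(\<Prod>i\<in>J. t' i powi v i) = (\<Prod>i\<in>J. t i powi v i)"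
        using insert.hyps by (intro prod.cong) (auto simp: t'_def)
      ultimately show ?thesis using insert.hyps by (simp add: t'_def)
    qed
    moreover have "t' i \<noteq> 0" for i using t s0 by (simp add: t'_def)
    ultimately show ?thesis by blast
  qed
qed

section \<open>Polynomial identities determine the Galois object\<close>

theorem theorem3p1:
  fixes G :: "'g monoid" and g :: 'g
    and \<chi> :: "'g \<Rightarrow> 'k::{alg_closed_field, field_char_0}" and \<mu> :: 'k
    and sH :: "'k \<Rightarrow> 'h::ring_1 \<Rightarrow> 'h" and \<iota> :: "'g \<Rightarrow> 'h" and y :: 'h
    and \<Delta> :: "'h \<Rightarrow> ('k, 'h, 'h) tensor" and \<epsilon> :: "'h \<Rightarrow> 'k" and S :: "'h \<Rightarrow> 'h"
    and sT :: "'k \<Rightarrow> 't::ring_1 \<Rightarrow> 't" and X :: "nat \<Rightarrow> 'h \<Rightarrow> 't" and \<delta> :: "'t \<Rightarrow> ('k, 't, 'h) tensor"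
    and sA :: "'k \<Rightarrow> 'a::ring_1 \<Rightarrow> 'a" and \<rho>A :: "'a \<Rightarrow> ('k, 'a, 'h) tensor"
    and sB :: "'k \<Rightarrow> 'b::ring_1 \<Rightarrow> 'b" and \<rho>B :: "'b \<Rightarrow> ('k, 'b, 'h) tensor"
  assumes "group_datum G g \<chi> \<mu>"
    and "monomial_hopf_algebra G g \<chi> \<mu> sH \<iota> y \<Delta> \<epsilon> S"
    and "tensor_algebra_of_copies sH \<Delta> \<epsilon> sT X \<delta>"
    and "galois_object sH \<Delta> \<epsilon> sA \<rho>A"
    and "galois_object sH \<Delta> \<epsilon> sB \<rho>B"
    and "polynomial_identities sH sT \<delta> sA \<rho>A = polynomial_identities sH sT \<delta> sB \<rho>B"
  shows "isomorphic_comodule_algebras sH sA \<rho>A sB \<rho>B"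
proof -
  interpret M: monomial_hopf G g \<chi> \<mu> sH \<iota> y \<Delta> \<epsilon> S
    using assms(1,2) by unfold_locales
  have galois: "monomial_galois G g \<chi> \<mu> sH \<iota> y \<Delta> \<epsilon> S s \<rho>" if "galois_object sH \<Delta> \<epsilon> s \<rho>"
    for s :: "'k \<Rightarrow> 'x::ring_1 \<Rightarrow> 'x" and \<rho>
    using that M.monomial_hopf_axioms M.H.hopf_algebra_axioms
    by (intro monomial_galois.intro hopf_galois_object.intro comodule_algebra_over_hopf.intro
        hopf_galois_object_axioms.intro) (auto simp: galois_object_def)
  obtain u Z where A: "normalised_frame G g \<chi> \<mu> sH \<iota> y \<Delta> \<epsilon> S sA \<rho>A u Z" and u1: "u \<one>\<^bsub>G\<^esub> = 1"
    by (rule monomial_galois.normalised_frame_exists[OF galois[OF assms(4)]])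
  obtain v Z' where B: "normalised_frame G g \<chi> \<mu> sH \<iota> y \<Delta> \<epsilon> S sB \<rho>B v Z'" and v1: "v \<one>\<^bsub>G\<^esub> = 1"
    by (rule monomial_galois.normalised_frame_exists[OF galois[OF assms(5)]])
  interpret A: normalised_frame G g \<chi> \<mu> sH \<iota> y \<Delta> \<epsilon> S sA \<rho>A u Z by (rule A)
  interpret B: normalised_frame G g \<chi> \<mu> sH \<iota> y \<Delta> \<epsilon> S sB \<rho>B v Z' by (rule B)
  note T = assms(3)
  let ?a = A.top_coeff and ?b = B.top_coeff
  have ab: "?a = 0 \<longleftrightarrow> ?b = 0"
    using A.test_poly_identity_iff(2)[OF u1 T, of "[]" "[]" 0 0]
      B.test_poly_identity_iff(2)[OF v1 T, of "[]" "[]" 0 0] assms(6) by simp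
  \<comment> \<open>The rescaling \<open>t\<close> must turn the cocycle of \<open>B\<close> into that of \<open>A\<close>, and \<open>t\<^sub>\<gamma> ?a = ?b\<close>.  Multiplied out, this
    requires the value \<open>val xs zs m n\<close> for the product of the \<open>t\<^sub>x\<close> over \<open>content xs m\<close> divided by that over
    \<open>content zs n\<close>.  If \<open>?a = ?b = 0\<close> nothing further is required of \<open>t\<^sub>\<gamma>\<close>, and only \<open>m = n = 0\<close> is admitted.\<close>
  define r where "r = ?b / ?a"
  define val where "val xs zs m n = (A.word_coeff xs * B.word_coeff zs * r ^ m) /
      (A.word_coeff zs * B.word_coeff xs * r ^ n)" for xs zs and m n :: nat
  define content where "content xs m = mset xs + replicate_mset m M.\<gamma>" for xs and m :: nat
  define adm where "adm xs zs m n \<longleftrightarrow> set xs \<subseteq> carrier G \<and> set zs \<subseteq> carrier G \<and> A.deg xs = A.deg zs \<and>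
      (?a = 0 \<longrightarrow> m = 0 \<and> n = 0)" for xs zs and m n :: nat
  define P where "P w c \<longleftrightarrow> (\<exists>xs zs m n. adm xs zs m n \<and>
      w = (\<lambda>i. int (count (content xs m) i) - int (count (content zs n) i)) \<and> c = val xs zs m n)" for w c
  have nz: "A.word_coeff xs \<noteq> 0" "B.word_coeff xs \<noteq> 0" if "set xs \<subseteq> carrier G" for xs
    using A.word_coeff_nonzero[OF u1 that] B.word_coeff_nonzero[OF v1 that] by auto
  have r_power: "r ^ m \<noteq> 0" "r ^ n \<noteq> 0" if "adm xs zs m n" for xs zs m n
    using that ab by (auto simp: adm_def r_def)
  have "\<exists>t. (\<forall>i. t i \<noteq> 0) \<and> (\<forall>w c. P w c \<longrightarrow> (\<Prod>i\<in>carrier G. t i powi w i) = c)"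
  proof (rule character_extends[OF M.finG])
    fix w w' c c' assume "P w c" "P w' c'"
    then obtain xs zs m n xs' zs' m' n' where 1: "adm xs zs m n" "adm xs' zs' m' n'"
      and w: "w = (\<lambda>i. int (count (content xs m) i) - int (count (content zs n) i))"
        "w' = (\<lambda>i. int (count (content xs' m') i) - int (count (content zs' n') i))"
      and c: "c = val xs zs m n" "c' = val xs' zs' m' n'" unfolding P_def by blast
    have sets: "set xs \<subseteq> carrier G" "set zs \<subseteq> carrier G" "set xs' \<subseteq> carrier G" "set zs' \<subseteq> carrier G"
      and degs: "A.deg xs = A.deg zs" "A.deg xs' = A.deg zs'" using 1 by (auto simp: adm_def)
    have adm: "adm (xs @ xs') (zs @ zs') (m + m') (n + n')"
      using 1 M.deg_append[OF sets(1,3)] M.deg_append[OF sets(2,4)] by (auto simp: adm_def)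
    note nzs = nz[OF sets(1)] nz[OF sets(2)] nz[OF sets(3)] nz[OF sets(4)]
      nz[of "xs @ xs'"] nz[of "zs @ zs'"] r_power[OF 1(1)] r_power[OF 1(2)]
    have "A.word_coeff (xs @ xs') / A.word_coeff (zs @ zs') =
        (A.word_coeff xs * A.word_coeff xs') / (A.word_coeff zs * A.word_coeff zs')"
      using A.word_coeff_append[OF u1 sets degs] nzs sets by (simp add: frac_eq_eq mult_ac)
    moreover have "B.word_coeff (zs @ zs') / B.word_coeff (xs @ xs') =
        (B.word_coeff zs * B.word_coeff zs') / (B.word_coeff xs * B.word_coeff xs')"
      using B.word_coeff_append[OF v1 sets degs] nzs sets by (simp add: frac_eq_eq mult_ac)
    moreover have val: "val xs zs m n = (A.word_coeff xs / A.word_coeff zs) * (B.word_coeff zs / B.word_coeff xs) *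
        (r ^ m / r ^ n)" for xs zs m n
      by (simp add: val_def)
    moreover have "c * c' = (A.word_coeff xs * A.word_coeff xs') / (A.word_coeff zs * A.word_coeff zs') *
        ((B.word_coeff zs * B.word_coeff zs') / (B.word_coeff xs * B.word_coeff xs')) *
        (r ^ (m + m') / r ^ (n + n'))"
      by (simp add: c val_def power_add mult_ac)
    ultimately have "c * c' = val (xs @ xs') (zs @ zs') (m + m') (n + n')"
      by (simp only:)
    moreover have "(\<lambda>i. w i + w' i) = (\<lambda>i. int (count (content (xs @ xs') (m + m')) i) -
        int (count (content (zs @ zs') (n + n')) i))"
      by (auto simp: w content_def)
    ultimately show "P (\<lambda>i. w i + w' i) (c * c')" unfolding P_def using adm by blast
  next
    fix w c assume "P w c"
    then obtain xs zs m n where 1: "adm xs zs m n"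
      and w: "w = (\<lambda>i. int (count (content xs m) i) - int (count (content zs n) i))"
      and c: "c = val xs zs m n" unfolding P_def by blast
    have "adm zs xs n m" using 1 by (auto simp: adm_def)
    moreover have "inverse c = val zs xs n m" by (simp add: c val_def mult_ac)
    moreover have "(\<lambda>i. - w i) = (\<lambda>i. int (count (content zs n) i) - int (count (content xs m) i))"
      by (simp add: w)
    ultimately show "P (\<lambda>i. - w i) (inverse c)" unfolding P_def by blast
    show "c \<noteq> 0" using nz r_power[OF 1] 1 by (simp add: c val_def adm_def)
    show "w i = 0" if "i \<notin> carrier G" for i
    proof -
      have "i \<notin> set xs" "i \<notin> set zs" "i \<noteq> M.\<gamma>" using 1 that by (auto simp: adm_def)
      then have "count (content xs m) i = 0" "count (content zs n) i = 0"
        by (simp_all add: content_def count_eq_zero_iff)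
      then show ?thesis by (simp only: w diff_self)
    qed
  next
    fix c assume "P (\<lambda>_. 0) c"
    then obtain xs zs m n where 1: "adm xs zs m n"
      and 0: "(\<lambda>_. 0) = (\<lambda>i. int (count (content xs m) i) - int (count (content zs n) i))"
      and c: "c = val xs zs m n" unfolding P_def by blast
    have cont: "content xs m = content zs n"
      using fun_cong[OF 0] by (intro multiset_eqI) simp
    have sets: "set xs \<subseteq> carrier G" "set zs \<subseteq> carrier G" and deg: "A.deg xs = A.deg zs"
      using 1 by (auto simp: adm_def)
    have a: "?a ^ m \<noteq> 0" "?b ^ n \<noteq> 0" "?a ^ n \<noteq> 0" "?b ^ m \<noteq> 0" using 1 ab by (auto simp: adm_def)
    note nzs = nz[OF sets(1)] nz[OF sets(2)]
    \<comment> \<open>the constant for which the test polynomial is an identity of \<open>A\<close>\<close>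
    define e where "e = (?a ^ n * A.word_coeff xs) / (?a ^ m * A.word_coeff zs)"
    have "?a ^ n * A.word_coeff xs = e * (?a ^ m * A.word_coeff zs)" using a nzs by (simp add: e_def)
    then have "M.test_poly sT X m n e xs zs \<in> polynomial_identities sH sT \<delta> sA \<rho>A"
      using A.test_poly_identity_iff(1)[OF u1 T sets deg cont[unfolded content_def]] by blast
    then have "?b ^ n * B.word_coeff xs = e * (?b ^ m * B.word_coeff zs)"
      using B.test_poly_identity_iff(1)[OF v1 T sets deg cont[unfolded content_def]] assms(6) by blast
    then have "?b ^ n * B.word_coeff xs * (?a ^ m * A.word_coeff zs) =
        e * (?a ^ m * A.word_coeff zs) * (?b ^ m * B.word_coeff zs)"
      by (simp only: mult_ac)
    moreover have "e * (?a ^ m * A.word_coeff zs) = ?a ^ n * A.word_coeff xs"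
      using a nzs by (simp add: e_def)
    ultimately have eq: "?b ^ n * B.word_coeff xs * (?a ^ m * A.word_coeff zs) =
        ?a ^ n * A.word_coeff xs * (?b ^ m * B.word_coeff zs)"
      by (simp only:)
    have r: "?b ^ m = r ^ m * ?a ^ m" "?b ^ n = r ^ n * ?a ^ n"
      using a by (simp_all add: r_def power_divide)
    have "?a ^ m * ?a ^ n * (A.word_coeff xs * B.word_coeff zs * r ^ m) =
        ?a ^ m * ?a ^ n * (A.word_coeff zs * B.word_coeff xs * r ^ n)"
      using eq unfolding r by (simp only: mult_ac)
    then have "A.word_coeff xs * B.word_coeff zs * r ^ m = A.word_coeff zs * B.word_coeff xs * r ^ n"
      by (simp only: mult_cancel_left mult_eq_0_iff a(1,3) simp_thms)
    then show "c = 1" using nzs r_power(2)[OF 1] by (simp add: c val_def)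
  qed
  then obtain t where t: "\<And>i. t i \<noteq> 0" and tP: "\<And>w c. P w c \<Longrightarrow> (\<Prod>i\<in>carrier G. t i powi w i) = c"
    by blast
  have t_val: "prod_mset (image_mset t (content xs m)) / prod_mset (image_mset t (content zs n)) = val xs zs m n"
    if adm: "adm xs zs m n" for xs zs m n
  proof -
    have "set_mset (content xs m) \<subseteq> carrier G" "set_mset (content zs n) \<subseteq> carrier G"
      using adm by (auto simp: adm_def content_def split: if_splits)
    note prod = prod_powi_difference[OF M.finG t this]
    have "P (\<lambda>i. int (count (content xs m) i) - int (count (content zs n) i)) (val xs zs m n)"
      unfolding P_def using adm by blast
    from tP[OF this] show ?thesis unfolding prod .
  qed
  have B': "normalised_frame G g \<chi> \<mu> sH \<iota> y \<Delta> \<epsilon> S sB \<rho>B (\<lambda>x. sB (t x) (v x)) Z'"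
    by (rule B.rescaled_frame) (rule t)
  have cocycle: "\<exists>c. u x * u z = sA c (u (x \<otimes>\<^bsub>G\<^esub> z)) \<and>
      sB (t x) (v x) * sB (t z) (v z) = sB c (sB (t (x \<otimes>\<^bsub>G\<^esub> z)) (v (x \<otimes>\<^bsub>G\<^esub> z)))"
    if x: "x \<in> carrier G" and z: "z \<in> carrier G" for x z
  proof -
    let ?xz = "x \<otimes>\<^bsub>G\<^esub> z"
    have xz: "?xz \<in> carrier G" using x z by simp
    have "adm [x, z] [?xz] 0 0" using x z by (simp add: adm_def)
    from t_val[OF this] have "t x * t z / t ?xz = A.word_coeff [x, z] / B.word_coeff [x, z]"
      by (simp add: content_def val_def A.word_coeff_single[OF u1 xz] B.word_coeff_single[OF v1 xz])
    then have *: "t x * t z * B.word_coeff [x, z] = A.word_coeff [x, z] * t ?xz"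
      using t[of ?xz] nz[of "[x, z]"] x z by (simp add: field_simps)
    have "u x * u z = sA (A.word_coeff [x, z]) (u ?xz)"
      using A.word_coeff[OF u1, of "[x, z]"] x z by simp
    moreover have "v x * v z = sB (B.word_coeff [x, z]) (v ?xz)"
      using B.word_coeff[OF v1, of "[x, z]"] x z by simp
    ultimately show ?thesis
      by (intro exI[of _ "A.word_coeff [x, z]"]) (simp add: B.scale_mult_scale * )
  qed
  have "?b = ?a * t M.\<gamma>"
  proof (cases "?a = 0")
    case False
    then have "adm [] [] 1 0" by (simp add: adm_def)
    from t_val[OF this] have "t M.\<gamma> = r"
      by (simp add: content_def val_def A.word_coeff_Nil[OF u1] B.word_coeff_Nil[OF v1])
    with False show ?thesis by (simp add: r_def)
  qed (use ab in simp)
  then have top: "Z' ^ M.d = sB \<mu> 1 + sB ?a (sB (t M.\<gamma>) (v M.\<gamma>))" using B.Z_power_d by simp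
  show ?thesis by (rule M.frames_isomorphic[OF A B' _ A.Z_power_d top]) (rule cocycle)
qed

end
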